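(* There is a constant $C>0$ depending only on the coefficients $a,b,c$ (not on $f$, $u$, $\kappa$, $N$ or the mesh) such that, for every positive constant $\kappa$ (independent of $i$ and $N$) and every quasi-equidistributing mesh with $N$ elements, i.e. every mesh satisfying $$\frac{N\rho_ih_i}{\sigma_h}\le\kappa,\qquad i=1,\dots,N$$ (where $\rho_i,\sigma_h,\alpha_h$ are computed from the linear finite element solution $u_h$ on that same mesh), one has $$\|(u-u_h)'\|_\Omega\le\frac{C\sqrt{\alpha_h\kappa^3}}{N},$$ where $\alpha_h$ satisfies (for quasi-equidistributing meshes with fixed $\kappa$ and $N$ elements, $N\to\infty$) $$\lim_{N\to\infty}\sqrt{\alpha_h}=\|r\|_{L^{2/3}(\Omega)}.$$ If further $r'\in L^1(\Omega)$, then there exists a constant $c_*>0$, depending only on $a,b,c$, such that for $N>\kappa c_*$ and every such mesh, $$\Big(1+\big(\tfrac{\kappa c_*}{N}\big)^{2/3}\Big)^{-3/2}\|r\|_{L^{2/3}(\Omega)}\le\sqrt{\alpha_h}\le\Big(1-\big(\tfrac{\kappa c_*}{N}\big)^{2/3}\Big)^{-3/2}\Big[\|r\|_{L^{2/3}(\Omega)}^{2/3}+\Big(\frac{\kappa c_*\|r'\|_{L^1(\Omega)}}{N}\Big)^{2/3}\Big]^{3/2}.$$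
   Context: Let $\Omega=(0,1)$. The functions $a,b\in W^{1,\infty}(\Omega)$, $c\in L^\infty(\Omega)$, $f\in L^2(\Omega)$ satisfy $a(x)\ge a_0>0$ and $c(x)-\frac12 b'(x)\ge 0$ a.e. in $\Omega$ for some constant $a_0$; $f$ is not a.e. zero. Put $B(w,v)=\int_\Omega(aw'v'+bw'v+cwv)\,dx$ and $(f,v)=\int_\Omega fv\,dx$. $u\in V=H_0^1(\Omega)$ is the solution of $B(u,v)=(f,v)$ for all $v\in V$ (weak form of $-(au')'+bu'+cu=f$, $u(0)=u(1)=0$). A mesh with $N$ elements is $0=x_0<x_1<\dots<x_N=1$, with $h_i=x_i-x_{i-1}$ and $K_i=(x_{i-1},x_i)$. $V_h$ is the space of continuous functions on $[0,1]$ that are linear on each $K_i$ and vanish at $0$ and $1$; $u_h\in V_h$ is the finite element solution: $B(u_h,v_h)=(f,v_h)$ for all $v_h\in V_h$. $r=f+a'u'-bu'-cu$ and $r_h=f+a'u_h'-bu_h'-cu_h$ (with $u_h'$ taken elementwise). Further $\langle r_h\rangle_i=\big(\frac1{h_i}\int_{K_i}|r_h|^2dx\big)^{1/2}$, $\alpha_h=\big[\sum_{i=1}^N h_i\langle r_h\rangle_i^{2/3}\big]^3$, $\rho_i=\big(1+\frac1{\alpha_h}\langle r_h\rangle_i^2\big)^{1/3}$, $\rho$ is the piecewise constant function equal to $\rho_i$ on $K_i$, and $\sigma_h=\sum_{i=1}^N\rho_ih_i$. $\|\cdot\|_\Omega$ is the $L^2(\Omega)$ norm; $\|v\|_{L^p(\Omega)}=(\int_\Omega|v|^pdx)^{1/p}$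 also for $0<p<1$. *)

theory Defs
  imports "HOL-Analysis.Analysis"
begin

text \<open>
  Functions on \<open>\<Omega> = (0,1)\<close> are represented by functions of type \<open>real \<Rightarrow> real\<close>; their values
  outside \<open>\<Omega>\<close> are irrelevant. Elements of a Sobolev space are pairs \<open>v\<close>, \<open>dv\<close>, where \<open>dv\<close> is
  (a representative of) the weak derivative of \<open>v\<close>.
\<close>

abbreviation Omega :: "real set" where
  "Omega \<equiv> {0<..<1}"

abbreviation dx_Omega :: "real measure" where
  "dx_Omega \<equiv> lebesgue_on Omega"

definition Lp :: "real \<Rightarrow> (real \<Rightarrow> real) set" where
  "Lp p = {v \<in> borel_measurable dx_Omega. integrable dx_Omega (\<lambda>x. \<bar>v x\<bar> powr p)}"

definition Linf :: "(real \<Rightarrow> real) set" where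
  "Linf = {v \<in> borel_measurable dx_Omega. \<exists>M. AE x in dx_Omega. \<bar>v x\<bar> \<le> M}"

text \<open>Only a quasi-norm for \<open>0 < p < 1\<close>.\<close>

definition Lp_norm :: "real \<Rightarrow> (real \<Rightarrow> real) \<Rightarrow> real" where
  "Lp_norm p v = (LINT x|dx_Omega. \<bar>v x\<bar> powr p) powr (1 / p)"

definition inner_L2 :: "(real \<Rightarrow> real) \<Rightarrow> (real \<Rightarrow> real) \<Rightarrow> real" where
  "inner_L2 f v = (LINT x|dx_Omega. f x * v x)"

text \<open>The space \<open>C\<^sub>c\<^sup>\<infinity>(\<Omega>)\<close>, extended by zero to the real line.\<close>

definition test_funs :: "(real \<Rightarrow> real) set" where
  "test_funs = {\<phi>. (\<forall>n x. (deriv ^^ n) \<phi> differentiable (at x)) \<and>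
                   (\<exists>K. compact K \<and> K \<subseteq> Omega \<and> (\<forall>x. x \<notin> K \<longrightarrow> \<phi> x = 0))}"

definition locally_integrable :: "(real \<Rightarrow> real) \<Rightarrow> bool" where
  "locally_integrable v \<longleftrightarrow> (\<forall>K. compact K \<and> K \<subseteq> Omega \<longrightarrow> integrable (lebesgue_on K) v)"

definition has_weak_deriv :: "(real \<Rightarrow> real) \<Rightarrow> (real \<Rightarrow> real) \<Rightarrow> bool" where
  "has_weak_deriv v dv \<longleftrightarrow> locally_integrable v \<and> locally_integrable dv \<and>
     (\<forall>\<phi>\<in>test_funs. (LINT x|dx_Omega. v x * deriv \<phi> x) = - (LINT x|dx_Omega. dv x * \<phi> x))"

definition W1inf :: "(real \<Rightarrow> real) \<Rightarrow> (real \<Rightarrow> real) \<Rightarrow> bool" where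
  "W1inf v dv \<longleftrightarrow> v \<in> Linf \<and> dv \<in> Linf \<and> has_weak_deriv v dv"

definition H1 :: "(real \<Rightarrow> real) \<Rightarrow> (real \<Rightarrow> real) \<Rightarrow> bool" where
  "H1 v dv \<longleftrightarrow> v \<in> Lp 2 \<and> dv \<in> Lp 2 \<and> has_weak_deriv v dv"

text \<open>\<open>H\<^sub>0\<^sup>1(\<Omega>)\<close> is the closure of the test functions in \<open>H\<^sup>1(\<Omega>)\<close>.\<close>

definition H10 :: "(real \<Rightarrow> real) \<Rightarrow> (real \<Rightarrow> real) \<Rightarrow> bool" where
  "H10 v dv \<longleftrightarrow> H1 v dv \<and>
     (\<exists>\<phi>::nat \<Rightarrow> real \<Rightarrow> real. (\<forall>k. \<phi> k \<in> test_funs) \<and>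
        (\<lambda>k. Lp_norm 2 (\<lambda>x. v x - \<phi> k x)) \<longlonglongrightarrow> 0 \<and>
        (\<lambda>k. Lp_norm 2 (\<lambda>x. dv x - deriv (\<phi> k) x)) \<longlonglongrightarrow> 0)"

definition B_form :: "(real \<Rightarrow> real) \<Rightarrow> (real \<Rightarrow> real) \<Rightarrow> (real \<Rightarrow> real) \<Rightarrow>
    (real \<Rightarrow> real) \<Rightarrow> (real \<Rightarrow> real) \<Rightarrow> (real \<Rightarrow> real) \<Rightarrow> (real \<Rightarrow> real) \<Rightarrow> real" where
  "B_form a b c w dw v dv =
     (LINT x|dx_Omega. a x * dw x * dv x + b x * dw x * v x + c x * w x * v x)"

definition weak_solution :: "(real \<Rightarrow> real) \<Rightarrow> (real \<Rightarrow> real) \<Rightarrow> (real \<Rightarrow> real) \<Rightarrow>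
    (real \<Rightarrow> real) \<Rightarrow> (real \<Rightarrow> real) \<Rightarrow> (real \<Rightarrow> real) \<Rightarrow> bool" where
  "weak_solution a b c f u du \<longleftrightarrow> H10 u du \<and>
     (\<forall>v dv. H10 v dv \<longrightarrow> B_form a b c u du v dv = inner_L2 f v)"

definition mesh :: "nat \<Rightarrow> (nat \<Rightarrow> real) \<Rightarrow> bool" where
  "mesh N X \<longleftrightarrow> X 0 = 0 \<and> X N = 1 \<and> (\<forall>i\<in>{1..N}. X (i - 1) < X i)"

definition elem_size :: "(nat \<Rightarrow> real) \<Rightarrow> nat \<Rightarrow> real" where
  "elem_size X i = X i - X (i - 1)"

definition elem :: "(nat \<Rightarrow> real) \<Rightarrow> nat \<Rightarrow> real set" where
  "elem X i = {X (i - 1)<..<X i}"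

definition Vh :: "nat \<Rightarrow> (nat \<Rightarrow> real) \<Rightarrow> (real \<Rightarrow> real) set" where
  "Vh N X = {v. continuous_on {0..1} v \<and>
                (\<forall>i\<in>{1..N}. \<exists>p q. \<forall>x\<in>elem X i. v x = p * x + q) \<and> v 0 = 0 \<and> v 1 = 0}"

text \<open>
  For \<open>v\<close> in \<open>Vh N X\<close> the classical derivative \<open>deriv v\<close> is the elementwise derivative on every
  open element, that is, everywhere in \<open>\<Omega>\<close> except possibly at the finitely many mesh points.
\<close>

definition fem_solution :: "(real \<Rightarrow> real) \<Rightarrow> (real \<Rightarrow> real) \<Rightarrow> (real \<Rightarrow> real) \<Rightarrow>
    (real \<Rightarrow> real) \<Rightarrow> nat \<Rightarrow> (nat \<Rightarrow> real) \<Rightarrow> (real \<Rightarrow> real) \<Rightarrow> bool" where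
  "fem_solution a b c f N X uh \<longleftrightarrow> uh \<in> Vh N X \<and>
     (\<forall>vh\<in>Vh N X. B_form a b c uh (deriv uh) vh (deriv vh) = inner_L2 f vh)"

text \<open>
  The function \<open>f + a'w' - bw' - cw\<close>, with \<open>da\<close> for \<open>a'\<close> and \<open>dw\<close> for \<open>w'\<close>: this is \<open>r\<close> for the
  solution \<open>w = u\<close> and \<open>r\<^sub>h\<close> for the finite element solution \<open>w = u\<^sub>h\<close>.
\<close>

definition residual :: "(real \<Rightarrow> real) \<Rightarrow> (real \<Rightarrow> real) \<Rightarrow> (real \<Rightarrow> real) \<Rightarrow>
    (real \<Rightarrow> real) \<Rightarrow> (real \<Rightarrow> real) \<Rightarrow> (real \<Rightarrow> real) \<Rightarrow> real \<Rightarrow> real" where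
  "residual da b c f w dw = (\<lambda>x. f x + da x * dw x - b x * dw x - c x * w x)"

definition elem_avg :: "(nat \<Rightarrow> real) \<Rightarrow> (real \<Rightarrow> real) \<Rightarrow> nat \<Rightarrow> real" where
  "elem_avg X rh i = sqrt (1 / elem_size X i * (LINT x|lebesgue_on (elem X i). \<bar>rh x\<bar>\<^sup>2))"

definition alpha_h :: "nat \<Rightarrow> (nat \<Rightarrow> real) \<Rightarrow> (real \<Rightarrow> real) \<Rightarrow> real" where
  "alpha_h N X rh = (\<Sum>i=1..N. elem_size X i * elem_avg X rh i powr (2 / 3)) ^ 3"

definition rho :: "nat \<Rightarrow> (nat \<Rightarrow> real) \<Rightarrow> (real \<Rightarrow> real) \<Rightarrow> nat \<Rightarrow> real" where
  "rho N X rh i = (1 + 1 / alpha_h N X rh * (elem_avg X rh i)\<^sup>2) powr (1 / 3)"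

definition sigma_h :: "nat \<Rightarrow> (nat \<Rightarrow> real) \<Rightarrow> (real \<Rightarrow> real) \<Rightarrow> real" where
  "sigma_h N X rh = (\<Sum>i=1..N. rho N X rh i * elem_size X i)"

definition quasi_equidistributing :: "real \<Rightarrow> nat \<Rightarrow> (nat \<Rightarrow> real) \<Rightarrow> (real \<Rightarrow> real) \<Rightarrow> bool" where
  "quasi_equidistributing \<kappa> N X rh \<longleftrightarrow> mesh N X \<and>
     (\<forall>i\<in>{1..N}. real N * rho N X rh i * elem_size X i / sigma_h N X rh \<le> \<kappa>)"

end

theory Submission
  imports Defs
begin

text \<open>
  Write \<open>e = u - u\<^sub>h\<close>, \<open>A = \<Sum>h\<^sub>i\<langle>r\<^sub>h\<rangle>\<^sub>i\<^bsup>2/3\<^esup>\<close> (so that \<open>\<alpha>\<^sub>h = A\<^sup>3\<close>), \<open>S = \<Sum>h\<^sub>i\<langle>r\<rangle>\<^sub>i\<^bsup>2/3\<^esup>\<close> and \<open>R = \<integral>|r|\<^bsup>2/3\<^esup>\<close>.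

  \<^bold>\<open>Error bound.\<close> Coercivity, Galerkin orthogonality and elementwise integration by parts give
  \<open>a\<^sub>0\<parallel>e'\<parallel>\<^sup>2 \<le> B(e,e) = \<integral>r\<^sub>h (e - \<Pi>e)\<close> with the linear interpolant \<open>\<Pi>e\<close>, hence
  \<open>a\<^sub>0\<parallel>e'\<parallel> \<le> (\<Sum>h\<^sub>i\<^sup>3\<langle>r\<^sub>h\<rangle>\<^sub>i\<^sup>2)\<^bsup>1/2\<^esup>\<close> (\<open>error_estimate\<close>). On a quasi-equidistributing mesh the right-hand side is at
  most \<open>\<surd>8 \<kappa>\<surd>\<alpha>\<^sub>h/N\<close>, \<open>h\<^sub>i \<le> 2\<kappa>/N\<close>, and necessarily \<open>\<kappa> \<ge> 1\<close> (\<open>quasi_equidistributing_bounds\<close>).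

  \<^bold>\<open>Asymptotics.\<close> The difference \<open>r - r\<^sub>h\<close> is linear in \<open>(e, e')\<close>, so \<open>\<parallel>r - r\<^sub>h\<parallel> \<le> c\<^sub>*\<kappa>\<surd>\<alpha>\<^sub>h/N\<close>. As \<open>t\<^bsup>2/3\<^esup>\<close> is
  subadditive and concave, \<open>|A - S| \<le> \<parallel>r - r\<^sub>h\<parallel>\<^bsup>2/3\<^esup> \<le> \<epsilon>A\<close> with \<open>\<epsilon> = (\<kappa>c\<^sub>*/N)\<^bsup>2/3\<^esup>\<close> (\<open>avg_sum_le_add\<close>); thus the
  unknown \<open>A\<close> is compared with the quantity \<open>S\<close>, in which \<open>r\<close> does not depend on the mesh. Jensen's inequality
  gives \<open>R \<le> S\<close>, and if \<open>r' \<in> L\<^sup>1\<close> then \<open>S \<le> R + (max h\<^sub>i \<parallel>r'\<parallel>\<^sub>1)\<^bsup>2/3\<^esup>\<close> (\<open>avg_sum_le_frac_int\<close>). These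
  inequalities are the two-sided bound. Without a derivative, \<open>S\<close> still tends to \<open>R\<close> because the
  test functions are dense in \<open>L\<^sup>2\<close> (\<open>avg_sum_tendsto\<close>).

  \<^bold>\<open>Sobolev functions.\<close> All facts about weak derivatives are reduced to the density of the test functions
  (\<open>test_funs_dense\<close>), from which it follows that \<open>H\<^sub>0\<^sup>1(\<Omega>)\<close> consists of the primitives of
  square integrable functions with mean zero (\<open>H10_iff\<close>) and that an integrable weak derivative determines a
  function up to a constant (\<open>weak_deriv_L1_prim\<close>).
\<close>

section \<open>Smooth functions and test functions\<close>

text \<open>Infinitely often differentiable functions on the whole line.\<close>

definition smooth :: "(real \<Rightarrow> real) \<Rightarrow> bool" where
  "smooth f \<longleftrightarrow> (\<forall>n x. (deriv ^^ n) f differentiable (at x))"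

text \<open>
  A set of functions that contains a derivative of each of its members consists of smooth functions.
  This makes explicit formulas for higher derivatives unnecessary.
\<close>

lemma smooth_coinduct:
  assumes "f \<in> S"
    and step: "\<And>g. g \<in> S \<Longrightarrow> \<exists>g'\<in>S. \<forall>x. (g has_real_derivative g' x) (at x)"
  shows "smooth f"
proof -
  have "(deriv ^^ n) f \<in> S" for n
  proof (induction n)
    case (Suc n)
    obtain g' where "g' \<in> S" and g': "\<And>x. ((deriv ^^ n) f has_real_derivative g' x) (at x)"
      using step[OF Suc] by blast
    have "deriv ((deriv ^^ n) f) = g'"
      using g' by (intro ext DERIV_imp_deriv)
    with \<open>g' \<in> S\<close> show ?case by simp
  qed (simp add: assms)
  then show ?thesis
    unfolding smooth_def using step by (metis real_differentiable_def)
qed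

lemma smooth_DERIV: "smooth f \<Longrightarrow> (f has_real_derivative deriv f x) (at x)"
  unfolding smooth_def
  by (metis DERIV_deriv_iff_real_differentiable funpow_0)

lemma smooth_deriv: "smooth f \<Longrightarrow> smooth (deriv f)"
  unfolding smooth_def
  by (metis funpow_simps_right(2) comp_apply)

lemma smooth_antiderivative:
  assumes "\<And>x. (F has_real_derivative g x) (at x)" "smooth g"
  shows "smooth F"
proof -
  have "deriv F = g"
    using assms(1) by (intro ext DERIV_imp_deriv)
  then have "(deriv ^^ n) F differentiable (at x)" for n x
    using assms by (cases n) (auto simp: smooth_def real_differentiable_def funpow_swap1)
  then show ?thesis by (simp add: smooth_def)
qed

text \<open>
  The algebra generated by the smooth functions is closed under differentiation by the sum and
  product rules, so it consists of smooth functions again.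
\<close>

inductive_set smooth_algebra :: "(real \<Rightarrow> real) set" where
  base: "smooth f \<Longrightarrow> f \<in> smooth_algebra"
| add: "f \<in> smooth_algebra \<Longrightarrow> g \<in> smooth_algebra \<Longrightarrow> (\<lambda>x. f x + g x) \<in> smooth_algebra"
| mult: "f \<in> smooth_algebra \<Longrightarrow> g \<in> smooth_algebra \<Longrightarrow> (\<lambda>x. f x * g x) \<in> smooth_algebra"

lemma smooth_algebra_smooth:
  assumes "f \<in> smooth_algebra"
  shows "smooth f"
  using assms
proof (rule smooth_coinduct)
  fix g assume "g \<in> smooth_algebra"
  then show "\<exists>g'\<in>smooth_algebra. \<forall>x. (g has_real_derivative g' x) (at x)"
  proof induction
    case (base f)
    then show ?case
      by (meson smooth_DERIV smooth_algebra.base smooth_deriv)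
  next
    case (add f g)
    then obtain f' g' where "f' \<in> smooth_algebra" "g' \<in> smooth_algebra"
      "\<forall>x. (f has_real_derivative f' x) (at x)" "\<forall>x. (g has_real_derivative g' x) (at x)"
      by blast
    then show ?case
      by (intro bexI[of _ "\<lambda>x. f' x + g' x"]) (auto intro: smooth_algebra.add DERIV_add)
  next
    case (mult f g)
    then obtain f' g' where "f' \<in> smooth_algebra" "g' \<in> smooth_algebra"
      "\<forall>x. (f has_real_derivative f' x) (at x)" "\<forall>x. (g has_real_derivative g' x) (at x)"
      by blast
    then show ?case using mult.hyps
      by (intro bexI[of _ "\<lambda>x. f' x * g x + g' x * f x"])
         (auto intro!: smooth_algebra.add smooth_algebra.mult DERIV_mult)
  qed
qed

lemma smooth_add: "smooth f \<Longrightarrow> smooth g \<Longrightarrow> smooth (\<lambda>x. f x + g x)"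
  by (simp add: smooth_algebra_smooth smooth_algebra.add smooth_algebra.base)

lemma smooth_mult: "smooth f \<Longrightarrow> smooth g \<Longrightarrow> smooth (\<lambda>x. f x * g x)"
  by (simp add: smooth_algebra_smooth smooth_algebra.mult smooth_algebra.base)

lemma smooth_const: "smooth (\<lambda>x. c)"
  by (rule smooth_coinduct[of _ "range (\<lambda>c x. c)"]) (auto intro!: exI[of _ 0])

lemma smooth_id: "smooth (\<lambda>x. x)"
  by (rule smooth_antiderivative[of _ "\<lambda>x. 1"]) (auto intro: smooth_const)

lemma smooth_cmult: "smooth f \<Longrightarrow> smooth (\<lambda>x. c * f x)"
  by (intro smooth_mult smooth_const)

lemma smooth_diff: "smooth f \<Longrightarrow> smooth g \<Longrightarrow> smooth (\<lambda>x. f x - g x)"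
  using smooth_add[of f "\<lambda>x. (-1) * g x"] smooth_cmult[of g "-1"] by simp

lemma smooth_affine:
  assumes "smooth f"
  shows "smooth (\<lambda>x. f (p * x + q))"
proof (rule smooth_coinduct[of _ "{\<lambda>x. c * g (p * x + q) |c g. smooth g}"])
  show "(\<lambda>x. f (p * x + q)) \<in> {\<lambda>x. c * g (p * x + q) |c g. smooth g}"
    using assms by (auto intro!: exI[of _ "1::real"] exI[of _ f])
next
  fix h assume "h \<in> {\<lambda>x. c * g (p * x + q) |c g. smooth g}"
  then obtain c g where h: "h = (\<lambda>x. c * g (p * x + q))" and g: "smooth g" by auto
  have "(h has_real_derivative (c * p) * deriv g (p * x + q)) (at x)" for x
    unfolding h
    by (auto intro!: derivative_eq_intros DERIV_chain2[OF smooth_DERIV[OF g]])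
  then show "\<exists>g'\<in>{\<lambda>x. c * g (p * x + q) |c g. smooth g}. \<forall>x. (h has_real_derivative g' x) (at x)"
    using smooth_deriv[OF g]
    by (intro bexI[of _ "\<lambda>x. (c * p) * deriv g (p * x + q)"]) auto
qed

lemma smooth_real_polynomial_function:
  assumes "real_polynomial_function (f :: real \<Rightarrow> real)"
  shows "smooth f"
  using assms
proof induction
  case (linear f)
  then have "f = (\<lambda>x. f 1 * x)"
    by (intro ext) (metis bounded_linear.linear linear_cmul mult.commute mult.right_neutral real_scaleR_def)
  then show ?case
    using smooth_cmult[OF smooth_id, of "f 1"] by simp
qed (simp_all add: smooth_const smooth_add smooth_mult)

lemma smooth_continuous_on: "smooth f \<Longrightarrow> continuous_on A f"
  by (meson DERIV_isCont continuous_at_imp_continuous_on smooth_DERIV)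

text \<open>
  \<open>flat k x = x\<^bsup>-k\<^esup> exp (-1/x)\<close> for \<open>x > 0\<close>, extended by zero. The span of these functions is closed
  under differentiation, so \<open>flat 0\<close> is a smooth function that vanishes exactly on the closed left
  half line.
\<close>

definition flat :: "nat \<Rightarrow> real \<Rightarrow> real" where
  "flat k x = (if x > 0 then inverse x ^ k * exp (- inverse x) else 0)"

lemma flat_tendsto_0: "(flat k \<longlongrightarrow> 0) (at_right 0)"
proof -
  have "((\<lambda>x::real. inverse x ^ k / exp (inverse x)) \<longlongrightarrow> 0) (at_right 0)"
    by (rule filterlim_compose[OF tendsto_power_div_exp_0 filterlim_inverse_at_top_right])
  moreover have "\<forall>\<^sub>F x in at_right 0. inverse x ^ k / exp (inverse x) = flat k x"
    by (rule eventually_mono[OF eventually_at_right_less]) (simp add: flat_def exp_minus field_simps)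
  ultimately show ?thesis
    using Lim_transform_eventually by blast
qed

lemma flat_DERIV:
  "(flat k has_real_derivative (flat (k + 2) x - real k * flat (k + 1) x)) (at x)"
proof -
  consider "x < 0" | "x > 0" | "x = 0" by linarith
  then show ?thesis
  proof cases
    case 1
    have "((\<lambda>x. 0) has_real_derivative 0) (at x)" by simp
    then have "(flat k has_real_derivative 0) (at x)"
      by (rule has_field_derivative_transform_within_open[where S="{..<0}"])
         (use 1 in \<open>auto simp: flat_def\<close>)
    then show ?thesis using 1 by (simp add: flat_def)
  next
    case 2
    have "((\<lambda>x. inverse x ^ k * exp (- inverse x)) has_real_derivative
       (flat (k + 2) x - real k * flat (k + 1) x)) (at x)"
      using 2
      by (auto intro!: derivative_eq_intros simp: flat_def)
         (cases k; simp add: field_simps power2_eq_square)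
    then show ?thesis
      by (rule has_field_derivative_transform_within_open[where S="{0<..}"])
         (use 2 in \<open>auto simp: flat_def\<close>)
  next
    case 3
    have "((\<lambda>y. (flat k y - flat k 0) / (y - 0)) \<longlongrightarrow> 0) (at_right 0)"
      by (rule Lim_transform_eventually[OF flat_tendsto_0[of "k + 1"]])
         (auto simp: flat_def field_simps intro!: eventually_mono[OF eventually_at_right_less])
    moreover have "((\<lambda>y. (flat k y - flat k 0) / (y - 0)) \<longlongrightarrow> 0) (at_left 0)"
      by (rule Lim_transform_eventually[OF tendsto_const])
         (auto simp: flat_def eventually_at_left_field intro!: exI[of _ "-1"])
    ultimately have "((\<lambda>y. (flat k y - flat k 0) / (y - 0)) \<longlongrightarrow> 0) (at 0)"
      by (simp add: filterlim_split_at)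
    then show ?thesis
      using 3 by (simp add: has_field_derivative_iff flat_def)
  qed
qed

inductive_set flat_span :: "(real \<Rightarrow> real) set" where
  flat: "(\<lambda>x. c * flat k x) \<in> flat_span"
| add: "f \<in> flat_span \<Longrightarrow> g \<in> flat_span \<Longrightarrow> (\<lambda>x. f x + g x) \<in> flat_span"

lemma smooth_flat: "smooth (flat k)"
proof (rule smooth_coinduct[of _ flat_span])
  show "flat k \<in> flat_span"
    using flat_span.flat[of 1 k] by simp
next
  fix g assume "g \<in> flat_span"
  then show "\<exists>g'\<in>flat_span. \<forall>x. (g has_real_derivative g' x) (at x)"
  proof induction
    case (flat c k)
    have "(\<lambda>x. c * flat (k + 2) x + (- c * real k) * flat (k + 1) x) \<in> flat_span"
      by (intro flat_span.intros)
    moreover have "((\<lambda>x. c * flat k x) has_real_derivative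
        c * flat (k + 2) x + (- c * real k) * flat (k + 1) x) (at x)" for x
      using DERIV_cmult[OF flat_DERIV, of c k x] by (simp add: algebra_simps)
    ultimately show ?case
      by (intro bexI[of _ "\<lambda>x. c * flat (k + 2) x + (- c * real k) * flat (k + 1) x"] allI)
  next
    case (add f g)
    then obtain f' g' where "f' \<in> flat_span" "g' \<in> flat_span"
      "\<forall>x. (f has_real_derivative f' x) (at x)" "\<forall>x. (g has_real_derivative g' x) (at x)"
      by blast
    then show ?case
      by (intro bexI[of _ "\<lambda>x. f' x + g' x"]) (auto intro: flat_span.add DERIV_add)
  qed
qed

text \<open>
  The integral is started at \<open>-1\<close>, inside the region where the integrand vanishes, so that \<open>0\<close> is
  an interior point of the interval of integration.
\<close>

lemma antiderivative_vanishing_left: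
  fixes g :: "real \<Rightarrow> real"
  assumes "continuous_on UNIV g" and zero: "\<And>x. x < 0 \<Longrightarrow> g x = 0"
  obtains F where "\<And>x. (F has_real_derivative g x) (at x)" "\<And>x. x \<le> 0 \<Longrightarrow> F x = 0"
proof
  define F where "F x = integral {-1..x} g" for x
  have F0: "F x = 0" if "x \<le> 0" for x
  proof -
    have "integral {-1..x} g = integral {-1..x} (\<lambda>x. 0)"
      using that by (intro integral_spike[where S="{0}"]) (auto simp: zero)
    then show ?thesis by (simp add: F_def)
  qed
  then show "F x = 0" if "x \<le> 0" for x using that .
  show "(F has_real_derivative g x) (at x)" for x
  proof (cases "x < 0")
    case True
    have "((\<lambda>x. 0) has_real_derivative 0) (at x)" by simp
    then have "(F has_real_derivative 0) (at x)"
      by (rule has_field_derivative_transform_within_open[where S="{..<0}"])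
         (use True F0 in auto)
    then show ?thesis using True by (simp add: zero)
  next
    case False
    have "(F has_real_derivative g x) (at x within {-1..x+1})"
      unfolding F_def
      by (rule integral_has_real_derivative)
         (use False assms(1) in \<open>auto intro: continuous_on_subset\<close>)
    moreover have "at x within {-1..x+1} = at x"
      using False by (intro at_within_interior) auto
    ultimately show ?thesis by simp
  qed
qed

text \<open>A smooth transition from 0 to 1, the normalized antiderivative of a bump function on \<open>(0,1)\<close>.\<close>

lemma smooth_step:
  obtains S where "smooth S" "\<And>x. 0 \<le> S x \<and> S x \<le> 1"
    "\<And>x. x \<le> 0 \<Longrightarrow> S x = 0" "\<And>x. x \<ge> 1 \<Longrightarrow> S x = (1::real)"
proof -
  define p where "p x = flat 0 x * flat 0 ((-1) * x + 1)" for x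
  have smp: "smooth p"
    unfolding p_def by (intro smooth_mult smooth_flat smooth_affine)
  have p0: "p x \<ge> 0" for x by (auto simp: p_def flat_def)
  have pz: "p x = 0" if "x < 0 \<or> x > 1" for x using that by (auto simp: p_def flat_def)
  have pp: "p x > 0" if "0 < x" "x < 1" for x using that by (auto simp: p_def flat_def)
  obtain F where F: "\<And>x. (F has_real_derivative p x) (at x)" and F0: "\<And>x. x \<le> 0 \<Longrightarrow> F x = 0"
    using antiderivative_vanishing_left[OF smooth_continuous_on[OF smp]] pz by metis
  have mono: "F x \<le> F y" if "x \<le> y" for x y
    using that F p0 by (meson DERIV_nonneg_imp_nondecreasing)
  have F1: "F x = F 1" if "x \<ge> 1" for x
  proof (cases "x = 1")
    case False
    then have "1 < x" using that by simp
    then show ?thesis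
      by (rule DERIV_isconst_end)
         (use F pz in \<open>auto intro!: continuous_at_imp_continuous_on DERIV_isCont[OF F] intro: DERIV_cong\<close>)
  qed simp
  have "F (1/4) < F (3/4)"
    by (rule DERIV_pos_imp_increasing) (use F pp in \<open>auto intro!: exI\<close>)
  then have pos: "F 1 > 0"
    using mono[of 0 "1/4"] mono[of "3/4" 1] F0[of 0] by simp
  show thesis
  proof
    show "smooth (\<lambda>x. (1 / F 1) * F x)"
      by (intro smooth_cmult smooth_antiderivative[OF F smp])
    show "0 \<le> (1 / F 1) * F x \<and> (1 / F 1) * F x \<le> 1" for x
    proof -
      have "0 \<le> F x" using mono[of 0 x] F0[of x] F0[of 0] by (cases "x \<le> 0") auto
      moreover have "F x \<le> F 1" using mono[of x 1] F1[of x] by (cases "x \<le> 1") auto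
      ultimately show ?thesis using pos by (simp add: field_simps)
    qed
    show "(1 / F 1) * F x = 0" if "x \<le> 0" for x using F0[OF that] by simp
    show "(1 / F 1) * F x = 1" if "x \<ge> 1" for x using F1[OF that] pos by simp
  qed
qed

text \<open>The compact support is described by a margin \<open>\<delta>\<close> at both end points.\<close>

lemma test_funs_iff:
  "\<phi> \<in> test_funs \<longleftrightarrow> smooth \<phi> \<and> (\<exists>\<delta>>0. \<forall>x. x < \<delta> \<or> x > 1 - \<delta> \<longrightarrow> \<phi> x = 0)"
proof safe
  assume "\<phi> \<in> test_funs"
  then obtain K where sm: "smooth \<phi>" and K: "compact K" "K \<subseteq> Omega" "\<And>x. x \<notin> K \<Longrightarrow> \<phi> x = 0"
    by (auto simp: test_funs_def smooth_def)
  show "smooth \<phi>" by fact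
  show "\<exists>\<delta>>0. \<forall>x. x < \<delta> \<or> x > 1 - \<delta> \<longrightarrow> \<phi> x = 0"
  proof (cases "K = {}")
    case True
    then show ?thesis using K(3) by (auto intro!: exI[of _ 1])
  next
    case False
    obtain l where l: "l \<in> K" "\<And>x. x \<in> K \<Longrightarrow> l \<le> x"
      using compact_attains_inf[OF K(1) False] by blast
    obtain m where m: "m \<in> K" "\<And>x. x \<in> K \<Longrightarrow> x \<le> m"
      using compact_attains_sup[OF K(1) False] by blast
    have "l > 0" "m < 1" using K(2) l(1) m(1) by auto
    show ?thesis
    proof (intro exI[of _ "min l (1 - m)"] conjI allI impI)
      show "0 < min l (1 - m)" using \<open>l > 0\<close> \<open>m < 1\<close> by simp
      fix x assume "x < min l (1 - m) \<or> 1 - min l (1 - m) < x"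
      then have "x \<notin> K" using l(2)[of x] m(2)[of x] by (auto simp: min_def split: if_splits)
      then show "\<phi> x = 0" by (rule K(3))
    qed
  qed
next
  fix \<delta> :: real
  assume "smooth \<phi>" and \<delta>: "\<delta> > 0" "\<forall>x. x < \<delta> \<or> x > 1 - \<delta> \<longrightarrow> \<phi> x = 0"
  have "compact {\<delta>..1-\<delta>} \<and> {\<delta>..1-\<delta>} \<subseteq> Omega \<and> (\<forall>x. x \<notin> {\<delta>..1-\<delta>} \<longrightarrow> \<phi> x = 0)"
    using \<delta> by auto
  then show "\<phi> \<in> test_funs"
    using \<open>smooth \<phi>\<close> unfolding test_funs_def smooth_def by blast
qed

lemma test_funs_smooth: "\<phi> \<in> test_funs \<Longrightarrow> smooth \<phi>"
  by (simp add: test_funs_iff)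

lemma test_funs_mult:
  assumes "\<phi> \<in> test_funs" "smooth g"
  shows "(\<lambda>x. g x * \<phi> x) \<in> test_funs"
  using assms unfolding test_funs_iff by (auto intro: smooth_mult)

lemma test_cutoff:
  fixes \<delta> :: real
  assumes "\<delta> > 0"
  obtains \<eta> where "\<eta> \<in> test_funs" "\<And>x. 0 \<le> \<eta> x \<and> \<eta> x \<le> 1"
    "\<And>x. 2 * \<delta> \<le> x \<Longrightarrow> x \<le> 1 - 2 * \<delta> \<Longrightarrow> \<eta> x = 1"
proof -
  obtain S where S: "smooth S" "\<And>x. 0 \<le> S x \<and> S x \<le> 1"
    "\<And>x. x \<le> 0 \<Longrightarrow> S x = 0" "\<And>x. x \<ge> 1 \<Longrightarrow> S x = (1::real)"
    using smooth_step by metis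
  define \<eta> where "\<eta> x = S ((1 / \<delta>) * x + (-1)) * S ((- 1 / \<delta>) * x + (1 / \<delta> - 1))" for x
  show thesis
  proof
    have "smooth \<eta>"
      unfolding \<eta>_def by (intro smooth_mult smooth_affine S(1))
    moreover have "\<eta> x = 0" if "x < \<delta> \<or> x > 1 - \<delta>" for x
    proof (cases "x < \<delta>")
      case True
      then have "S ((1 / \<delta>) * x + (-1)) = 0" using assms by (intro S(3)) (simp add: field_simps)
      then show ?thesis by (simp add: \<eta>_def)
    next
      case False
      then have "1 - \<delta> < x" using that by simp
      then have "S ((- 1 / \<delta>) * x + (1 / \<delta> - 1)) = 0"
        using assms by (intro S(3)) (simp add: divide_simps)
      then show ?thesis by (simp add: \<eta>_def)
    qed
    ultimately show "\<eta> \<in> test_funs"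
      unfolding test_funs_iff using assms by blast
    show "0 \<le> \<eta> x \<and> \<eta> x \<le> 1" for x
      using S(2) by (auto simp: \<eta>_def intro!: mult_le_one)
    show "\<eta> x = 1" if "2 * \<delta> \<le> x" "x \<le> 1 - 2 * \<delta>" for x
    proof -
      have "(1 / \<delta>) * x + (-1) \<ge> 1"
        using that assms by (simp add: field_simps)
      moreover have "(- 1 / \<delta>) * x + (1 / \<delta> - 1) = (1 - x) / \<delta> - 1"
        by (simp add: diff_divide_distrib)
      moreover have "(1 - x) / \<delta> \<ge> 2"
        using that assms by (simp add: pos_le_divide_eq)
      ultimately have "(1 / \<delta>) * x + (-1) \<ge> 1" "(- 1 / \<delta>) * x + (1 / \<delta> - 1) \<ge> 1"
        by linarith+
      then show ?thesis by (simp add: \<eta>_def S(4))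
    qed
  qed
qed

section \<open>Square integrable functions and fractional powers\<close>

text \<open>
  The space \<open>L\<^sup>2(M)\<close> and its norm, with plain squares instead of \<open>powr\<close>. The value of \<open>L2norm\<close> is only
  meaningful for square integrable functions.
\<close>

definition square_integrable :: "'a measure \<Rightarrow> ('a \<Rightarrow> real) \<Rightarrow> bool" where
  "square_integrable M f \<longleftrightarrow> f \<in> borel_measurable M \<and> integrable M (\<lambda>x. (f x)\<^sup>2)"

definition L2norm :: "'a measure \<Rightarrow> ('a \<Rightarrow> real) \<Rightarrow> real" where
  "L2norm M f = sqrt (LINT x|M. (f x)\<^sup>2)"

lemma square_integrable_measurable [measurable_dest]:
  "square_integrable M f \<Longrightarrow> f \<in> borel_measurable M"
  by (simp add: square_integrable_def)

lemma L2norm_nonneg [simp]: "L2norm M f \<ge> 0"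
  by (simp add: L2norm_def)

lemma L2norm_sq: "(L2norm M f)\<^sup>2 = (LINT x|M. (f x)\<^sup>2)"
  by (simp add: L2norm_def)

lemma abs_mult_le_squares: "\<bar>x * y\<bar> \<le> x\<^sup>2 + (y::real)\<^sup>2"
proof -
  have "2 * (\<bar>x\<bar> * \<bar>y\<bar>) \<le> \<bar>x\<bar>\<^sup>2 + \<bar>y\<bar>\<^sup>2"
    using sum_squares_bound[of "\<bar>x\<bar>" "\<bar>y\<bar>"] by simp
  moreover have "0 \<le> \<bar>x\<bar> * \<bar>y\<bar>" by simp
  ultimately have "\<bar>x\<bar> * \<bar>y\<bar> \<le> \<bar>x\<bar>\<^sup>2 + \<bar>y\<bar>\<^sup>2" by linarith
  then show ?thesis by (simp add: abs_mult)
qed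

lemma power2_mult_le: "\<bar>c\<bar> \<le> K \<Longrightarrow> (c * y)\<^sup>2 \<le> K\<^sup>2 * (y::real)\<^sup>2"
  by (simp add: power_mult_distrib mult_right_mono abs_le_square_iff[symmetric])

lemma square_integrable_mult:
  assumes "square_integrable M f" "square_integrable M g"
  shows "integrable M (\<lambda>x. f x * g x)"
proof (rule Bochner_Integration.integrable_bound[of M "\<lambda>x. (f x)\<^sup>2 + (g x)\<^sup>2"])
  show "AE x in M. norm (f x * g x) \<le> norm ((f x)\<^sup>2 + (g x)\<^sup>2)"
    using abs_mult_le_squares by (intro AE_I2) (simp del: abs_mult)
qed (use assms in \<open>auto simp: square_integrable_def\<close>)

lemma square_integrable_add:
  assumes "square_integrable M f" "square_integrable M g"
  shows "square_integrable M (\<lambda>x. f x + g x)"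
  using assms square_integrable_mult[OF assms]
  by (auto simp: square_integrable_def power2_sum mult.assoc)

lemma square_integrable_cmult:
  "square_integrable M f \<Longrightarrow> square_integrable M (\<lambda>x. c * f x)"
  by (auto simp: square_integrable_def power_mult_distrib)

lemma square_integrable_diff:
  assumes "square_integrable M f" "square_integrable M g"
  shows "square_integrable M (\<lambda>x. f x - g x)"
  using square_integrable_add[OF assms(1) square_integrable_cmult[OF assms(2), of "-1"]] by simp

lemma square_integrable_sum:
  assumes "\<And>i. i \<in> I \<Longrightarrow> square_integrable M (f i)"
  shows "square_integrable M (\<lambda>x. \<Sum>i\<in>I. f i x)"
proof (cases "finite I")
  case True
  then show ?thesis using assms
    by (induction I) (simp_all add: square_integrable_add square_integrable_def[of _ "\<lambda>x. 0"])
qed (simp add: square_integrable_def)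

lemma square_integrable_bounded_mult:
  assumes "square_integrable M f" "c \<in> borel_measurable M" "AE x in M. \<bar>c x\<bar> \<le> K"
  shows "square_integrable M (\<lambda>x. c x * f x)"
  unfolding square_integrable_def
proof (intro conjI)
  show "integrable M (\<lambda>x. (c x * f x)\<^sup>2)"
  proof (rule Bochner_Integration.integrable_bound[of M "\<lambda>x. K\<^sup>2 * (f x)\<^sup>2"])
    show "AE x in M. norm ((c x * f x)\<^sup>2) \<le> norm (K\<^sup>2 * (f x)\<^sup>2)"
      using assms(3) by eventually_elim (simp add: power2_mult_le)
  qed (use assms in \<open>auto simp: square_integrable_def\<close>)
qed (use assms in \<open>auto simp: square_integrable_def\<close>)

lemma L2norm_bounded_mult:
  assumes "square_integrable M f" "c \<in> borel_measurable M" "AE x in M. \<bar>c x\<bar> \<le> K" "K \<ge> 0"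
  shows "L2norm M (\<lambda>x. c x * f x) \<le> K * L2norm M f"
proof -
  have "(LINT x|M. (c x * f x)\<^sup>2) \<le> (LINT x|M. K\<^sup>2 * (f x)\<^sup>2)"
  proof (rule integral_mono_AE)
    show "AE x in M. (c x * f x)\<^sup>2 \<le> K\<^sup>2 * (f x)\<^sup>2"
      using assms(3) by eventually_elim (rule power2_mult_le)
  qed (use square_integrable_bounded_mult[OF assms(1-3)] assms(1)
       in \<open>auto simp: square_integrable_def\<close>)
  then have "L2norm M (\<lambda>x. c x * f x) \<le> sqrt (K\<^sup>2 * (LINT x|M. (f x)\<^sup>2))"
    by (simp add: L2norm_def)
  then show ?thesis using assms(4) by (simp add: L2norm_def real_sqrt_mult)
qed

text \<open>The quadratic polynomial \<open>t \<mapsto> \<parallel>f - t g\<parallel>\<^sup>2\<close> is nonnegative; it is evaluated at its minimum.\<close>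

lemma Cauchy_Schwarz_integral:
  assumes f: "square_integrable M f" and g: "square_integrable M g"
  shows "\<bar>LINT x|M. f x * g x\<bar> \<le> L2norm M f * L2norm M g"
proof -
  define A B C where "A = (LINT x|M. (f x)\<^sup>2)" and "B = (LINT x|M. (g x)\<^sup>2)"
    and "C = (LINT x|M. f x * g x)"
  have i: "integrable M (\<lambda>x. (f x)\<^sup>2)" "integrable M (\<lambda>x. (g x)\<^sup>2)" "integrable M (\<lambda>x. f x * g x)"
    using f g square_integrable_mult[OF f g] by (auto simp: square_integrable_def)
  have "0 \<le> A - 2 * t * C + t\<^sup>2 * B" for t
  proof -
    have "0 \<le> (LINT x|M. (f x - t * g x)\<^sup>2)" by simp
    also have "\<dots> = (LINT x|M. (f x)\<^sup>2 - (2 * t) * (f x * g x) + t\<^sup>2 * (g x)\<^sup>2)"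
      by (simp add: power2_diff power_mult_distrib algebra_simps)
    also have "\<dots> = A - 2 * t * C + t\<^sup>2 * B"
      using i by (simp add: A_def B_def C_def)
    finally show ?thesis .
  qed
  note quad = this
  have A0: "A \<ge> 0" "B \<ge> 0" by (auto simp: A_def B_def)
  have "C\<^sup>2 \<le> A * B"
  proof (cases "B = 0")
    case True
    have "C = 0"
    proof (rule ccontr)
      assume "C \<noteq> 0"
      then show False using quad[of "(A + 1) / (2 * C)"] True by simp
    qed
    then show ?thesis using A0 by simp
  next
    case False
    then have "B > 0" using A0 by simp
    then show ?thesis using quad[of "C / B"]
      by (simp add: power2_eq_square field_simps)
  qed
  then have "\<bar>C\<bar> \<le> sqrt (A * B)"
    by (metis real_sqrt_abs real_sqrt_le_iff)
  then show ?thesis by (simp add: L2norm_def A_def B_def C_def real_sqrt_mult)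
qed

lemma L2norm_add_le:
  assumes f: "square_integrable M f" and g: "square_integrable M g"
  shows "L2norm M (\<lambda>x. f x + g x) \<le> L2norm M f + L2norm M g"
proof (rule power2_le_imp_le)
  have "(L2norm M (\<lambda>x. f x + g x))\<^sup>2 = (LINT x|M. (f x)\<^sup>2 + (g x)\<^sup>2 + 2 * (f x * g x))"
    unfolding L2norm_sq by (simp add: power2_sum mult_ac)
  also have "\<dots> = (L2norm M f)\<^sup>2 + (L2norm M g)\<^sup>2 + 2 * (LINT x|M. f x * g x)"
    using f g square_integrable_mult[OF f g] by (simp add: L2norm_sq square_integrable_def)
  also have "\<dots> \<le> (L2norm M f + L2norm M g)\<^sup>2"
    using Cauchy_Schwarz_integral[OF f g] by (simp add: power2_sum)
  finally show "(L2norm M (\<lambda>x. f x + g x))\<^sup>2 \<le> (L2norm M f + L2norm M g)\<^sup>2" .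
qed simp

lemma L2norm_cmult: "L2norm M (\<lambda>x. c * f x) = \<bar>c\<bar> * L2norm M f"
  by (simp add: L2norm_def power_mult_distrib real_sqrt_mult)

lemma L2norm_diff_le:
  assumes f: "square_integrable M f" and g: "square_integrable M g"
  shows "L2norm M (\<lambda>x. f x - g x) \<le> L2norm M f + L2norm M g"
  using L2norm_add_le[OF f square_integrable_cmult[OF g, of "-1"]] L2norm_cmult[of M "-1" g]
  by simp

lemma L2norm_cong_AE:
  assumes "f \<in> borel_measurable M" "g \<in> borel_measurable M" "AE x in M. f x = g x"
  shows "L2norm M f = L2norm M g"
  using assms unfolding L2norm_def by (intro arg_cong[of _ _ sqrt] integral_cong_AE) auto

lemma square_integrable_cong_AE:
  assumes "square_integrable M f" "g \<in> borel_measurable M" "AE x in M. f x = g x"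
  shows "square_integrable M g"
  using assms unfolding square_integrable_def
  by (auto intro: integrable_cong_AE_imp[of M "\<lambda>x. (f x)\<^sup>2"])

lemma L2norm_eq_0:
  assumes "square_integrable M f" "L2norm M f = 0"
  shows "AE x in M. f x = 0"
  using assms integral_nonneg_eq_0_iff_AE[of M "\<lambda>x. (f x)\<^sup>2"]
  by (auto simp: L2norm_def square_integrable_def)

lemma (in finite_measure) square_integrable_bounded:
  assumes "f \<in> borel_measurable M" "AE x in M. \<bar>f x\<bar> \<le> K"
  shows "square_integrable M f"
  unfolding square_integrable_def
proof
  show "integrable M (\<lambda>x. (f x)\<^sup>2)"
    by (rule integrable_const_bound[of _ "K\<^sup>2"])
       (use assms in \<open>auto elim!: eventually_mono intro: order.trans[OF power2_mult_le[of _ K 1, simplified]]\<close>)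
qed fact

lemma (in finite_measure) square_integrable_integrable:
  assumes "square_integrable M f"
  shows "integrable M f"
  using square_integrable_mult[OF assms square_integrable_bounded[of "\<lambda>_. 1" 1]] by simp

lemma (in finite_measure) integral_abs_le_L2norm:
  assumes "square_integrable M f"
  shows "(LINT x|M. \<bar>f x\<bar>) \<le> sqrt (measure M (space M)) * L2norm M f"
proof -
  have "square_integrable M (\<lambda>x. \<bar>f x\<bar>)"
    using assms by (auto simp: square_integrable_def)
  from Cauchy_Schwarz_integral[OF this square_integrable_bounded[of "\<lambda>_. 1" 1]]
  show ?thesis by (simp add: L2norm_def mult.commute)
qed

lemma powr_add_le:
  fixes x y \<theta> :: real
  assumes "x \<ge> 0" "y \<ge> 0" "0 < \<theta>" "\<theta> \<le> 1"
  shows "(x + y) powr \<theta> \<le> x powr \<theta> + y powr \<theta>"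
proof (cases "x + y = 0")
  case False
  then have pos: "x + y > 0" using assms by simp
  have part: "z \<le> z powr \<theta> * (x + y) powr (1 - \<theta>)" if "0 \<le> z" "z \<le> x + y" for z
  proof (cases "z = 0")
    case False
    have "z = z powr \<theta> * z powr (1 - \<theta>)"
      using False that by (simp flip: powr_add)
    also have "\<dots> \<le> z powr \<theta> * (x + y) powr (1 - \<theta>)"
      using that assms by (intro mult_left_mono powr_mono2) auto
    finally show ?thesis .
  qed simp
  have "(x + y) powr \<theta> * (x + y) powr (1 - \<theta>) = x + y"
    using pos by (simp flip: powr_add)
  also have "\<dots> \<le> (x powr \<theta> + y powr \<theta>) * (x + y) powr (1 - \<theta>)"
    using part[of x] part[of y] assms by (simp add: distrib_right)
  finally show ?thesis
    using pos by (simp add: mult_le_cancel_right)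
qed (use assms in auto)

lemma powr_abs_le_add_diff:
  fixes x y \<theta> :: real
  assumes "0 < \<theta>" "\<theta> \<le> 1"
  shows "\<bar>x\<bar> powr \<theta> \<le> \<bar>y\<bar> powr \<theta> + \<bar>x - y\<bar> powr \<theta>"
proof -
  have "\<bar>x\<bar> powr \<theta> \<le> (\<bar>y\<bar> + \<bar>x - y\<bar>) powr \<theta>"
    using assms by (intro powr_mono2) auto
  also have "\<dots> \<le> \<bar>y\<bar> powr \<theta> + \<bar>x - y\<bar> powr \<theta>"
    using assms by (intro powr_add_le) auto
  finally show ?thesis .
qed

text \<open>
  The concave function \<open>t \<mapsto> t\<^bsup>\<theta>\<^esup>\<close> lies below its tangent at \<open>s\<close>. With \<open>s\<close> the mean value of \<open>t\<close>, this
  gives Jensen's inequality for integrals and for weighted sums.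
\<close>

lemma powr_tangent:
  fixes s t \<theta> :: real
  assumes "t \<ge> 0" "s > 0" "0 < \<theta>" "\<theta> < 1"
  shows "t powr \<theta> \<le> s powr (\<theta> - 1) * (\<theta> * t + (1 - \<theta>) * s)"
proof (cases "t = 0")
  case False
  have "t powr \<theta> * s powr (1 - \<theta>) \<le> \<theta> * t + (1 - \<theta>) * s"
    using assms False by (intro Youngs_inequality_0) auto
  then have "s powr (\<theta> - 1) * (t powr \<theta> * s powr (1 - \<theta>)) \<le> s powr (\<theta> - 1) * (\<theta> * t + (1 - \<theta>) * s)"
    by (intro mult_left_mono) auto
  moreover have "s powr (\<theta> - 1) * s powr (1 - \<theta>) = 1"
    using assms by (simp flip: powr_add)
  ultimately show ?thesis by (simp add: mult_ac)
qed (use assms in auto)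

lemma powr_le_one_plus:
  fixes t \<theta> :: real
  assumes "t \<ge> 0" "0 < \<theta>" "\<theta> \<le> 1"
  shows "t powr \<theta> \<le> 1 + t"
proof (cases "t \<le> 1")
  case True
  then have "t powr \<theta> \<le> 1" using assms by (simp add: powr_le1)
  then show ?thesis using assms by linarith
next
  case False
  then have "t powr \<theta> \<le> t powr 1" using assms by (intro powr_mono) auto
  then show ?thesis using assms by simp
qed

lemma (in finite_measure) integrable_powr:
  fixes t :: "'a \<Rightarrow> real"
  assumes "integrable M t" "AE x in M. t x \<ge> 0" "0 < \<theta>" "\<theta> \<le> 1"
  shows "integrable M (\<lambda>x. t x powr \<theta>)"
proof (rule Bochner_Integration.integrable_bound[of M "\<lambda>x. 1 + t x"])
  show "AE x in M. norm (t x powr \<theta>) \<le> norm (1 + t x)"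
    using assms(2)
  proof eventually_elim
    case (elim x)
    show ?case using powr_le_one_plus[OF elim assms(3,4)] elim by simp
  qed
qed (use assms in auto)

lemma (in finite_measure) integral_powr_le:
  fixes t :: "'a \<Rightarrow> real"
  assumes t: "integrable M t" "AE x in M. t x \<ge> 0" and \<theta>: "0 < \<theta>" "\<theta> < 1"
    and h: "measure M (space M) > 0"
  shows "(LINT x|M. t x powr \<theta>) \<le> measure M (space M) powr (1 - \<theta>) * (LINT x|M. t x) powr \<theta>"
proof -
  define h T where "h = measure M (space M)" and "T = (LINT x|M. t x)"
  have "T \<ge> 0" unfolding T_def using t(2) by (rule integral_nonneg_AE)
  have h0: "h > 0" using h by (simp add: h_def)
  show ?thesis
  proof (cases "T = 0")
    case True
    then have "AE x in M. t x = 0"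
      using integral_nonneg_eq_0_iff_AE[OF t] by (simp add: T_def)
    then have "AE x in M. t x powr \<theta> = 0" by eventually_elim simp
    then show ?thesis by (simp add: integral_eq_zero_AE)
  next
    case False
    define s where "s = T / h"
    have s: "s > 0" "s * h = T" using False \<open>T \<ge> 0\<close> h0 by (auto simp: s_def)
    have "(LINT x|M. t x powr \<theta>) \<le> (LINT x|M. s powr (\<theta> - 1) * (\<theta> * t x + (1 - \<theta>) * s))"
    proof (rule integral_mono_AE)
      show "AE x in M. t x powr \<theta> \<le> s powr (\<theta> - 1) * (\<theta> * t x + (1 - \<theta>) * s)"
        using t(2) by eventually_elim (use powr_tangent s \<theta> in auto)
    qed (use t \<theta> in \<open>auto intro!: integrable_powr\<close>)
    also have "\<dots> = s powr (\<theta> - 1) * (\<theta> * T + (1 - \<theta>) * (s * h))"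
      using t by (simp add: T_def h_def)
    also have "\<dots> = s powr (\<theta> - 1) * T"
      using s by (simp add: algebra_simps)
    also have "\<dots> = h powr (1 - \<theta>) * T powr \<theta>"
      using False \<open>T \<ge> 0\<close> h0 by (simp add: s_def powr_divide powr_diff field_simps)
    finally show ?thesis by (simp add: h_def T_def)
  qed
qed

lemma sum_powr_le:
  fixes h t :: "'a \<Rightarrow> real"
  assumes "finite I" and h: "\<And>i. i \<in> I \<Longrightarrow> h i \<ge> 0" "(\<Sum>i\<in>I. h i) = 1"
    and t: "\<And>i. i \<in> I \<Longrightarrow> t i \<ge> 0" and \<theta>: "0 < \<theta>" "\<theta> < 1"
  shows "(\<Sum>i\<in>I. h i * t i powr \<theta>) \<le> (\<Sum>i\<in>I. h i * t i) powr \<theta>"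
proof -
  define T where "T = (\<Sum>i\<in>I. h i * t i)"
  have "T \<ge> 0" unfolding T_def by (intro sum_nonneg mult_nonneg_nonneg h t)
  show ?thesis
  proof (cases "T = 0")
    case True
    then have "h i * t i = 0" if "i \<in> I" for i
      using sum_nonneg_eq_0_iff[OF \<open>finite I\<close>, of "\<lambda>i. h i * t i"] h t that by (auto simp: T_def)
    then have "h i * t i powr \<theta> = 0" if "i \<in> I" for i using that by fastforce
    then have "(\<Sum>i\<in>I. h i * t i powr \<theta>) = 0" by (rule sum.neutral[OF ballI])
    then show ?thesis by simp
  next
    case False
    then have "T > 0" using \<open>T \<ge> 0\<close> by simp
    have "(\<Sum>i\<in>I. h i * t i powr \<theta>) \<le> (\<Sum>i\<in>I. h i * (T powr (\<theta> - 1) * (\<theta> * t i + (1 - \<theta>) * T)))"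
      by (intro sum_mono mult_left_mono powr_tangent t h \<theta> \<open>T > 0\<close>)
    also have "\<dots> = (\<Sum>i\<in>I. (T powr (\<theta> - 1) * \<theta>) * (h i * t i) + (T powr (\<theta> - 1) * (1 - \<theta>) * T) * h i)"
      by (intro sum.cong) (auto simp: algebra_simps)
    also have "\<dots> = (T powr (\<theta> - 1) * \<theta>) * T + T powr (\<theta> - 1) * (1 - \<theta>) * T"
      using h(2) by (simp add: sum.distrib T_def flip: sum_distrib_left)
    also have "\<dots> = T powr (\<theta> - 1) * T" by (simp add: algebra_simps)
    also have "\<dots> = T powr \<theta>" using \<open>T > 0\<close> by (simp add: powr_diff)
    finally show ?thesis by (simp add: T_def)
  qed
qed

section \<open>Density of the test functions in Lebesgue spaces\<close>

lemma finite_measure_Omega: "finite_measure dx_Omega"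
  by (rule finite_measure_lebesgue_on) simp

lemma measure_Omega: "measure dx_Omega (space dx_Omega) = 1"
  by (simp add: measure_restrict_space)

text \<open>
  A measurable function is an almost everywhere limit of continuous functions. These are truncated at
  \<open>\<plusminus>M\<close>, replaced by polynomials (Weierstrass), and multiplied by smooth cutoff functions that tend to 1 on
  the open interval. The sequence stays bounded, so dominated convergence applies to it.
\<close>

lemma bounded_approx_test_funs:
  fixes g :: "real \<Rightarrow> real"
  assumes g: "g \<in> borel_measurable dx_Omega" and M: "\<And>x. \<bar>g x\<bar> \<le> M"
  obtains \<phi> where "\<And>n. \<phi> n \<in> test_funs" "\<And>n x. x \<in> Omega \<Longrightarrow> \<bar>\<phi> n x\<bar> \<le> M + 1"
    "AE x in dx_Omega. (\<lambda>n. \<phi> n x) \<longlonglongrightarrow> g x"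
proof -
  have M0: "M \<ge> 0" using M[of 0] by linarith
  have "g measurable_on Omega"
    using g by (simp add: measurable_on_iff_borel_measurable)
  then obtain N G where N: "negligible N" and G: "\<And>n. continuous_on UNIV (G n)"
    and lim: "\<And>x. x \<notin> N \<Longrightarrow> (\<lambda>n. G n x) \<longlonglongrightarrow> (if x \<in> Omega then g x else 0)"
    unfolding measurable_on_def by blast
  define H where "H n x = max (- M) (min M (G n x))" for n :: nat and x
  have "continuous_on {0..1} (H n)" for n
    unfolding H_def by (intro continuous_intros continuous_on_subset[OF G]) auto
  then have "\<exists>q. real_polynomial_function q \<and> (\<forall>x\<in>{0..1}. \<bar>H n x - q x\<bar> < 1 / (real n + 1))" for n
    using Stone_Weierstrass_real_polynomial_function[of "{0..1}" "H n" "1 / (real n + 1)"]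
    by (metis compact_Icc of_nat_0_le_iff add_nonneg_pos zero_less_one zero_less_divide_iff)
  then obtain q where q: "\<And>n. real_polynomial_function (q n)"
    and qH: "\<And>n x. x \<in> {0..1} \<Longrightarrow> \<bar>H n x - q n x\<bar> < 1 / (real n + 1)"
    by metis
  have "\<exists>\<eta>. \<eta> \<in> test_funs \<and> (\<forall>x. 0 \<le> \<eta> x \<and> \<eta> x \<le> 1) \<and>
      (\<forall>x. 2 * (1 / (real n + 1)) \<le> x \<longrightarrow> x \<le> 1 - 2 * (1 / (real n + 1)) \<longrightarrow> \<eta> x = 1)" for n
    by (rule test_cutoff[of "1 / (real n + 1)"]) auto
  then obtain \<eta> where \<eta>: "\<And>n. \<eta> n \<in> test_funs" "\<And>n x. 0 \<le> \<eta> n x \<and> \<eta> n x \<le> 1"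
    and \<eta>1: "\<And>n x. 2 * (1 / (real n + 1)) \<le> x \<Longrightarrow> x \<le> 1 - 2 * (1 / (real n + 1)) \<Longrightarrow> \<eta> n x = 1"
    by metis
  have conv0: "(\<lambda>n. 2 * (1 / (real n + 1))) \<longlonglongrightarrow> 0"
    using tendsto_mult_right_zero[OF LIMSEQ_inverse_real_of_nat, of 2]
    by (simp add: inverse_eq_divide add.commute)
  show thesis
  proof
    show "(\<lambda>x. q n x * \<eta> n x) \<in> test_funs" for n
      by (intro test_funs_mult \<eta> smooth_real_polynomial_function q)
    show "\<bar>q n x * \<eta> n x\<bar> \<le> M + 1" if "x \<in> Omega" for n x
    proof -
      have "1 / (real n + 1) \<le> 1" by (simp add: field_simps)
      moreover have "\<bar>H n x\<bar> \<le> M" using M0 by (auto simp: H_def)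
      moreover have "\<bar>H n x - q n x\<bar> < 1 / (real n + 1)" using qH[of x n] that by simp
      ultimately have "\<bar>q n x\<bar> \<le> M + 1" by linarith
      then have "\<bar>q n x\<bar> * \<bar>\<eta> n x\<bar> \<le> (M + 1) * 1"
        using \<eta>(2)[of n x] M0 by (intro mult_mono) auto
      then show ?thesis by (simp add: abs_mult)
    qed
    have "(\<lambda>n. q n x * \<eta> n x) \<longlonglongrightarrow> g x" if x: "x \<in> Omega" "x \<notin> N" for x
    proof -
      have "(\<lambda>n. max (- M) (min M (G n x))) \<longlonglongrightarrow> max (- M) (min M (g x))"
        using lim[of x] x by (intro tendsto_intros) auto
      moreover have "max (- M) (min M (g x)) = g x" using M[of x] by auto
      ultimately have "(\<lambda>n. H n x) \<longlonglongrightarrow> g x" by (simp add: H_def)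
      moreover have "(\<lambda>n. q n x - H n x) \<longlonglongrightarrow> 0"
      proof (rule Lim_null_comparison[OF always_eventually conv0], rule allI)
        fix n
        have "\<bar>H n x - q n x\<bar> < 1 / (real n + 1)" using qH[of x n] x by simp
        moreover have "0 \<le> 1 / (real n + 1)" by simp
        ultimately show "norm (q n x - H n x) \<le> 2 * (1 / (real n + 1))"
          unfolding real_norm_def by linarith
      qed
      ultimately have "(\<lambda>n. H n x + (q n x - H n x)) \<longlonglongrightarrow> g x + 0"
        by (rule tendsto_add)
      then have qlim: "(\<lambda>n. q n x) \<longlonglongrightarrow> g x" by simp
      have "\<forall>\<^sub>F n in sequentially. 2 * (1 / (real n + 1)) < min x (1 - x)"
        by (rule order_tendstoD(2)[OF conv0]) (use x in auto)
      then have "\<forall>\<^sub>F n in sequentially. q n x = q n x * \<eta> n x"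
        by eventually_elim (use \<eta>1[of _ x] in auto)
      with qlim show ?thesis by (rule Lim_transform_eventually)
    qed
    note conv = this
    have "AE x in lebesgue. x \<notin> N"
      using N by (intro AE_not_in) (simp add: negligible_iff_null_sets)
    then have "AE x in dx_Omega. x \<notin> N \<and> x \<in> Omega"
      by (auto simp: AE_restrict_space_iff)
    then show "AE x in dx_Omega. (\<lambda>n. q n x * \<eta> n x) \<longlonglongrightarrow> g x"
      by (rule eventually_mono) (use conv in blast)
  qed
qed

lemma add_power_le:
  fixes x y :: real
  assumes "x \<ge> 0" "y \<ge> 0"
  shows "(x + y) ^ p \<le> 2 ^ p * (x ^ p + y ^ p)"
proof -
  have "(x + y) ^ p \<le> (2 * max x y) ^ p"
    using assms by (intro power_mono) auto
  also have "\<dots> = 2 ^ p * max x y ^ p" by (simp add: power_mult_distrib)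
  also have "max x y ^ p \<le> x ^ p + y ^ p"
    using assms by (auto simp: max_def)
  finally show ?thesis by simp
qed

lemma smooth_measurable_Omega: "smooth f \<Longrightarrow> f \<in> borel_measurable dx_Omega"
  by (simp add: borel_measurable_continuous_onI measurable_completion measurable_restrict_space1 smooth_continuous_on)

text \<open>The function is first truncated and then approximated by means of \<open>bounded_approx_test_funs\<close>.\<close>

lemma test_funs_dense:
  fixes g :: "real \<Rightarrow> real"
  assumes g: "g \<in> borel_measurable dx_Omega" "integrable dx_Omega (\<lambda>x. \<bar>g x\<bar> ^ p)" "p > 0"
    and \<epsilon>: "\<epsilon> > 0"
  shows "\<exists>\<phi>\<in>test_funs. integrable dx_Omega (\<lambda>x. \<bar>g x - \<phi> x\<bar> ^ p) \<and>
    (LINT x|dx_Omega. \<bar>g x - \<phi> x\<bar> ^ p) < \<epsilon>"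
proof -
  interpret finite_measure dx_Omega by (rule finite_measure_Omega)
  define T where "T n x = max (- real n) (min (real n) (g x))" for n x
  have Tm: "T n \<in> borel_measurable dx_Omega" for n
    unfolding T_def using g(1) by measurable
  have Tb: "\<bar>T n x\<bar> \<le> real n" for n x by (auto simp: T_def)
  have gT: "\<bar>g x - T n x\<bar> \<le> \<bar>g x\<bar>" for n x by (auto simp: T_def)
  have Teq: "T n x = g x" if "\<bar>g x\<bar> \<le> real n" for n x using that by (auto simp: T_def)
  define \<epsilon>' where "\<epsilon>' = \<epsilon> / (2 * 2 ^ p)"
  have \<epsilon>': "\<epsilon>' > 0" using \<epsilon> by (simp add: \<epsilon>'_def)
  have iT: "integrable dx_Omega (\<lambda>x. \<bar>g x - T n x\<bar> ^ p)" for n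
    by (rule Bochner_Integration.integrable_bound[OF g(2)])
       (use g Tm gT in \<open>auto intro!: AE_I2 power_mono\<close>)
  have "(\<lambda>n. LINT x|dx_Omega. \<bar>g x - T n x\<bar> ^ p) \<longlonglongrightarrow> (LINT x|dx_Omega. 0)"
  proof (rule integral_dominated_convergence[where w="\<lambda>x. \<bar>g x\<bar> ^ p"])
    show "AE x in dx_Omega. (\<lambda>n. \<bar>g x - T n x\<bar> ^ p) \<longlonglongrightarrow> 0"
    proof (rule AE_I2)
      fix x
      have "\<forall>\<^sub>F n in sequentially. \<bar>g x\<bar> \<le> real n"
        using filterlim_real_sequentially by (simp add: filterlim_at_top)
      then have "\<forall>\<^sub>F n in sequentially. 0 = \<bar>g x - T n x\<bar> ^ p"
        by eventually_elim (use g(3) in \<open>simp add: Teq\<close>)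
      then show "(\<lambda>n. \<bar>g x - T n x\<bar> ^ p) \<longlonglongrightarrow> 0"
        by (rule Lim_transform_eventually[OF tendsto_const])
    qed
  qed (use g Tm gT in \<open>auto intro!: AE_I2 power_mono\<close>)
  then have "\<forall>\<^sub>F n in sequentially. (LINT x|dx_Omega. \<bar>g x - T n x\<bar> ^ p) < \<epsilon>'"
    using \<epsilon>' by (intro order_tendstoD(2)) auto
  then obtain n where n: "(LINT x|dx_Omega. \<bar>g x - T n x\<bar> ^ p) < \<epsilon>'"
    by (auto simp: eventually_sequentially)
  obtain \<phi> where \<phi>: "\<And>k. \<phi> k \<in> test_funs" "\<And>k x. x \<in> Omega \<Longrightarrow> \<bar>\<phi> k x\<bar> \<le> real n + 1"
    "AE x in dx_Omega. (\<lambda>k. \<phi> k x) \<longlonglongrightarrow> T n x"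
    using bounded_approx_test_funs[OF Tm Tb] by metis
  have \<phi>m: "\<phi> k \<in> borel_measurable dx_Omega" for k
    by (intro smooth_measurable_Omega test_funs_smooth \<phi>(1))
  have bd: "\<bar>T n x - \<phi> k x\<bar> \<le> 2 * real n + 1" if "x \<in> Omega" for k x
    using Tb[of n x] \<phi>(2)[OF that, of k] by linarith
  have i\<phi>: "integrable dx_Omega (\<lambda>x. \<bar>T n x - \<phi> k x\<bar> ^ p)" for k
    by (rule integrable_const_bound[of _ "(2 * real n + 1) ^ p"])
       (use Tm \<phi>m bd in \<open>auto intro!: AE_I2 power_mono\<close>)
  have "(\<lambda>k. LINT x|dx_Omega. \<bar>T n x - \<phi> k x\<bar> ^ p) \<longlonglongrightarrow> (LINT x|dx_Omega. 0)"
  proof (rule integral_dominated_convergence[where w="\<lambda>x. (2 * real n + 1) ^ p"])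
    show "AE x in dx_Omega. (\<lambda>k. \<bar>T n x - \<phi> k x\<bar> ^ p) \<longlonglongrightarrow> 0"
      using \<phi>(3)
    proof eventually_elim
      case (elim x)
      have "(\<lambda>k. \<bar>T n x - \<phi> k x\<bar> ^ p) \<longlonglongrightarrow> \<bar>T n x - T n x\<bar> ^ p"
        by (intro tendsto_intros elim)
      then show ?case using g(3) by (simp add: zero_power del: abs_diff_less_iff tendsto_rabs_zero_iff)
    qed
  qed (use Tm \<phi>m bd in \<open>auto intro!: AE_I2 power_mono\<close>)
  then have "\<forall>\<^sub>F k in sequentially. (LINT x|dx_Omega. \<bar>T n x - \<phi> k x\<bar> ^ p) < \<epsilon>'"
    using \<epsilon>' by (intro order_tendstoD(2)) auto
  then obtain k where k: "(LINT x|dx_Omega. \<bar>T n x - \<phi> k x\<bar> ^ p) < \<epsilon>'"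
    by (auto simp: eventually_sequentially)
  have le: "\<bar>g x - \<phi> k x\<bar> ^ p \<le> 2 ^ p * (\<bar>g x - T n x\<bar> ^ p + \<bar>T n x - \<phi> k x\<bar> ^ p)" for x
  proof -
    have "\<bar>g x - \<phi> k x\<bar> ^ p \<le> (\<bar>g x - T n x\<bar> + \<bar>T n x - \<phi> k x\<bar>) ^ p"
      by (intro power_mono) auto
    also have "\<dots> \<le> 2 ^ p * (\<bar>g x - T n x\<bar> ^ p + \<bar>T n x - \<phi> k x\<bar> ^ p)"
      by (intro add_power_le) auto
    finally show ?thesis .
  qed
  have int: "integrable dx_Omega (\<lambda>x. \<bar>g x - \<phi> k x\<bar> ^ p)"
    by (rule Bochner_Integration.integrable_bound[of _ "\<lambda>x. 2 ^ p * (\<bar>g x - T n x\<bar> ^ p + \<bar>T n x - \<phi> k x\<bar> ^ p)"])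
       (use g iT i\<phi> \<phi>m le in \<open>auto intro!: AE_I2\<close>)
  have "(LINT x|dx_Omega. \<bar>g x - \<phi> k x\<bar> ^ p)
      \<le> (LINT x|dx_Omega. 2 ^ p * (\<bar>g x - T n x\<bar> ^ p + \<bar>T n x - \<phi> k x\<bar> ^ p))"
    by (rule integral_mono[OF int]) (use iT i\<phi> le in auto)
  also have "\<dots> = 2 ^ p * ((LINT x|dx_Omega. \<bar>g x - T n x\<bar> ^ p) + (LINT x|dx_Omega. \<bar>T n x - \<phi> k x\<bar> ^ p))"
    using iT i\<phi> by simp
  also have "\<dots> < 2 ^ p * (\<epsilon>' + \<epsilon>')"
    using n k by (intro mult_strict_left_mono add_strict_mono) auto
  also have "\<dots> = \<epsilon>" by (simp add: \<epsilon>'_def)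
  finally show ?thesis using int \<phi>(1) by blast
qed

section \<open>Primitives, weak derivatives and \<open>H\<^sub>0\<^sup>1\<close>\<close>

lemma Lp_2_iff: "v \<in> Lp 2 \<longleftrightarrow> square_integrable dx_Omega v"
  and Lp_norm_2: "Lp_norm 2 v = L2norm dx_Omega v"
proof -
  have eq: "\<bar>v x\<bar> powr 2 = (v x)\<^sup>2" for v :: "real \<Rightarrow> real" and x
    by simp
  show "v \<in> Lp 2 \<longleftrightarrow> square_integrable dx_Omega v"
    by (simp add: Lp_def square_integrable_def eq)
  show "Lp_norm 2 v = L2norm dx_Omega v"
    by (simp add: Lp_norm_def L2norm_def eq powr_half_sqrt)
qed

lemma Lp_1_iff: "v \<in> Lp 1 \<longleftrightarrow> integrable dx_Omega v"
  and Lp_norm_1: "Lp_norm 1 v = (LINT x|dx_Omega. \<bar>v x\<bar>)"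
proof -
  show "v \<in> Lp 1 \<longleftrightarrow> integrable dx_Omega v"
    by (auto simp: Lp_def intro: integrable_abs_cancel)
  show "Lp_norm 1 v = (LINT x|dx_Omega. \<bar>v x\<bar>)"
    by (simp add: Lp_norm_def)
qed

interpretation Omega: finite_measure dx_Omega
  by (rule finite_measure_Omega)

lemma integrable_restrict_Omega:
  assumes "integrable dx_Omega f" "S \<in> sets lebesgue" "S \<subseteq> Omega"
  shows "integrable (lebesgue_on S) (f :: real \<Rightarrow> real)"
proof -
  have "integrable lebesgue (\<lambda>x. indicator S x *\<^sub>R (indicator Omega x *\<^sub>R f x))"
    by (rule integrable_mult_indicator) (use assms in \<open>simp_all add: integrable_restrict_space\<close>)
  moreover have "(\<lambda>x. indicator S x *\<^sub>R (indicator Omega x *\<^sub>R f x)) = (\<lambda>x. indicator S x *\<^sub>R f x)"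
    using assms(3) by (auto simp: indicator_def fun_eq_iff)
  ultimately have "integrable lebesgue (\<lambda>x. indicator S x *\<^sub>R f x)"
    by (simp only:)
  then show ?thesis
    using assms(2) by (subst integrable_restrict_space) simp_all
qed

lemma LINT_restrict_Omega:
  fixes f :: "real \<Rightarrow> real"
  assumes "S \<in> sets lebesgue" "S \<subseteq> Omega"
  shows "(LINT x|lebesgue_on S. f x) = (LINT x|dx_Omega. indicator S x * f x)"
proof -
  have eq: "(\<lambda>x. indicator Omega x *\<^sub>R (indicator S x * f x)) = (\<lambda>x. indicator S x *\<^sub>R f x)"
    using assms(2) by (auto simp: indicator_def fun_eq_iff)
  have "(LINT x|dx_Omega. indicator S x * f x) = (LINT x|lebesgue. indicator Omega x *\<^sub>R (indicator S x * f x))"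
    by (rule integral_restrict_space) simp
  moreover have "(LINT x|lebesgue_on S. f x) = (LINT x|lebesgue. indicator S x *\<^sub>R f x)"
    by (rule integral_restrict_space) (use assms in simp)
  ultimately show ?thesis by (simp only: eq)
qed

lemma sets_Omega_Int: "A \<in> sets borel \<Longrightarrow> A \<inter> Omega \<in> sets dx_Omega"
  by (simp add: sets_restrict_space_iff)

lemma integrable_indicator_Omega:
  assumes "integrable dx_Omega f" "A \<in> sets borel"
  shows "integrable dx_Omega (\<lambda>x. indicator A x * f x :: real)"
proof -
  have "integrable dx_Omega (\<lambda>x. indicator (A \<inter> Omega) x *\<^sub>R f x)"
    by (intro integrable_mult_indicator sets_Omega_Int assms)
  then show ?thesis
    by (rule Bochner_Integration.integrable_cong[THEN iffD1, rotated 2]) (auto simp: indicator_def)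
qed

lemma measurable_indicator_Omega: "A \<in> sets borel \<Longrightarrow> (indicator A :: real \<Rightarrow> real) \<in> borel_measurable dx_Omega"
  by (intro measurable_restrict_space1 measurable_completion) simp

lemma square_integrable_indicator:
  assumes "square_integrable dx_Omega f" "A \<in> sets borel"
  shows "square_integrable dx_Omega (\<lambda>x. indicator A x * f x)"
  by (rule square_integrable_bounded_mult[OF assms(1) measurable_indicator_Omega[OF assms(2)], of 1])
     (auto simp: indicator_def)

lemma integral_abs_Omega_le_L2norm: 
  "square_integrable dx_Omega f \<Longrightarrow> (LINT x|dx_Omega. \<bar>f x\<bar>) \<le> L2norm dx_Omega f"
  using Omega.integral_abs_le_L2norm[of f] measure_Omega by simp

lemma abs_integral_Omega_le_L2norm: 
  "square_integrable dx_Omega f \<Longrightarrow> \<bar>LINT x|dx_Omega. f x\<bar> \<le> L2norm dx_Omega f"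
  using integral_abs_Omega_le_L2norm[of f] integral_abs_bound[of dx_Omega f] by linarith

lemma L2norm_le_bound:
  assumes "f \<in> borel_measurable dx_Omega" "\<And>x. x \<in> Omega \<Longrightarrow> \<bar>f x\<bar> \<le> K"
  shows "L2norm dx_Omega f \<le> K"
proof -
  have K: "K \<ge> 0" using assms(2)[of "1/2"] by auto
  have "square_integrable dx_Omega (\<lambda>x. 1)"
    by (intro Omega.square_integrable_bounded[of _ 1]) auto
  moreover have "AE x in dx_Omega. \<bar>f x\<bar> \<le> K"
    by (intro AE_I2) (use assms(2) in auto)
  ultimately have "L2norm dx_Omega f \<le> K * L2norm dx_Omega (\<lambda>x. 1)"
    using L2norm_bounded_mult[of dx_Omega "\<lambda>x. 1" f K] assms(1) K by simp
  then show ?thesis using measure_Omega by (simp add: L2norm_def)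
qed

lemma L2_tendsto_integral_mult:
  assumes "\<And>k. square_integrable M (f k)" "\<And>k. square_integrable M (g k)"
    and F: "square_integrable M F" and G: "square_integrable M G"
    and limf: "(\<lambda>k. L2norm M (\<lambda>x. F x - f k x)) \<longlonglongrightarrow> 0"
    and limg: "(\<lambda>k. L2norm M (\<lambda>x. G x - g k x)) \<longlonglongrightarrow> 0"
  shows "(\<lambda>k. LINT x|M. f k x * g k x) \<longlonglongrightarrow> (LINT x|M. F x * G x)"
proof (rule Lim_transform2)
  show "(\<lambda>k. LINT x|M. F x * G x) \<longlonglongrightarrow> (LINT x|M. F x * G x)" by simp
  let ?a = "\<lambda>k. L2norm M (\<lambda>x. F x - f k x)" and ?b = "\<lambda>k. L2norm M (\<lambda>x. G x - g k x)"
  have "(\<lambda>k. ?a k * (L2norm M G + ?b k) + L2norm M F * ?b k) \<longlonglongrightarrow>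
      0 * (L2norm M G + 0) + L2norm M F * 0"
    by (intro tendsto_intros limf limg)
  then have lim: "(\<lambda>k. ?a k * (L2norm M G + ?b k) + L2norm M F * ?b k) \<longlonglongrightarrow> 0" by simp
  show "(\<lambda>k. (LINT x|M. F x * G x) - (LINT x|M. f k x * g k x)) \<longlonglongrightarrow> 0"
  proof (rule Lim_null_comparison[OF always_eventually lim], rule allI)
    fix k
    note d = square_integrable_diff[OF F assms(1)[of k]] square_integrable_diff[OF G assms(2)[of k]]
    have "(LINT x|M. F x * G x) - (LINT x|M. f k x * g k x) = (LINT x|M. F x * G x - f k x * g k x)"
      by (intro Bochner_Integration.integral_diff[symmetric] square_integrable_mult assms)
    also have "\<dots> = (LINT x|M. (F x - f k x) * g k x + F x * (G x - g k x))"
      by (simp add: algebra_simps)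
    also have "\<dots> = (LINT x|M. (F x - f k x) * g k x) + (LINT x|M. F x * (G x - g k x))"
      by (intro Bochner_Integration.integral_add square_integrable_mult assms d)
    finally have "norm ((LINT x|M. F x * G x) - (LINT x|M. f k x * g k x))
       \<le> \<bar>LINT x|M. (F x - f k x) * g k x\<bar> + \<bar>LINT x|M. F x * (G x - g k x)\<bar>" by simp
    also have "\<dots> \<le> ?a k * L2norm M (g k) + L2norm M F * ?b k"
      by (intro add_mono Cauchy_Schwarz_integral assms d)
    also have "L2norm M (g k) \<le> L2norm M G + ?b k"
      using L2norm_diff_le[OF G d(2)] by simp
    finally show "norm ((LINT x|M. F x * G x) - (LINT x|M. f k x * g k x))
        \<le> ?a k * (L2norm M G + ?b k) + L2norm M F * ?b k"
      by (simp add: mult_left_mono)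
  qed
qed

lemma L2norm_diff_self_tendsto:
  "(\<lambda>k::nat. L2norm M (\<lambda>x. F x - F x)) \<longlonglongrightarrow> 0"
  by (simp add: L2norm_def)

text \<open>
  The primitive \<open>x \<mapsto> \<integral>\<^sub>0\<^sup>x g\<close>. It is written as an integral over the fixed measure space \<open>\<Omega>\<close>, so that
  linearity and estimates are those of the integral; only arguments \<open>x\<close> in \<open>[0,1]\<close> matter.
\<close>

definition prim :: "(real \<Rightarrow> real) \<Rightarrow> real \<Rightarrow> real" where
  "prim g x = (LINT t|dx_Omega. indicator {..x} t * g t)"

lemma prim_abs_le:
  assumes "integrable dx_Omega g"
  shows "\<bar>prim g x\<bar> \<le> (LINT t|dx_Omega. \<bar>g t\<bar>)"
proof -
  have "\<bar>prim g x\<bar> \<le> (LINT t|dx_Omega. \<bar>indicator {..x} t * g t\<bar>)"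
    unfolding prim_def by (rule integral_abs_bound)
  also have "\<dots> \<le> (LINT t|dx_Omega. \<bar>g t\<bar>)"
    using assms by (intro integral_mono integrable_abs integrable_indicator_Omega) (auto simp: indicator_def)
  finally show ?thesis .
qed

lemma prim_diff:
  assumes "integrable dx_Omega f" "integrable dx_Omega g"
  shows "prim (\<lambda>x. f x - g x) x = prim f x - prim g x"
  using assms by (simp add: prim_def right_diff_distrib integrable_indicator_Omega)

lemma prim_eq_integral:
  assumes g: "integrable dx_Omega g" and x: "x \<in> {0..1}"
  shows "prim g x = integral {0..x} g"
proof -
  have "{..x} \<inter> Omega \<in> sets lebesgue"
    by (intro sets.Int) simp_all
  have "prim g x = (LINT t|dx_Omega. indicator ({..x} \<inter> Omega) t * g t)"
    unfolding prim_def by (intro Bochner_Integration.integral_cong) (auto simp: indicator_def)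
  also have "\<dots> = (LINT t|lebesgue_on ({..x} \<inter> Omega). g t)"
    by (rule LINT_restrict_Omega[symmetric]) (use \<open>_ \<in> sets lebesgue\<close> in auto)
  also have "\<dots> = integral ({..x} \<inter> Omega) g"
    by (intro lebesgue_integral_eq_integral integrable_restrict_Omega[OF g]) (use \<open>_ \<in> sets lebesgue\<close> in auto)
  also have "\<dots> = integral {0..x} g"
    by (rule integral_spike_set; rule negligible_subset[of "{0,1}"]) (use x in auto)
  finally show ?thesis .
qed

lemma integrable_on_01:
  assumes "integrable dx_Omega (g :: real \<Rightarrow> real)"
  shows "g integrable_on {0..1}"
proof -
  have "g integrable_on Omega"
    using assms by (intro integrable_on_lebesgue_on) auto
  then show ?thesis
    by (metis box_real(1) box_real(2) integrable_on_open_interval)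
qed

lemma prim_continuous:
  assumes "integrable dx_Omega g"
  shows "continuous_on {0..1} (prim g)"
  using indefinite_integral_continuous_1[OF integrable_on_01[OF assms]]
  by (rule continuous_on_cong[THEN iffD1, OF refl, rotated]) (simp add: prim_eq_integral[OF assms])

lemma continuous_on_measurable_Omega:
  assumes "continuous_on {0..1} (f :: real \<Rightarrow> real)"
  shows "f \<in> borel_measurable dx_Omega"
  by (rule continuous_imp_measurable_on_sets_lebesgue)
     (auto intro: continuous_on_subset[OF assms])

lemma prim_measurable [measurable (raw)]:
  "integrable dx_Omega g \<Longrightarrow> prim g \<in> borel_measurable dx_Omega"
  by (intro continuous_on_measurable_Omega prim_continuous)

lemma prim_square_integrable:
  "integrable dx_Omega g \<Longrightarrow> square_integrable dx_Omega (prim g)"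
  by (rule Omega.square_integrable_bounded[of _ "LINT t|dx_Omega. \<bar>g t\<bar>"])
     (auto intro: prim_abs_le prim_measurable)

lemma prim_1: "prim g 1 = (LINT t|dx_Omega. g t)"
  unfolding prim_def by (intro Bochner_Integration.integral_cong) (auto simp: indicator_def)

lemma L2norm_prim_le:
  assumes "square_integrable dx_Omega g"
  shows "L2norm dx_Omega (prim g) \<le> L2norm dx_Omega g"
  by (intro L2norm_le_bound order.trans[OF prim_abs_le integral_abs_Omega_le_L2norm] prim_measurable
       Omega.square_integrable_integrable assms)

lemma smooth_bounded:
  assumes "smooth f"
  obtains K where "K \<ge> 0" "\<And>x. x \<in> Omega \<Longrightarrow> \<bar>f x\<bar> \<le> K"
proof -
  have "bounded (f ` {0..1})"
    by (rule compact_imp_bounded, rule compact_continuous_image)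
       (simp_all add: smooth_continuous_on assms)
  then obtain K where K: "\<forall>y\<in>f ` {0..1}. norm y \<le> K"
    unfolding bounded_iff ..
  have bd: "\<bar>f x\<bar> \<le> max K 0" if "x \<in> Omega" for x
  proof -
    have "norm (f x) \<le> K" using K that by auto
    then show ?thesis by simp
  qed
  show thesis by (rule that[OF max.cobounded2 bd])
qed

lemma smooth_square_integrable:
  assumes "smooth f"
  shows "square_integrable dx_Omega f"
proof -
  obtain K where "\<And>x. x \<in> Omega \<Longrightarrow> \<bar>f x\<bar> \<le> K" using smooth_bounded[OF assms] by blast
  then show ?thesis
    by (intro Omega.square_integrable_bounded[of _ K] smooth_measurable_Omega assms) auto
qed

lemma smooth_integrable: "smooth f \<Longrightarrow> integrable dx_Omega f"
  by (intro Omega.square_integrable_integrable smooth_square_integrable)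

lemma smooth_prim_deriv:
  assumes "smooth F" "x \<in> {0..1}"
  shows "prim (deriv F) x = F x - F 0"
proof -
  have "prim (deriv F) x = integral {0..x} (deriv F)"
    using assms by (intro prim_eq_integral smooth_integrable smooth_deriv) auto
  also have "(deriv F has_integral F x - F 0) {0..x}"
    using assms by (intro fundamental_theorem_of_calculus)
      (auto simp flip: has_real_derivative_iff_has_vector_derivative
            intro!: DERIV_subset[OF smooth_DERIV])
  then have "integral {0..x} (deriv F) = F x - F 0" by (rule integral_unique)
  finally show ?thesis .
qed

lemma test_fun_endpoints: "\<phi> \<in> test_funs \<Longrightarrow> \<phi> 0 = 0 \<and> \<phi> 1 = 0"
  unfolding test_funs_iff by force

lemma test_fun_prim: "\<phi> \<in> test_funs \<Longrightarrow> x \<in> {0..1} \<Longrightarrow> prim (deriv \<phi>) x = \<phi> x"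
  using smooth_prim_deriv[OF test_funs_smooth] test_fun_endpoints by simp

lemma integral_deriv_test_fun: "\<phi> \<in> test_funs \<Longrightarrow> (LINT x|dx_Omega. deriv \<phi> x) = 0"
  using test_fun_prim[of \<phi> 1] test_fun_endpoints[of \<phi>] by (simp add: prim_1)

lemma smooth_integration_by_parts:
  assumes "smooth f" "\<phi> \<in> test_funs"
  shows "(LINT x|dx_Omega. f x * deriv \<phi> x) = - (LINT x|dx_Omega. deriv f x * \<phi> x)"
proof -
  note sm = assms(1) test_funs_smooth[OF assms(2)]
  have "deriv (\<lambda>x. f x * \<phi> x) = (\<lambda>x. deriv f x * \<phi> x + deriv \<phi> x * f x)"
    by (intro ext DERIV_imp_deriv DERIV_mult smooth_DERIV sm)
  moreover have "(LINT x|dx_Omega. deriv (\<lambda>x. f x * \<phi> x) x) = 0"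
    by (intro integral_deriv_test_fun test_funs_mult assms)
  moreover have "(LINT x|dx_Omega. deriv f x * \<phi> x + deriv \<phi> x * f x) =
      (LINT x|dx_Omega. deriv f x * \<phi> x) + (LINT x|dx_Omega. deriv \<phi> x * f x)"
    by (intro Bochner_Integration.integral_add smooth_integrable smooth_mult smooth_deriv sm)
  ultimately show ?thesis by (simp add: mult.commute[of "f _"])
qed

text \<open>
  The antiderivative of a test function is a test function only if the integral vanishes. In general
  a multiple of a fixed test function \<open>\<tau>\<close> with integral 1 (the derivative of a smooth step) is
  subtracted first.
\<close>

lemma test_fun_antiderivative:
  obtains \<tau> where "\<tau> \<in> test_funs"
    "\<And>\<psi>. \<psi> \<in> test_funs \<Longrightarrow> \<exists>\<phi>\<in>test_funs. deriv \<phi> = (\<lambda>x. \<psi> x - (LINT t|dx_Omega. \<psi> t) * \<tau> x)"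
proof -
  obtain S where S: "smooth S" "\<And>x. 0 \<le> S x \<and> S x \<le> 1"
    "\<And>x. x \<le> 0 \<Longrightarrow> S x = 0" "\<And>x. x \<ge> 1 \<Longrightarrow> S x = (1::real)"
    using smooth_step by metis
  define T where "T x = S (2 * x + (- 1 / 2))" for x
  have T: "smooth T" unfolding T_def by (intro smooth_affine S)
  have T0: "T x = 0" if "x \<le> 1/4" for x using that by (auto simp: T_def intro: S)
  have T1: "T x = 1" if "x \<ge> 3/4" for x using that by (auto simp: T_def intro: S)
  have dT: "deriv T x = 0" if "x < 1/4 \<or> x > 1 - 1/4" for x
  proof (rule DERIV_imp_deriv)
    have "((\<lambda>y. T x) has_real_derivative 0) (at x)" by simp
    then show "(T has_real_derivative 0) (at x)"
      by (rule has_field_derivative_transform_within_open[where S="if x < 1/4 then {..<1/4} else {3/4<..}"])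
         (use that in \<open>auto simp: T0 T1 split: if_splits\<close>)
  qed
  show thesis
  proof
    show "deriv T \<in> test_funs"
      unfolding test_funs_iff using smooth_deriv[OF T] dT
      by (intro conjI exI[of _ "1/4"]) auto
    fix \<psi> assume \<psi>: "\<psi> \<in> test_funs"
    then obtain \<delta> where \<delta>: "\<delta> > 0" "\<And>x. x < \<delta> \<or> x > 1 - \<delta> \<Longrightarrow> \<psi> x = 0" and sm: "smooth \<psi>"
      unfolding test_funs_iff by blast
    obtain F where F: "\<And>x. (F has_real_derivative \<psi> x) (at x)" and F0: "\<And>x. x \<le> 0 \<Longrightarrow> F x = 0"
      using antiderivative_vanishing_left[OF smooth_continuous_on[OF sm]] \<delta> by (metis order.strict_trans)
    have smF: "smooth F" using F sm by (rule smooth_antiderivative)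
    have dF: "deriv F = \<psi>" using F by (intro ext DERIV_imp_deriv)
    have F1: "F 1 = (LINT t|dx_Omega. \<psi> t)"
      using smooth_prim_deriv[OF smF, of 1] F0[of 0] by (simp add: dF prim_1)
    have const: "F x = F y" if "x < y" "\<And>z. x < z \<Longrightarrow> z < y \<Longrightarrow> \<psi> z = 0" for x y
      by (rule DERIV_isconst_end[OF that(1), symmetric])
         (use that F in \<open>auto intro!: smooth_continuous_on smF intro: DERIV_cong\<close>)
    have Fl: "F x = 0" if "x < \<delta>" for x
      using const[of 0 x] F0[of x] F0[of 0] \<delta> that by (cases "x > 0") auto
    have Fr: "F x = F 1" if "x > 1 - \<delta>" for x
      using const[of 1 x] const[of x 1] \<delta> that by (cases x "1::real" rule: linorder_cases) auto
    define \<phi> where "\<phi> x = F x - F 1 * T x" for x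
    have "smooth \<phi>" unfolding \<phi>_def by (intro smooth_diff smooth_cmult smF T)
    moreover have "\<phi> x = 0" if "x < min \<delta> (1/4) \<or> x > 1 - min \<delta> (1/4)" for x
    proof (cases "x < min \<delta> (1/4)")
      case False
      then have "x > 1 - \<delta>" "x \<ge> 3/4" using that by auto
      then show ?thesis by (simp add: \<phi>_def Fr T1)
    qed (simp add: \<phi>_def Fl T0)
    ultimately have "\<phi> \<in> test_funs"
      unfolding test_funs_iff using \<delta>(1) by (intro conjI exI[of _ "min \<delta> (1/4)"]) auto
    moreover have "deriv \<phi> = (\<lambda>x. \<psi> x - F 1 * deriv T x)"
      unfolding \<phi>_def by (intro ext DERIV_imp_deriv DERIV_diff F DERIV_cmult smooth_DERIV T)
    ultimately show "\<exists>\<phi>\<in>test_funs. deriv \<phi> = (\<lambda>x. \<psi> x - (LINT t|dx_Omega. \<psi> t) * deriv T x)"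
      using F1 by auto
  qed
qed

lemma test_funs_dense_L2:
  assumes "square_integrable dx_Omega g" "\<epsilon> > 0"
  shows "\<exists>\<phi>\<in>test_funs. L2norm dx_Omega (\<lambda>x. g x - \<phi> x) < \<epsilon>"
proof -
  have "\<exists>\<phi>\<in>test_funs. integrable dx_Omega (\<lambda>x. \<bar>g x - \<phi> x\<bar> ^ 2) \<and>
      (LINT x|dx_Omega. \<bar>g x - \<phi> x\<bar> ^ 2) < \<epsilon>\<^sup>2"
    using assms by (intro test_funs_dense) (auto simp: square_integrable_def)
  then show ?thesis
    using assms(2) by (auto simp: L2norm_def intro!: bexI real_less_lsqrt)
qed

text \<open>Derivatives of test functions are dense in the functions of mean zero.\<close>

lemma deriv_test_funs_dense:
  assumes g: "square_integrable dx_Omega g" "(LINT x|dx_Omega. g x) = 0" and "\<epsilon> > 0"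
  shows "\<exists>\<phi>\<in>test_funs. L2norm dx_Omega (\<lambda>x. g x - deriv \<phi> x) < \<epsilon>"
proof -
  obtain \<tau> where \<tau>: "\<tau> \<in> test_funs"
    "\<And>\<psi>. \<psi> \<in> test_funs \<Longrightarrow> \<exists>\<phi>\<in>test_funs. deriv \<phi> = (\<lambda>x. \<psi> x - (LINT t|dx_Omega. \<psi> t) * \<tau> x)"
    using test_fun_antiderivative by metis
  define \<epsilon>' where "\<epsilon>' = \<epsilon> / (1 + L2norm dx_Omega \<tau>)"
  have pos: "1 + L2norm dx_Omega \<tau> > 0" by (simp add: add_pos_nonneg)
  then have "\<epsilon>' > 0" using assms by (simp add: \<epsilon>'_def)
  then obtain \<psi> where \<psi>: "\<psi> \<in> test_funs" "L2norm dx_Omega (\<lambda>x. g x - \<psi> x) < \<epsilon>'"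
    using test_funs_dense_L2[OF g(1)] by blast
  obtain \<phi> where \<phi>: "\<phi> \<in> test_funs" "deriv \<phi> = (\<lambda>x. \<psi> x - (LINT t|dx_Omega. \<psi> t) * \<tau> x)"
    using \<tau>(2)[OF \<psi>(1)] by blast
  note sq\<psi> = smooth_square_integrable[OF test_funs_smooth[OF \<psi>(1)]]
  note sq\<tau> = smooth_square_integrable[OF test_funs_smooth[OF \<tau>(1)]]
  define m where "m = (LINT t|dx_Omega. \<psi> t)"
  have "(LINT x|dx_Omega. g x - \<psi> x) = - m"
    using g sq\<psi> by (simp add: m_def Omega.square_integrable_integrable)
  then have m: "\<bar>m\<bar> \<le> L2norm dx_Omega (\<lambda>x. g x - \<psi> x)"
    using abs_integral_Omega_le_L2norm[OF square_integrable_diff[OF g(1) sq\<psi>]] by simp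
  have "L2norm dx_Omega (\<lambda>x. g x - deriv \<phi> x) = L2norm dx_Omega (\<lambda>x. (g x - \<psi> x) + m * \<tau> x)"
    by (simp add: \<phi>(2) m_def algebra_simps)
  also have "\<dots> \<le> L2norm dx_Omega (\<lambda>x. g x - \<psi> x) + \<bar>m\<bar> * L2norm dx_Omega \<tau>"
    using L2norm_add_le[OF square_integrable_diff[OF g(1) sq\<psi>] square_integrable_cmult[OF sq\<tau>, of m]]
    by (simp add: L2norm_cmult)
  also have "\<dots> \<le> L2norm dx_Omega (\<lambda>x. g x - \<psi> x) * (1 + L2norm dx_Omega \<tau>)"
    using mult_right_mono[OF m, of "L2norm dx_Omega \<tau>"] by (simp add: algebra_simps)
  also have "\<dots> < \<epsilon>' * (1 + L2norm dx_Omega \<tau>)"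
    using \<psi>(2) pos by (intro mult_strict_right_mono)
  also have "\<dots> = \<epsilon>" using pos by (simp add: \<epsilon>'_def)
  finally show ?thesis using \<phi>(1) by blast
qed

lemma deriv_test_funs_sequence:
  assumes "square_integrable dx_Omega g" "(LINT x|dx_Omega. g x) = 0"
  obtains \<phi> :: "nat \<Rightarrow> real \<Rightarrow> real" where "\<And>k. \<phi> k \<in> test_funs"
    "(\<lambda>k. L2norm dx_Omega (\<lambda>x. g x - deriv (\<phi> k) x)) \<longlonglongrightarrow> 0"
proof -
  have "\<forall>k::nat. \<exists>\<phi>\<in>test_funs. L2norm dx_Omega (\<lambda>x. g x - deriv \<phi> x) < inverse (real (Suc k))"
    using deriv_test_funs_dense[OF assms] by simp
  then obtain \<phi> where \<phi>: "\<And>k. \<phi> k \<in> test_funs"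
    "\<And>k. L2norm dx_Omega (\<lambda>x. g x - deriv (\<phi> k) x) < inverse (real (Suc k))"
    by metis
  have "(\<lambda>k. L2norm dx_Omega (\<lambda>x. g x - deriv (\<phi> k) x)) \<longlonglongrightarrow> 0"
    by (rule Lim_null_comparison[OF always_eventually LIMSEQ_inverse_real_of_nat])
       (use \<phi>(2) in \<open>auto intro: less_imp_le\<close>)
  with \<phi>(1) show thesis by (rule that)
qed

text \<open>
  For a test function in place of \<open>g\<close> this is the fundamental theorem of calculus. Both sides are
  continuous in \<open>g\<close> with respect to the \<open>L\<^sup>1\<close> norm, in which the test functions are dense.
\<close>

lemma prim_integration_by_parts:
  assumes g: "integrable dx_Omega g" and \<psi>: "\<psi> \<in> test_funs"
  shows "(LINT x|dx_Omega. prim g x * deriv \<psi> x) = - (LINT x|dx_Omega. g x * \<psi> x)"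
proof -
  obtain K where K: "K \<ge> 0" "\<And>x. x \<in> Omega \<Longrightarrow> \<bar>\<psi> x\<bar> \<le> K"
    using smooth_bounded[OF test_funs_smooth[OF \<psi>]] by blast
  obtain K' where K': "K' \<ge> 0" "\<And>x. x \<in> Omega \<Longrightarrow> \<bar>deriv \<psi> x\<bar> \<le> K'"
    using smooth_bounded[OF smooth_deriv[OF test_funs_smooth[OF \<psi>]]] by blast
  note sm\<psi> = test_funs_smooth[OF \<psi>] smooth_deriv[OF test_funs_smooth[OF \<psi>]]
  note m\<psi> = sm\<psi>[THEN smooth_measurable_Omega]
  have imult: "integrable dx_Omega (\<lambda>x. h x * \<psi> x)" if "integrable dx_Omega h" for h
    by (rule Bochner_Integration.integrable_bound[of _ "\<lambda>x. K * \<bar>h x\<bar>"])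
       (use that K m\<psi> in \<open>auto simp: abs_mult mult.commute intro!: AE_I2 mult_mono\<close>)
  have *: "\<bar>(LINT x|dx_Omega. prim g x * deriv \<psi> x) + (LINT x|dx_Omega. g x * \<psi> x)\<bar> \<le> (K + K') * \<epsilon>"
    if eps: "\<epsilon> > 0" for \<epsilon>
  proof -
    obtain \<phi> where \<phi>: "\<phi> \<in> test_funs" "(LINT x|dx_Omega. \<bar>g x - \<phi> x\<bar>) < \<epsilon>"
      using test_funs_dense[of g 1 \<epsilon>] g eps by auto
    have zero: "\<phi> x = 0" if "x < 0" for x
      using \<phi>(1) that unfolding test_funs_iff by (meson order.strict_trans)
    obtain F where F: "\<And>x. (F has_real_derivative \<phi> x) (at x)" and F0: "\<And>x. x \<le> 0 \<Longrightarrow> F x = 0"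
      using antiderivative_vanishing_left[OF smooth_continuous_on[OF test_funs_smooth[OF \<phi>(1)]] zero]
      by blast
    have smF: "smooth F" using F test_funs_smooth[OF \<phi>(1)] by (rule smooth_antiderivative)
    have dF: "deriv F = \<phi>" using F by (intro ext DERIV_imp_deriv)
    have Fp: "F x = prim \<phi> x" if "x \<in> Omega" for x
      using smooth_prim_deriv[OF smF, of x] F0[of 0] that by (simp add: dF)
    note i\<phi> = smooth_integrable[OF test_funs_smooth[OF \<phi>(1)]]
    have id: "integrable dx_Omega (\<lambda>x. g x - \<phi> x)" using g i\<phi> by simp
    have Fg: "\<bar>prim g x - F x\<bar> \<le> (LINT x|dx_Omega. \<bar>g x - \<phi> x\<bar>)" if "x \<in> Omega" for x
      using prim_abs_le[OF id, of x] that by (simp add: prim_diff g i\<phi> Fp)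
    have sq: "square_integrable dx_Omega (\<lambda>x. prim g x - F x)"
      by (intro square_integrable_diff prim_square_integrable g smooth_square_integrable smF)
    have i1: "integrable dx_Omega (\<lambda>x. (prim g x - F x) * deriv \<psi> x)"
      by (intro square_integrable_mult sq smooth_square_integrable sm\<psi>)
    have "(LINT x|dx_Omega. prim g x * deriv \<psi> x) + (LINT x|dx_Omega. g x * \<psi> x) =
      ((LINT x|dx_Omega. prim g x * deriv \<psi> x) - (LINT x|dx_Omega. F x * deriv \<psi> x)) +
      ((LINT x|dx_Omega. g x * \<psi> x) - (LINT x|dx_Omega. \<phi> x * \<psi> x))"
      using smooth_integration_by_parts[OF smF \<psi>] by (simp add: dF)
    also have "(LINT x|dx_Omega. prim g x * deriv \<psi> x) - (LINT x|dx_Omega. F x * deriv \<psi> x) =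
      (LINT x|dx_Omega. prim g x * deriv \<psi> x - F x * deriv \<psi> x)"
      by (intro Bochner_Integration.integral_diff[symmetric] square_integrable_mult prim_square_integrable g
          smooth_square_integrable smF sm\<psi>)
    also have "\<dots> = (LINT x|dx_Omega. (prim g x - F x) * deriv \<psi> x)"
      by (simp add: algebra_simps)
    also have "(LINT x|dx_Omega. g x * \<psi> x) - (LINT x|dx_Omega. \<phi> x * \<psi> x) =
      (LINT x|dx_Omega. g x * \<psi> x - \<phi> x * \<psi> x)"
      by (intro Bochner_Integration.integral_diff[symmetric] imult g i\<phi>)
    also have "\<dots> = (LINT x|dx_Omega. (g x - \<phi> x) * \<psi> x)"
      by (simp add: algebra_simps)
    finally have "\<bar>(LINT x|dx_Omega. prim g x * deriv \<psi> x) + (LINT x|dx_Omega. g x * \<psi> x)\<bar> \<le>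
      (LINT x|dx_Omega. \<bar>(prim g x - F x) * deriv \<psi> x\<bar>) + (LINT x|dx_Omega. \<bar>(g x - \<phi> x) * \<psi> x\<bar>)"
      using integral_abs_bound[of dx_Omega "\<lambda>x. (prim g x - F x) * deriv \<psi> x"]
        integral_abs_bound[of dx_Omega "\<lambda>x. (g x - \<phi> x) * \<psi> x"] by linarith
    also have "(LINT x|dx_Omega. \<bar>(prim g x - F x) * deriv \<psi> x\<bar>) \<le>
       (LINT x|dx_Omega. (LINT x|dx_Omega. \<bar>g x - \<phi> x\<bar>) * K')"
      by (intro integral_mono integrable_abs i1)
         (use Fg K' in \<open>auto simp: abs_mult intro!: mult_mono\<close>)
    also have "\<dots> = K' * (LINT x|dx_Omega. \<bar>g x - \<phi> x\<bar>)"
      using measure_Omega by simp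
    also have "(LINT x|dx_Omega. \<bar>(g x - \<phi> x) * \<psi> x\<bar>) \<le> (LINT x|dx_Omega. K * \<bar>g x - \<phi> x\<bar>)"
      by (intro integral_mono integrable_abs imult id integrable_mult_right)
         (use K in \<open>auto simp: abs_mult mult.commute intro!: mult_mono\<close>)
    also have "\<dots> = K * (LINT x|dx_Omega. \<bar>g x - \<phi> x\<bar>)" by simp
    finally have "\<bar>(LINT x|dx_Omega. prim g x * deriv \<psi> x) + (LINT x|dx_Omega. g x * \<psi> x)\<bar>
      \<le> (K + K') * (LINT x|dx_Omega. \<bar>g x - \<phi> x\<bar>)" by (simp add: algebra_simps)
    also have "\<dots> \<le> (K + K') * \<epsilon>"
      using K K' \<phi>(2) by (intro mult_left_mono) auto
    finally show ?thesis .
  qed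
  have "\<bar>(LINT x|dx_Omega. prim g x * deriv \<psi> x) + (LINT x|dx_Omega. g x * \<psi> x)\<bar> \<le> 0"
  proof (rule field_le_epsilon)
    fix e :: real assume "e > 0"
    have pos: "K + K' + 1 > 0" using K K' by simp
    have "(K + K') * (e / (K + K' + 1)) \<le> (K + K' + 1) * (e / (K + K' + 1))"
      using \<open>e > 0\<close> pos by (intro mult_right_mono) auto
    also have "\<dots> = e" using pos by simp
    finally show "\<bar>(LINT x|dx_Omega. prim g x * deriv \<psi> x) + (LINT x|dx_Omega. g x * \<psi> x)\<bar> \<le> 0 + e"
      using *[of "e / (K + K' + 1)"] \<open>e > 0\<close> pos by simp
  qed
  then show ?thesis by simp
qed

lemma integrable_locally_integrable:
  "integrable dx_Omega v \<Longrightarrow> locally_integrable v"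
  unfolding locally_integrable_def
  by (auto intro!: integrable_restrict_Omega lmeasurable_compact fmeasurableD)

text \<open>
  Every primitive of a square integrable function with mean zero belongs to \<open>H\<^sub>0\<^sup>1(\<Omega>)\<close>: the test
  functions whose derivatives approximate \<open>g\<close> approximate the primitive even uniformly.
\<close>

lemma H10_prim:
  assumes g: "square_integrable dx_Omega g" "(LINT x|dx_Omega. g x) = 0"
    and v: "v \<in> borel_measurable dx_Omega" "AE x in dx_Omega. v x = prim g x"
  shows "H10 v g"
proof -
  note ig = Omega.square_integrable_integrable[OF g(1)]
  have sqv: "square_integrable dx_Omega v"
    by (rule square_integrable_cong_AE[OF prim_square_integrable[OF ig] v(1)])
       (use v(2) in eventually_elim, simp)
  have cong: "(LINT x|dx_Omega. v x * h x) = (LINT x|dx_Omega. prim g x * h x)"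
    if "h \<in> borel_measurable dx_Omega" for h
    by (rule integral_cong_AE) (use v that prim_measurable[OF ig] in auto)
  have "has_weak_deriv v g"
    unfolding has_weak_deriv_def
    using integrable_locally_integrable[OF ig]
      integrable_locally_integrable[OF Omega.square_integrable_integrable[OF sqv]]
    by (auto simp: cong smooth_measurable_Omega smooth_deriv test_funs_smooth prim_integration_by_parts[OF ig])
  then have H1: "H1 v g" using sqv g by (simp add: H1_def Lp_2_iff)
  obtain \<phi> where \<phi>: "\<And>k::nat. \<phi> k \<in> test_funs"
    "(\<lambda>k. L2norm dx_Omega (\<lambda>x. g x - deriv (\<phi> k) x)) \<longlonglongrightarrow> 0"
    using deriv_test_funs_sequence[OF g] by metis
  have "L2norm dx_Omega (\<lambda>x. v x - \<phi> k x) \<le> L2norm dx_Omega (\<lambda>x. g x - deriv (\<phi> k) x)" for k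
  proof -
    note sm = test_funs_smooth[OF \<phi>(1)[of k]]
    have sq: "square_integrable dx_Omega (\<lambda>x. g x - deriv (\<phi> k) x)"
      by (intro square_integrable_diff g smooth_square_integrable smooth_deriv sm)
    have eq: "prim (\<lambda>x. g x - deriv (\<phi> k) x) x = prim g x - \<phi> k x" if "x \<in> Omega" for x
      using that by (simp add: prim_diff ig smooth_integrable smooth_deriv sm test_fun_prim \<phi>)
    have "L2norm dx_Omega (\<lambda>x. v x - \<phi> k x) = L2norm dx_Omega (prim (\<lambda>x. g x - deriv (\<phi> k) x))"
    proof (rule L2norm_cong_AE)
      show "AE x in dx_Omega. v x - \<phi> k x = prim (\<lambda>x. g x - deriv (\<phi> k) x) x"
        using v(2) AE_space by eventually_elim (simp add: eq)
      show "prim (\<lambda>x. g x - deriv (\<phi> k) x) \<in> borel_measurable dx_Omega"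
        by (intro prim_measurable Omega.square_integrable_integrable sq)
    qed (use v(1) smooth_measurable_Omega[OF sm] in simp)
    also have "\<dots> \<le> L2norm dx_Omega (\<lambda>x. g x - deriv (\<phi> k) x)"
      by (rule L2norm_prim_le[OF sq])
    finally show ?thesis .
  qed
  then have "(\<lambda>k. L2norm dx_Omega (\<lambda>x. v x - \<phi> k x)) \<longlonglongrightarrow> 0"
    by (intro Lim_null_comparison[OF always_eventually \<phi>(2)]) simp
  with \<phi> H1 show ?thesis unfolding H10_def Lp_norm_2 by blast
qed

lemma H10_D:
  assumes "H10 v dv"
  shows "square_integrable dx_Omega v" "square_integrable dx_Omega dv"
    "(LINT x|dx_Omega. dv x) = 0" "AE x in dx_Omega. v x = prim dv x"
proof -
  show sqv: "square_integrable dx_Omega v" and sqd: "square_integrable dx_Omega dv"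
    using assms by (auto simp: H10_def H1_def Lp_2_iff)
  note id = Omega.square_integrable_integrable[OF sqd]
  obtain \<phi> :: "nat \<Rightarrow> real \<Rightarrow> real" where \<phi>: "\<And>k. \<phi> k \<in> test_funs"
    and lim: "(\<lambda>k. L2norm dx_Omega (\<lambda>x. v x - \<phi> k x)) \<longlonglongrightarrow> 0"
      "(\<lambda>k. L2norm dx_Omega (\<lambda>x. dv x - deriv (\<phi> k) x)) \<longlonglongrightarrow> 0"
    using assms unfolding H10_def Lp_norm_2 by blast
  note sm = test_funs_smooth[OF \<phi>] smooth_deriv[OF test_funs_smooth[OF \<phi>]]
  note sq = sm[THEN smooth_square_integrable]
  have dsq: "square_integrable dx_Omega (\<lambda>x. dv x - deriv (\<phi> k) x)" for k
    by (intro square_integrable_diff sqd sq)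
  have "\<bar>LINT x|dx_Omega. dv x\<bar> \<le> L2norm dx_Omega (\<lambda>x. dv x - deriv (\<phi> k) x)" for k
    using abs_integral_Omega_le_L2norm[OF dsq, of k]
    by (simp add: id smooth_integrable sm integral_deriv_test_fun \<phi>)
  then have "\<bar>LINT x|dx_Omega. dv x\<bar> \<le> 0"
    by (intro LIMSEQ_le_const[OF lim(2)]) auto
  then show "(LINT x|dx_Omega. dv x) = 0" by simp
  have psq: "square_integrable dx_Omega (prim dv)" by (rule prim_square_integrable[OF id])
  have "L2norm dx_Omega (\<lambda>x. v x - prim dv x) \<le>
      L2norm dx_Omega (\<lambda>x. v x - \<phi> k x) + L2norm dx_Omega (\<lambda>x. dv x - deriv (\<phi> k) x)" for k
  proof -
    have eq: "prim (\<lambda>x. dv x - deriv (\<phi> k) x) x = prim dv x - \<phi> k x" if "x \<in> Omega" for x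
      using that by (simp add: prim_diff id smooth_integrable sm test_fun_prim \<phi>)
    have "L2norm dx_Omega (\<lambda>x. v x - prim dv x)
       = L2norm dx_Omega (\<lambda>x. (v x - \<phi> k x) - prim (\<lambda>x. dv x - deriv (\<phi> k) x) x)"
      unfolding L2norm_def
      by (intro arg_cong[of _ _ sqrt] Bochner_Integration.integral_cong refl) (simp add: eq)
    also have "\<dots> \<le> L2norm dx_Omega (\<lambda>x. v x - \<phi> k x) + L2norm dx_Omega (prim (\<lambda>x. dv x - deriv (\<phi> k) x))"
      by (intro L2norm_diff_le square_integrable_diff sqv sq prim_square_integrable
          Omega.square_integrable_integrable dsq)
    also have "L2norm dx_Omega (prim (\<lambda>x. dv x - deriv (\<phi> k) x)) \<le> L2norm dx_Omega (\<lambda>x. dv x - deriv (\<phi> k) x)"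
      by (rule L2norm_prim_le[OF dsq])
    finally show ?thesis by simp
  qed
  then have "L2norm dx_Omega (\<lambda>x. v x - prim dv x) \<le> 0 + 0"
    by (intro LIMSEQ_le_const[OF tendsto_add[OF lim]]) auto
  then have "L2norm dx_Omega (\<lambda>x. v x - prim dv x) = 0"
    using L2norm_nonneg[of dx_Omega "\<lambda>x. v x - prim dv x"] by linarith
  then have "AE x in dx_Omega. v x - prim dv x = 0"
    by (intro L2norm_eq_0 square_integrable_diff sqv psq)
  then show "AE x in dx_Omega. v x = prim dv x" by simp
qed

text \<open>
  In one dimension \<open>H\<^sub>0\<^sup>1(\<Omega>)\<close> consists exactly of the primitives of square integrable functions with
  mean zero. This description is used from here on instead of closure and weak derivatives.
\<close>

lemma H10_iff:
  "H10 v dv \<longleftrightarrow> square_integrable dx_Omega v \<and> square_integrable dx_Omega dv \<and>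
     (LINT x|dx_Omega. dv x) = 0 \<and> (AE x in dx_Omega. v x = prim dv x)"
  using H10_D[of v dv] H10_prim[of dv v] square_integrable_measurable by blast

lemma H10_sequence:
  assumes "H10 v dv"
  obtains \<phi> :: "nat \<Rightarrow> real \<Rightarrow> real" where "\<And>k. \<phi> k \<in> test_funs"
    "(\<lambda>k. L2norm dx_Omega (\<lambda>x. v x - \<phi> k x)) \<longlonglongrightarrow> 0"
    "(\<lambda>k. L2norm dx_Omega (\<lambda>x. dv x - deriv (\<phi> k) x)) \<longlonglongrightarrow> 0"
  using assms unfolding H10_def Lp_norm_2 by blast

lemma H10_poincare:
  assumes "H10 v dv"
  shows "L2norm dx_Omega v \<le> L2norm dx_Omega dv"
proof -
  note D = H10_D[OF assms]
  have "L2norm dx_Omega v = L2norm dx_Omega (prim dv)"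
    using D by (intro L2norm_cong_AE prim_measurable) (auto simp: Omega.square_integrable_integrable)
  then show ?thesis using L2norm_prim_le[OF D(2)] by simp
qed

lemma weak_deriv_integration_by_parts:
  assumes a: "square_integrable dx_Omega a" "square_integrable dx_Omega da" "has_weak_deriv a da"
    and w: "H10 w dw"
  shows "(LINT x|dx_Omega. a x * dw x) = - (LINT x|dx_Omega. da x * w x)"
proof -
  obtain \<phi> :: "nat \<Rightarrow> real \<Rightarrow> real" where \<phi>: "\<And>k. \<phi> k \<in> test_funs"
    and lim: "(\<lambda>k. L2norm dx_Omega (\<lambda>x. w x - \<phi> k x)) \<longlonglongrightarrow> 0"
      "(\<lambda>k. L2norm dx_Omega (\<lambda>x. dw x - deriv (\<phi> k) x)) \<longlonglongrightarrow> 0"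
    using H10_sequence[OF w] by blast
  note sm = test_funs_smooth[OF \<phi>] smooth_deriv[OF test_funs_smooth[OF \<phi>]]
  note sq = sm[THEN smooth_square_integrable]
  have "(\<lambda>k. LINT x|dx_Omega. a x * deriv (\<phi> k) x) \<longlonglongrightarrow> (LINT x|dx_Omega. a x * dw x)"
    by (intro L2_tendsto_integral_mult L2norm_diff_self_tendsto lim a sq H10_D[OF w])
  moreover have "(\<lambda>k. - (LINT x|dx_Omega. da x * \<phi> k x)) \<longlonglongrightarrow> - (LINT x|dx_Omega. da x * w x)"
    by (intro tendsto_minus L2_tendsto_integral_mult L2norm_diff_self_tendsto lim a sq H10_D[OF w])
  moreover have "(LINT x|dx_Omega. a x * deriv (\<phi> k) x) = - (LINT x|dx_Omega. da x * \<phi> k x)" for k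
    using a(3) \<phi> by (simp add: has_weak_deriv_def)
  ultimately show ?thesis using LIMSEQ_unique by simp
qed

text \<open>
  The identity \<open>\<integral>bw'w = -1/2 \<integral>b'w\<^sup>2\<close> for \<open>w\<close> in \<open>H\<^sub>0\<^sup>1(\<Omega>)\<close>. For a test function \<open>w\<close> it is the definition of
  the weak derivative \<open>b'\<close>, tested with \<open>w\<^sup>2\<close>; then both sides are continuous in \<open>w\<close>.
\<close>

lemma weak_deriv_square:
  assumes b: "W1inf b db" and w: "H10 w dw"
  shows "(LINT x|dx_Omega. b x * dw x * w x) = - (1 / 2) * (LINT x|dx_Omega. db x * w x * w x)"
proof -
  obtain K K' where m: "b \<in> borel_measurable dx_Omega" "db \<in> borel_measurable dx_Omega"
    and K: "AE x in dx_Omega. \<bar>b x\<bar> \<le> K" and K': "AE x in dx_Omega. \<bar>db x\<bar> \<le> K'"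
    using b by (auto simp: W1inf_def Linf_def)
  obtain \<phi> :: "nat \<Rightarrow> real \<Rightarrow> real" where \<phi>: "\<And>k. \<phi> k \<in> test_funs"
    and lim: "(\<lambda>k. L2norm dx_Omega (\<lambda>x. w x - \<phi> k x)) \<longlonglongrightarrow> 0"
      "(\<lambda>k. L2norm dx_Omega (\<lambda>x. dw x - deriv (\<phi> k) x)) \<longlonglongrightarrow> 0"
    using H10_sequence[OF w] by blast
  note sm = test_funs_smooth[OF \<phi>] smooth_deriv[OF test_funs_smooth[OF \<phi>]]
  note sq = sm[THEN smooth_square_integrable]
  note D = H10_D[OF w]
  have limc: "(\<lambda>k. L2norm dx_Omega (\<lambda>x. c x * F x - c x * f k x)) \<longlonglongrightarrow> 0"
    if l: "(\<lambda>k. L2norm dx_Omega (\<lambda>x. F x - f k x)) \<longlonglongrightarrow> 0" and c: "c \<in> borel_measurable dx_Omega"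
      "AE x in dx_Omega. \<bar>c x\<bar> \<le> L" and s: "square_integrable dx_Omega F" "\<And>k. square_integrable dx_Omega (f k)"
    for c F L and f :: "nat \<Rightarrow> real \<Rightarrow> real"
  proof (rule Lim_null_comparison[OF always_eventually tendsto_mult_right_zero[OF l, of "max L 0"]], rule allI)
    fix k
    have "AE x in dx_Omega. \<bar>c x\<bar> \<le> max L 0" using c(2) by eventually_elim auto
    from L2norm_bounded_mult[OF square_integrable_diff[OF s] c(1) this]
    show "norm (L2norm dx_Omega (\<lambda>x. c x * F x - c x * f k x)) \<le> max L 0 * L2norm dx_Omega (\<lambda>x. F x - f k x)"
      by (simp add: right_diff_distrib)
  qed
  have l1: "(\<lambda>k. LINT x|dx_Omega. b x * deriv (\<phi> k) x * \<phi> k x) \<longlonglongrightarrow> (LINT x|dx_Omega. b x * dw x * w x)"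
    by (intro L2_tendsto_integral_mult limc[OF _ m(1) K] lim sq D
        square_integrable_bounded_mult[OF _ m(1) K])
  have l2: "(\<lambda>k. - (1 / 2) * (LINT x|dx_Omega. db x * \<phi> k x * \<phi> k x)) \<longlonglongrightarrow>
     - (1 / 2) * (LINT x|dx_Omega. db x * w x * w x)"
    by (intro tendsto_mult tendsto_const L2_tendsto_integral_mult limc[OF _ m(2) K'] lim sq D
        square_integrable_bounded_mult[OF _ m(2) K'])
  have eq: "(LINT x|dx_Omega. b x * deriv (\<phi> k) x * \<phi> k x) = - (1 / 2) * (LINT x|dx_Omega. db x * \<phi> k x * \<phi> k x)" for k
  proof -
    have "deriv (\<lambda>x. \<phi> k x * \<phi> k x) = (\<lambda>x. deriv (\<phi> k) x * \<phi> k x + deriv (\<phi> k) x * \<phi> k x)"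
      by (intro ext DERIV_imp_deriv DERIV_mult smooth_DERIV sm)
    moreover have "(LINT x|dx_Omega. b x * deriv (\<lambda>x. \<phi> k x * \<phi> k x) x) =
        - (LINT x|dx_Omega. db x * (\<phi> k x * \<phi> k x))"
      using b test_funs_mult[OF \<phi> sm(1), of k k] by (simp add: W1inf_def has_weak_deriv_def)
    ultimately have "(LINT x|dx_Omega. 2 * (b x * deriv (\<phi> k) x * \<phi> k x)) = - (LINT x|dx_Omega. db x * \<phi> k x * \<phi> k x)"
      by (simp add: algebra_simps)
    then show ?thesis by simp
  qed
  show ?thesis using l1 l2 unfolding eq by (rule LIMSEQ_unique)
qed

text \<open>
  The lemma of du Bois-Reymond. The function \<open>g = r - \<integral>r'\<close> is orthogonal to all derivatives of test
  functions, hence to all functions of mean zero, among them \<open>g\<close> minus its mean value.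
\<close>

lemma weak_deriv_L1_prim:
  assumes r: "square_integrable dx_Omega r" "integrable dx_Omega dr" "has_weak_deriv r dr"
  obtains m where "AE x in dx_Omega. r x = m + prim dr x"
proof -
  define g where "g x = r x - prim dr x" for x
  define m where "m = (LINT x|dx_Omega. g x)"
  have sqg: "square_integrable dx_Omega g"
    unfolding g_def by (intro square_integrable_diff r prim_square_integrable)
  have sq1: "square_integrable dx_Omega (\<lambda>x. m)"
    by (intro Omega.square_integrable_bounded[of _ "\<bar>m\<bar>"]) auto
  have sqG: "square_integrable dx_Omega (\<lambda>x. g x - m)"
    by (intro square_integrable_diff sqg sq1)
  have G0: "(LINT x|dx_Omega. g x - m) = 0"
    using measure_Omega by (simp add: Omega.square_integrable_integrable sqg m_def)
  obtain \<phi> where \<phi>: "\<And>k::nat. \<phi> k \<in> test_funs"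
    "(\<lambda>k. L2norm dx_Omega (\<lambda>x. (g x - m) - deriv (\<phi> k) x)) \<longlonglongrightarrow> 0"
    using deriv_test_funs_sequence[OF sqG G0] by metis
  note sq = smooth_square_integrable[OF smooth_deriv[OF test_funs_smooth[OF \<phi>(1)]]]
  have "(LINT x|dx_Omega. g x * deriv (\<phi> k) x) = 0" for k
  proof -
    have "(LINT x|dx_Omega. g x * deriv (\<phi> k) x) =
        (LINT x|dx_Omega. r x * deriv (\<phi> k) x - prim dr x * deriv (\<phi> k) x)"
      by (simp add: g_def left_diff_distrib)
    also have "\<dots> = (LINT x|dx_Omega. r x * deriv (\<phi> k) x) - (LINT x|dx_Omega. prim dr x * deriv (\<phi> k) x)"
      by (intro Bochner_Integration.integral_diff square_integrable_mult r sq prim_square_integrable)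
    also have "\<dots> = 0"
      using r(3) \<phi>(1) prim_integration_by_parts[OF r(2) \<phi>(1)] by (simp add: has_weak_deriv_def)
    finally show ?thesis .
  qed
  moreover have "(\<lambda>k. LINT x|dx_Omega. g x * deriv (\<phi> k) x) \<longlonglongrightarrow> (LINT x|dx_Omega. g x * (g x - m))"
    by (intro L2_tendsto_integral_mult L2norm_diff_self_tendsto sqg sq sqG \<phi>)
  ultimately have "(LINT x|dx_Omega. g x * (g x - m)) = 0"
    by (simp add: LIMSEQ_const_iff)
  moreover have "(LINT x|dx_Omega. (g x - m)\<^sup>2) =
      (LINT x|dx_Omega. g x * (g x - m)) - (LINT x|dx_Omega. m * (g x - m))"
    by (subst Bochner_Integration.integral_diff[symmetric])
       (auto intro!: square_integrable_mult sqg sqG sq1 Bochner_Integration.integral_cong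
          simp: power2_eq_square algebra_simps simp del: integral_mult_right)
  moreover have "(LINT x|dx_Omega. m * (g x - m)) = 0" using G0 by (simp only: integral_mult_right_zero)
  ultimately have "L2norm dx_Omega (\<lambda>x. g x - m) = 0" by (simp add: L2norm_def)
  from L2norm_eq_0[OF sqG this] have "AE x in dx_Omega. r x = m + prim dr x"
    by eventually_elim (simp add: g_def)
  then show thesis by (rule that)
qed

section \<open>Meshes and piecewise constant functions\<close>

lemma elem_borel [simp]: "elem X i \<in> sets borel"
  by (simp add: elem_def)

lemma mesh_pos: "mesh N X \<Longrightarrow> N > 0"
  by (cases N) (auto simp: mesh_def)

lemma mesh_strict_mono:
  assumes "mesh N X" "i < j" "j \<le> N"
  shows "X i < X j"
  using assms(2,3)
proof (induction j)
  case (Suc j)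
  have "X j < X (Suc j)" using assms(1) Suc.prems by (auto simp: mesh_def dest!: bspec[of _ _ "Suc j"])
  then show ?case using Suc by (cases "i = j") auto
qed simp

lemma mesh_mono: "mesh N X \<Longrightarrow> i \<le> j \<Longrightarrow> j \<le> N \<Longrightarrow> X i \<le> X j"
  using mesh_strict_mono[of N X i j] by (cases "i = j") auto

lemma mesh_range: "mesh N X \<Longrightarrow> i \<le> N \<Longrightarrow> 0 \<le> X i \<and> X i \<le> 1"
  using mesh_mono[of N X 0 i] mesh_mono[of N X i N] by (auto simp: mesh_def)

lemma elem_subset: "mesh N X \<Longrightarrow> i \<in> {1..N} \<Longrightarrow> elem X i \<subseteq> Omega"
  using mesh_range[of N X "i - 1"] mesh_range[of N X i] by (force simp: elem_def)

lemma elem_size_pos: "mesh N X \<Longrightarrow> i \<in> {1..N} \<Longrightarrow> elem_size X i > 0"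
  by (simp add: mesh_def elem_size_def)

lemma sum_elem_size:
  assumes "mesh N X"
  shows "(\<Sum>i=1..N. elem_size X i) = 1"
proof -
  have "(\<Sum>i=1..n. elem_size X i) = X n - X 0" for n
    by (induction n) (auto simp: elem_size_def)
  then show ?thesis using assms by (simp add: mesh_def)
qed

lemma elem_disjoint:
  assumes "mesh N X" "i \<in> {1..N}" "j \<in> {1..N}" "x \<in> elem X i" "x \<in> elem X j"
  shows "i = j"
proof (rule ccontr)
  assume "i \<noteq> j"
  then consider "i \<le> j - 1" | "j \<le> i - 1" by linarith
  then show False
  proof cases
    case 1
    then show False using mesh_mono[OF assms(1), of i "j - 1"] assms by (force simp: elem_def)
  next
    case 2
    then show False using mesh_mono[OF assms(1), of j "i - 1"] assms by (force simp: elem_def)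
  qed
qed

lemma elem_cover:
  assumes "mesh N X" "x \<in> Omega" "x \<notin> X ` {0..N}"
  obtains i where "i \<in> {1..N}" "x \<in> elem X i"
proof -
  define i where "i = (LEAST i. x < X i)"
  have N: "x < X N" using assms by (simp add: mesh_def)
  have xi: "x < X i" unfolding i_def by (rule LeastI[of _ N]) (rule N)
  have iN: "i \<le> N" unfolding i_def by (rule Least_le) (rule N)
  have i0: "i \<noteq> 0" using xi assms by (metis mesh_def greaterThanLessThan_iff order.asym)
  then have "\<not> x < X (i - 1)" unfolding i_def by (intro not_less_Least) simp
  moreover have "x \<noteq> X (i - 1)" using assms(3) iN by auto
  ultimately have "x \<in> elem X i" using xi by (simp add: elem_def)
  with i0 iN show thesis by (intro that) auto
qed

lemma Omega_lebesgue: "Omega \<inter> space lebesgue \<in> sets lebesgue"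
  by simp

text \<open>The finitely many mesh points may be ignored.\<close>

lemma AE_mesh:
  assumes "mesh N X" and "\<And>x i. i \<in> {1..N} \<Longrightarrow> x \<in> elem X i \<Longrightarrow> x \<in> Omega \<Longrightarrow> P x"
  shows "AE x in dx_Omega. P x"
proof -
  have "AE x in lebesgue. x \<notin> X ` {0..N}"
    by (intro AE_not_in) (simp add: negligible_finite flip: negligible_iff_null_sets)
  then show ?thesis
    unfolding AE_restrict_space_iff[OF Omega_lebesgue]
    by (rule eventually_mono) (use assms(2) elem_cover[OF assms(1)] in blast)
qed

text \<open>The function with value \<open>p i\<close> on the \<open>i\<close>-th open element and zero elsewhere.\<close>

definition piecewise_const :: "nat \<Rightarrow> (nat \<Rightarrow> real) \<Rightarrow> (nat \<Rightarrow> real) \<Rightarrow> real \<Rightarrow> real" where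
  "piecewise_const N X p x = (\<Sum>i=1..N. p i * indicator (elem X i) x)"

lemma sum_indicator_elem:
  assumes "mesh N X" "i \<in> {1..N}" "x \<in> elem X i"
  shows "(\<Sum>j=1..N. indicator (elem X j) x * f j) = (f i :: real)"
proof -
  have "(\<Sum>j=1..N. indicator (elem X j) x * f j) = (\<Sum>j=1..N. if j = i then f i else 0)"
    using assms elem_disjoint[OF assms(1)] by (intro sum.cong) (auto simp: indicator_def)
  then show ?thesis using assms(2) by simp
qed

lemma piecewise_const_elem:
  assumes "mesh N X" "i \<in> {1..N}" "x \<in> elem X i"
  shows "piecewise_const N X p x = p i"
  using sum_indicator_elem[OF assms, of p] by (simp add: piecewise_const_def mult.commute)

lemma piecewise_const_square_integrable:
  "square_integrable dx_Omega (piecewise_const N X p)"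
proof -
  have "square_integrable dx_Omega (\<lambda>x. p i * indicator (elem X i) x)" for i
    by (intro square_integrable_cmult Omega.square_integrable_bounded[of _ 1] measurable_indicator_Omega)
       (auto simp: indicator_def)
  then show ?thesis unfolding piecewise_const_def by (intro square_integrable_sum)
qed

lemma integral_mesh:
  fixes F :: "real \<Rightarrow> real"
  assumes X: "mesh N X" and F: "integrable dx_Omega F"
  shows "(LINT x|dx_Omega. F x) = (\<Sum>i=1..N. LINT x|dx_Omega. indicator (elem X i) x * F x)"
proof -
  have int: "integrable dx_Omega (\<lambda>x. indicator (elem X i) x * F x :: real)" for i
    by (intro integrable_indicator_Omega F elem_borel)
  have "(LINT x|dx_Omega. F x) = (LINT x|dx_Omega. (\<Sum>i=1..N. indicator (elem X i) x * F x))"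
  proof (rule integral_cong_AE)
    show "AE x in dx_Omega. F x = (\<Sum>i=1..N. indicator (elem X i) x * F x)"
    proof (rule AE_mesh[OF X])
      fix x i assume "i \<in> {1..N}" "x \<in> elem X i"
      then show "F x = (\<Sum>i=1..N. indicator (elem X i) x * F x)"
        by (rule sum_indicator_elem[OF X, of i x "\<lambda>_. F x", symmetric])
    qed
    show "(\<lambda>x. \<Sum>i=1..N. indicator (elem X i) x * F x) \<in> borel_measurable dx_Omega"
      by (intro borel_measurable_sum borel_measurable_integrable int)
  qed (use F in simp)
  also have "\<dots> = (\<Sum>i=1..N. LINT x|dx_Omega. indicator (elem X i) x * F x)"
    by (rule Bochner_Integration.integral_sum) (rule int)
  finally show ?thesis .
qed

lemma integral_indicator_elem:
  assumes "mesh N X" "i \<in> {1..N}"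
  shows "(LINT x|dx_Omega. indicator (elem X i) x) = elem_size X i"
proof -
  have "(LINT x|lebesgue_on (elem X i). 1) = (LINT x|dx_Omega. indicat_real (elem X i) x * 1)"
    by (intro LINT_restrict_Omega elem_subset[OF assms]) (simp add: elem_def)
  moreover have "(LINT x|lebesgue_on (elem X i). (1::real)) = elem_size X i"
    using elem_size_pos[OF assms] by (simp add: measure_restrict_space elem_def elem_size_def)
  ultimately show ?thesis by simp
qed

text \<open>
  The norm of \<open>L\<^sup>2(K\<^sub>i)\<close>, computed on \<open>\<Omega>\<close> with an indicator function. The average \<open>elem_avg\<close> is this
  norm divided by \<open>\<surd>h\<^sub>i\<close>.
\<close>

abbreviation elem_norm :: "(nat \<Rightarrow> real) \<Rightarrow> nat \<Rightarrow> (real \<Rightarrow> real) \<Rightarrow> real" where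
  "elem_norm X i g \<equiv> L2norm dx_Omega (\<lambda>x. indicator (elem X i) x * g x)"

lemma elem_norm_sq:
  "(elem_norm X i g)\<^sup>2 = (LINT x|dx_Omega. indicator (elem X i) x * (g x)\<^sup>2)"
  unfolding L2norm_sq
  by (intro Bochner_Integration.integral_cong) (auto simp: indicator_def)

lemma sum_elem_norm_sq:
  assumes "mesh N X" "square_integrable dx_Omega g"
  shows "(\<Sum>i=1..N. (elem_norm X i g)\<^sup>2) = (L2norm dx_Omega g)\<^sup>2"
  unfolding elem_norm_sq
  unfolding L2norm_sq
  using integral_mesh[OF assms(1), of "\<lambda>x. (g x)\<^sup>2"] assms(2) by (simp add: square_integrable_def)

lemma elem_avg_sq:
  assumes "mesh N X" "i \<in> {1..N}"
  shows "elem_avg X g i = elem_norm X i g / sqrt (elem_size X i)"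
    and "elem_size X i * (elem_avg X g i)\<^sup>2 = (elem_norm X i g)\<^sup>2"
proof -
  have "(LINT x|lebesgue_on (elem X i). \<bar>g x\<bar>\<^sup>2) = (elem_norm X i g)\<^sup>2"
    unfolding elem_norm_sq using elem_subset[OF assms]
    by (subst LINT_restrict_Omega) (simp_all add: elem_def)
  then show eq: "elem_avg X g i = elem_norm X i g / sqrt (elem_size X i)"
    by (simp add: elem_avg_def real_sqrt_divide)
  show "elem_size X i * (elem_avg X g i)\<^sup>2 = (elem_norm X i g)\<^sup>2"
    using elem_size_pos[OF assms] by (simp add: eq power_divide)
qed

section \<open>The finite element space\<close>

lemma borel_measurable_Omega_AE:
  fixes f g :: "real \<Rightarrow> real"
  assumes "f \<in> borel_measurable dx_Omega" "AE x in dx_Omega. f x = g x"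
  shows "g \<in> borel_measurable dx_Omega"
proof -
  have "(\<lambda>x. if x \<in> Omega then f x else 0) \<in> borel_measurable lebesgue"
    using assms(1) by (intro borel_measurable_if_I) auto
  moreover have "AE x in lebesgue. (if x \<in> Omega then f x else 0) = (if x \<in> Omega then g x else 0)"
    using assms(2) unfolding AE_restrict_space_iff[OF Omega_lebesgue]
    by eventually_elim auto
  ultimately have "(\<lambda>x. if x \<in> Omega then g x else 0) \<in> borel_measurable lebesgue"
    by (rule borel_measurable_AE)
  then show ?thesis by (rule borel_measurable_if_D)
qed

lemma Vh_slopes:
  assumes X: "mesh N X" and v: "v \<in> Vh N X"
  obtains p where "\<And>i x. i \<in> {1..N} \<Longrightarrow> x \<in> elem X i \<Longrightarrow> (v has_real_derivative p i) (at x)"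
proof -
  have "\<forall>i\<in>{1..N}. \<exists>p q. \<forall>x\<in>elem X i. v x = p * x + q"
    using v by (simp add: Vh_def)
  then obtain p q where pq: "\<And>i x. i \<in> {1..N} \<Longrightarrow> x \<in> elem X i \<Longrightarrow> v x = p i * x + q i"
    by metis
  have "(v has_real_derivative p i) (at x)" if "i \<in> {1..N}" "x \<in> elem X i" for i x
  proof (rule has_field_derivative_transform_within_open[where S="elem X i"])
    show "((\<lambda>x. p i * x + q i) has_real_derivative p i) (at x)"
      by (auto intro!: derivative_eq_intros)
  qed (use that pq in \<open>auto simp: elem_def\<close>)
  then show thesis by (rule that)
qed

lemma Vh_deriv:
  assumes X: "mesh N X" and v: "v \<in> Vh N X"
  obtains p where "\<And>i x. i \<in> {1..N} \<Longrightarrow> x \<in> elem X i \<Longrightarrow> deriv v x = p i"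
    "square_integrable dx_Omega (deriv v)"
proof -
  obtain p where p: "\<And>i x. i \<in> {1..N} \<Longrightarrow> x \<in> elem X i \<Longrightarrow> (v has_real_derivative p i) (at x)"
    using Vh_slopes[OF X v] by metis
  have d: "deriv v x = p i" if "i \<in> {1..N}" "x \<in> elem X i" for i x
    using p[OF that] by (rule DERIV_imp_deriv)
  have AE: "AE x in dx_Omega. piecewise_const N X p x = deriv v x"
    by (rule AE_mesh[OF X]) (simp add: d piecewise_const_elem[OF X])
  note pc = piecewise_const_square_integrable[of N X p]
  have "square_integrable dx_Omega (deriv v)"
    by (rule square_integrable_cong_AE[OF pc borel_measurable_Omega_AE[OF _ AE] AE])
       (use pc in \<open>simp add: square_integrable_def\<close>)
  with d show thesis by (rule that)
qed

lemma Vh_H10: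
  assumes X: "mesh N X" and v: "v \<in> Vh N X"
  shows "H10 v (deriv v)"
proof -
  obtain p where p: "\<And>i x. i \<in> {1..N} \<Longrightarrow> x \<in> elem X i \<Longrightarrow> (v has_real_derivative p i) (at x)"
    using Vh_slopes[OF X v] by metis
  have sq: "square_integrable dx_Omega (deriv v)"
    using Vh_deriv[OF X v] by metis
  have cont: "continuous_on {0..1} v" and v0: "v 0 = 0" and v1: "v 1 = 0"
    using v by (auto simp: Vh_def)
  have prim: "prim (deriv v) x = v x" if x: "x \<in> {0..1}" for x
  proof -
    have "(deriv v has_integral v x - v 0) {0..x}"
    proof (rule fundamental_theorem_of_calculus_strong[of "X ` {0..N} \<union> {0, 1}"])
      fix y assume y: "y \<in> {0..x} - (X ` {0..N} \<union> {0, 1})"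
      then obtain i where i: "i \<in> {1..N}" "y \<in> elem X i"
        using elem_cover[OF X, of y] x by force
      then show "(v has_vector_derivative deriv v y) (at y)"
        using p[OF i] DERIV_imp_deriv[OF p[OF i]]
        by (simp add: has_real_derivative_iff_has_vector_derivative)
    qed (use x cont in \<open>auto intro: continuous_on_subset\<close>)
    then show ?thesis
      using x v0 Omega.square_integrable_integrable[OF sq]
      by (simp add: prim_eq_integral integral_unique)
  qed
  show ?thesis
  proof (rule H10_prim[OF sq])
    show "(LINT x|dx_Omega. deriv v x) = 0" using prim[of 1] v1 by (simp add: prim_1)
    show "v \<in> borel_measurable dx_Omega" by (rule continuous_on_measurable_Omega[OF cont])
    show "AE x in dx_Omega. v x = prim (deriv v) x"
      by (rule AE_I2) (simp add: prim)
  qed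
qed

lemma prim_interval:
  assumes g: "integrable dx_Omega g" and xy: "0 \<le> x" "x \<le> y" "y \<le> 1"
  shows "prim g y - prim g x = integral {x..y} g"
proof -
  have "integral {0..x} g + integral {x..y} g = integral {0..y} g"
    using xy by (intro Henstock_Kurzweil_Integration.integral_combine
        integrable_on_subinterval[OF integrable_on_01[OF g]]) auto
  then show ?thesis using xy by (simp add: prim_eq_integral[OF g])
qed

text \<open>Conversely, the primitive of a piecewise constant function of mean zero is a finite element function.\<close>

lemma prim_piecewise_const_Vh:
  assumes X: "mesh N X" and 0: "(LINT x|dx_Omega. piecewise_const N X p x) = 0"
  shows "prim (piecewise_const N X p) \<in> Vh N X"
    and "AE x in dx_Omega. deriv (prim (piecewise_const N X p)) x = piecewise_const N X p x"
proof -
  let ?g = "piecewise_const N X p"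
  note int = Omega.square_integrable_integrable[OF piecewise_const_square_integrable[of N X p]]
  have lin: "\<exists>q. \<forall>x\<in>elem X i. prim ?g x = p i * x + q" if i: "i \<in> {1..N}" for i
  proof -
    have step: "prim ?g y - prim ?g x = p i * (y - x)"
      if xy: "x \<le> y" "x \<in> elem X i" "y \<in> elem X i" for x y
    proof -
      have "integral {x..y} ?g = integral {x..y} (\<lambda>_. p i)"
        using xy by (intro Henstock_Kurzweil_Integration.integral_cong piecewise_const_elem[OF X i])
                    (auto simp: elem_def)
      then show ?thesis
        using prim_interval[OF int, of x y] elem_subset[OF X i] xy by (force simp: mult.commute)
    qed
    define z where "z = (X (i - 1) + X i) / 2"
    have z: "z \<in> elem X i" using elem_size_pos[OF X i] by (auto simp: z_def elem_def elem_size_def)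
    have "prim ?g x = p i * x + (prim ?g z - p i * z)" if "x \<in> elem X i" for x
      using step[of x z] step[of z x] that z by (cases "x \<le> z") (auto simp: algebra_simps)
    then show ?thesis by blast
  qed
  have "prim ?g 0 = 0" by (simp add: prim_eq_integral[OF int])
  moreover have "prim ?g 1 = 0" using 0 by (simp add: prim_1)
  ultimately show Vh: "prim ?g \<in> Vh N X"
    unfolding Vh_def using prim_continuous[OF int] lin by blast
  show "AE x in dx_Omega. deriv (prim ?g) x = ?g x"
  proof (rule AE_mesh[OF X])
    fix x i assume i: "i \<in> {1..N}" "x \<in> elem X i"
    obtain q where q: "\<And>x. x \<in> elem X i \<Longrightarrow> prim ?g x = p i * x + q" using lin[OF i(1)] by blast
    have "((\<lambda>x. p i * x + q) has_real_derivative p i) (at x)"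
      by (auto intro!: derivative_eq_intros)
    then have "(prim ?g has_real_derivative p i) (at x)"
      by (rule has_field_derivative_transform_within_open[where S="elem X i"])
         (use i q in \<open>auto simp: elem_def\<close>)
    then show "deriv (prim ?g) x = ?g x"
      by (simp add: DERIV_imp_deriv piecewise_const_elem[OF X i])
  qed
qed

section \<open>Localization to one element\<close>

text \<open>
  For \<open>d\<close> the derivative of a function \<open>v\<close> in \<open>H\<^sub>0\<^sup>1(\<Omega>)\<close>, the function \<open>prim e\<close> is \<open>v\<close> minus its linear
  interpolant on the \<open>i\<close>-th element, extended by zero. It belongs to \<open>H\<^sub>0\<^sup>1(\<Omega>)\<close>, and its norm is of first
  order in \<open>h\<^sub>i\<close>: it is bounded pointwise by \<open>\<surd>h\<^sub>i \<parallel>e\<parallel>\<close>, and \<open>\<parallel>e\<parallel>\<close> does not exceed the norm of \<open>d\<close> on the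
  element, because the mean value is subtracted.
\<close>

lemma local_part:
  fixes d :: "real \<Rightarrow> real"
  assumes X: "mesh N X" and i: "i \<in> {1..N}" and d: "square_integrable dx_Omega d"
  defines "m \<equiv> (LINT x|dx_Omega. indicator (elem X i) x * d x) / elem_size X i"
  defines "e \<equiv> \<lambda>x. indicator (elem X i) x * (d x - m)"
  shows "H10 (prim e) e"
    and "\<And>x. x \<in> Omega \<Longrightarrow> x \<notin> elem X i \<Longrightarrow> prim e x = 0"
    and "L2norm dx_Omega (prim e) \<le> elem_size X i * elem_norm X i d"
proof -
  define K where "K = (indicator (elem X i) :: real \<Rightarrow> real)"
  define h where "h = elem_size X i"
  have h: "h > 0" using elem_size_pos[OF X i] by (simp add: h_def)
  have K01: "K x * K x = K x" "K x \<ge> 0" "\<bar>K x\<bar> \<le> 1" for x by (auto simp: K_def indicator_def)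
  have sqK: "square_integrable dx_Omega K"
    unfolding K_def by (intro Omega.square_integrable_bounded[of _ 1] measurable_indicator_Omega)
      (auto simp: indicator_def)
  have intK: "(LINT x|dx_Omega. K x) = h"
    unfolding K_def h_def by (rule integral_indicator_elem[OF X i])
  have normK: "L2norm dx_Omega K = sqrt h"
    using intK by (simp add: L2norm_def power2_eq_square K01)
  have sqKd: "square_integrable dx_Omega (\<lambda>x. K x * d x)"
    unfolding K_def by (intro square_integrable_indicator d elem_borel)
  have e: "e = (\<lambda>x. K x * d x - m * K x)"
    by (auto simp: e_def K_def fun_eq_iff algebra_simps)
  have sqe: "square_integrable dx_Omega e"
    unfolding e by (intro square_integrable_diff sqKd square_integrable_cmult sqK)
  note inte = Omega.square_integrable_integrable[OF sqe]
  have mh: "(LINT x|dx_Omega. K x * d x) = m * h"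
    using h by (simp add: m_def K_def h_def)
  have e0: "(LINT x|dx_Omega. e x) = 0"
    using sqKd sqK mh intK by (simp add: e Omega.square_integrable_integrable)
  show "H10 (prim e) e"
    by (rule H10_prim[OF sqe e0 prim_measurable[OF inte]]) simp
  show zero: "prim e x = 0" if x: "x \<in> Omega" "x \<notin> elem X i" for x
  proof (cases "x \<le> X (i - 1)")
    case True
    then have "(\<lambda>t. indicator {..x} t * e t) = (\<lambda>_. 0)"
      by (auto simp: e_def indicator_def elem_def fun_eq_iff)
    then show ?thesis by (simp add: prim_def)
  next
    case False
    then have "X i \<le> x" using x by (simp add: elem_def)
    then have "(\<lambda>t. indicator {..x} t * e t) = e"
      by (auto simp: e_def indicator_def elem_def fun_eq_iff)
    then show ?thesis using e0 by (simp add: prim_def)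
  qed
  have norme: "L2norm dx_Omega e \<le> L2norm dx_Omega (\<lambda>x. K x * d x)"
  proof -
    have "(LINT x|dx_Omega. (e x)\<^sup>2) = (LINT x|dx_Omega. (K x * d x)\<^sup>2 - 2 * m * (K x * d x) + m\<^sup>2 * K x)"
      by (intro Bochner_Integration.integral_cong refl)
         (auto simp: e K_def indicator_def power2_eq_square algebra_simps)
    also have "\<dots> = (LINT x|dx_Omega. (K x * d x)\<^sup>2) - 2 * m * (m * h) + m\<^sup>2 * h"
      using sqKd sqK by (simp add: Omega.square_integrable_integrable square_integrable_def mh intK
          Omega.square_integrable_integrable[OF sqKd] Omega.square_integrable_integrable[OF sqK])
    also have "\<dots> = (LINT x|dx_Omega. (K x * d x)\<^sup>2) - m\<^sup>2 * h"
      by (simp add: power2_eq_square)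
    also have "\<dots> \<le> (LINT x|dx_Omega. (K x * d x)\<^sup>2)" using h by simp
    finally show ?thesis by (simp add: L2norm_def)
  qed
  have bound: "\<bar>prim e x\<bar> \<le> sqrt h * L2norm dx_Omega e" for x
  proof -
    have "\<bar>prim e x\<bar> \<le> (LINT t|dx_Omega. \<bar>e t\<bar>)" by (rule prim_abs_le[OF inte])
    also have "\<dots> = (LINT t|dx_Omega. K t * \<bar>e t\<bar>)"
      by (intro Bochner_Integration.integral_cong refl) (auto simp: e_def K_def indicator_def)
    also have "\<dots> \<le> L2norm dx_Omega K * L2norm dx_Omega (\<lambda>t. \<bar>e t\<bar>)"
      by (rule order.trans[OF abs_ge_self Cauchy_Schwarz_integral[OF sqK]])
         (use sqe in \<open>auto simp: square_integrable_def\<close>)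
    also have "\<dots> = sqrt h * L2norm dx_Omega e" unfolding normK by (simp add: L2norm_def)
    finally show ?thesis .
  qed
  have "L2norm dx_Omega (prim e) = L2norm dx_Omega (\<lambda>x. prim e x * K x)"
    unfolding L2norm_def
    by (intro arg_cong[of _ _ sqrt] Bochner_Integration.integral_cong refl)
       (use zero in \<open>auto simp: K_def indicator_def\<close>)
  also have "\<dots> \<le> (sqrt h * L2norm dx_Omega e) * L2norm dx_Omega K"
    by (rule L2norm_bounded_mult[OF sqK prim_measurable[OF inte]]) (use bound h in auto)
  also have "\<dots> = h * L2norm dx_Omega e" using h by (simp add: normK)
  also have "\<dots> \<le> h * L2norm dx_Omega (\<lambda>x. K x * d x)" using norme h by simp
  finally show "L2norm dx_Omega (prim e) \<le> elem_size X i * elem_norm X i d"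
    by (simp add: h_def K_def)
qed

section \<open>The energy estimate\<close>

lemma Linf_mult:
  assumes "g \<in> Linf" "square_integrable dx_Omega f"
  shows "square_integrable dx_Omega (\<lambda>x. g x * f x)"
  using assms by (auto simp: Linf_def intro: square_integrable_bounded_mult)

lemma Linf_L2norm_bound:
  assumes "g \<in> Linf"
  shows "\<exists>K\<ge>0. \<forall>f. square_integrable dx_Omega f \<longrightarrow> L2norm dx_Omega (\<lambda>x. g x * f x) \<le> K * L2norm dx_Omega f"
proof -
  obtain K where m: "g \<in> borel_measurable dx_Omega" and K: "AE x in dx_Omega. \<bar>g x\<bar> \<le> K"
    using assms by (auto simp: Linf_def)
  have "AE x in dx_Omega. \<bar>g x\<bar> \<le> max K 0" using K by eventually_elim auto
  then show ?thesis
    by (intro exI[of _ "max K 0"]) (auto intro: L2norm_bounded_mult[OF _ m])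
qed

lemma Linf_square_integrable:
  assumes "g \<in> Linf"
  shows "square_integrable dx_Omega g"
  using assms by (auto simp: Linf_def intro: Omega.square_integrable_bounded)

lemma H10_diff:
  assumes "H10 v dv" "H10 w dw"
  shows "H10 (\<lambda>x. v x - w x) (\<lambda>x. dv x - dw x)"
proof -
  note V = H10_D[OF assms(1)] and W = H10_D[OF assms(2)]
  note int = V(2)[THEN Omega.square_integrable_integrable] W(2)[THEN Omega.square_integrable_integrable]
  have "AE x in dx_Omega. v x - w x = prim (\<lambda>x. dv x - dw x) x"
    using V(4) W(4) by eventually_elim (simp add: prim_diff int)
  then show ?thesis
    unfolding H10_iff using V W int by (auto intro: square_integrable_diff)
qed

lemma prim_add:
  assumes "integrable dx_Omega f" "integrable dx_Omega g"
  shows "prim (\<lambda>x. f x + g x) x = prim f x + prim g x"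
  using assms by (simp add: prim_def distrib_left integrable_indicator_Omega)

lemma prim_cong_AE:
  assumes "f \<in> borel_measurable dx_Omega" "g \<in> borel_measurable dx_Omega" "AE x in dx_Omega. f x = g x"
  shows "prim f = prim g"
  unfolding prim_def
  by (intro ext integral_cong_AE borel_measurable_times measurable_indicator_Omega assms)
     (use assms(3) in \<open>auto elim: eventually_mono\<close>)

lemma square_integrable_prim:
  "square_integrable dx_Omega d \<Longrightarrow> square_integrable dx_Omega (prim d)"
  by (intro prim_square_integrable Omega.square_integrable_integrable)

text \<open>Coefficients of a coercive convection-diffusion-reaction problem.\<close>

locale elliptic =
  fixes a da b db c :: "real \<Rightarrow> real" and a0 :: real
  assumes a: "W1inf a da" and b: "W1inf b db" and c: "c \<in> Linf"
    and a0: "a0 > 0" "AE x in dx_Omega. a x \<ge> a0"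
    and pos: "AE x in dx_Omega. c x - 1 / 2 * db x \<ge> 0"
begin

lemma coeffs_Linf: "a \<in> Linf" "da \<in> Linf" "b \<in> Linf" "db \<in> Linf"
  using a b by (auto simp: W1inf_def)

lemma B_form_split:
  assumes "square_integrable dx_Omega w" "square_integrable dx_Omega dw"
    and "square_integrable dx_Omega v" "square_integrable dx_Omega dv"
  shows "B_form a b c w dw v dv =
    (LINT x|dx_Omega. a x * dw x * dv x) + (LINT x|dx_Omega. b x * dw x * v x)
     + (LINT x|dx_Omega. c x * w x * v x)"
  unfolding B_form_def
  by (intro trans[OF Bochner_Integration.integral_add] arg_cong2[of _ _ _ _ plus] refl
      Bochner_Integration.integral_add Bochner_Integration.integrable_add
      square_integrable_mult Linf_mult coeffs_Linf c assms)

text \<open>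
  By \<open>weak_deriv_square\<close> the convection term contributes \<open>-1/2 b'\<close> to the reaction coefficient, and
  \<open>c - 1/2 b'\<close> is nonnegative.
\<close>

lemma coercive:
  assumes "H10 v dv"
  shows "a0 * (L2norm dx_Omega dv)\<^sup>2 \<le> B_form a b c v dv v dv"
proof -
  note D = H10_D[OF assms]
  have "B_form a b c v dv v dv =
    (LINT x|dx_Omega. a x * dv x * dv x) + (LINT x|dx_Omega. b x * dv x * v x)
     + (LINT x|dx_Omega. c x * v x * v x)"
    by (rule B_form_split) (use D in auto)
  also have "(LINT x|dx_Omega. b x * dv x * v x) = (LINT x|dx_Omega. - (1 / 2) * (db x * v x * v x))"
    using weak_deriv_square[OF b assms] by simp
  finally have B: "B_form a b c v dv v dv = (LINT x|dx_Omega. a x * dv x * dv x)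
     + ((LINT x|dx_Omega. - (1 / 2) * (db x * v x * v x)) + (LINT x|dx_Omega. c x * v x * v x))"
    by simp
  have "(LINT x|dx_Omega. - (1 / 2) * (db x * v x * v x)) + (LINT x|dx_Omega. c x * v x * v x) =
      (LINT x|dx_Omega. - (1 / 2) * (db x * v x * v x) + c x * v x * v x)"
    by (intro Bochner_Integration.integral_add[symmetric] integrable_mult_right square_integrable_mult
        Linf_mult coeffs_Linf c D)
  also have "\<dots> \<ge> 0"
  proof (rule integral_nonneg_AE)
    show "AE x in dx_Omega. 0 \<le> - (1 / 2) * (db x * v x * v x) + c x * v x * v x"
      using pos
    proof eventually_elim
      case (elim x)
      from mult_nonneg_nonneg[OF elim zero_le_square[of "v x"]]
      show ?case by (simp add: algebra_simps)
    qed
  qed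
  finally have nonneg: "(LINT x|dx_Omega. - (1 / 2) * (db x * v x * v x)) + (LINT x|dx_Omega. c x * v x * v x) \<ge> 0" .
  have "a0 * (L2norm dx_Omega dv)\<^sup>2 = (LINT x|dx_Omega. a0 * (dv x)\<^sup>2)"
    by (simp add: L2norm_sq)
  also have "\<dots> \<le> (LINT x|dx_Omega. a x * dv x * dv x)"
  proof (rule integral_mono_AE)
    show "AE x in dx_Omega. a0 * (dv x)\<^sup>2 \<le> a x * dv x * dv x"
      using a0(2) by eventually_elim (simp add: power2_eq_square mult_right_mono mult.assoc)
    show "integrable dx_Omega (\<lambda>x. a0 * (dv x)\<^sup>2)"
      using D(2) by (simp add: square_integrable_def)
    show "integrable dx_Omega (\<lambda>x. a x * dv x * dv x)"
      by (intro square_integrable_mult Linf_mult coeffs_Linf D)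
  qed
  finally show ?thesis using B nonneg by linarith
qed

lemma residual_square_integrable:
  assumes "square_integrable dx_Omega f" "square_integrable dx_Omega w" "square_integrable dx_Omega dw"
  shows "square_integrable dx_Omega (residual da b c f w dw)"
  unfolding residual_def
  by (intro square_integrable_diff square_integrable_add Linf_mult coeffs_Linf c assms)

text \<open>
  The weak residual of \<open>w\<close>, tested with a function supported in one element on which \<open>w'\<close> is constant,
  is the integral against the strong residual: constancy of \<open>w'\<close> lets the weak derivative of
  the coefficient \<open>a\<close> alone account for the integration by parts.
\<close>

lemma local_residual:
  assumes X: "mesh N X" and i: "i \<in> {1..N}"
    and sq: "square_integrable dx_Omega f" "square_integrable dx_Omega w" "square_integrable dx_Omega dw"
    and dw: "\<And>x. x \<in> elem X i \<Longrightarrow> dw x = p"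
    and v: "H10 v dv" "\<And>x. x \<in> Omega \<Longrightarrow> x \<notin> elem X i \<Longrightarrow> v x = 0 \<and> dv x = 0"
  shows "inner_L2 f v - B_form a b c w dw v dv = (LINT x|dx_Omega. residual da b c f w dw x * v x)"
proof -
  note D = H10_D[OF v(1)]
  have "(LINT x|dx_Omega. a x * dw x * dv x) = (LINT x|dx_Omega. p * (a x * dv x))"
    by (intro Bochner_Integration.integral_cong refl) (use dw v(2) in force)
  also have "\<dots> = p * (LINT x|dx_Omega. a x * dv x)" by simp
  also have "(LINT x|dx_Omega. a x * dv x) = - (LINT x|dx_Omega. da x * v x)"
    by (rule weak_deriv_integration_by_parts[OF _ _ _ v(1)])
       (use a in \<open>auto simp: W1inf_def Linf_square_integrable\<close>)
  also have "p * - (LINT x|dx_Omega. da x * v x) = - (LINT x|dx_Omega. p * (da x * v x))" by simp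
  also have "(LINT x|dx_Omega. p * (da x * v x)) = (LINT x|dx_Omega. da x * dw x * v x)"
    by (intro Bochner_Integration.integral_cong refl) (use dw v(2) in force)
  finally have A: "(LINT x|dx_Omega. a x * dw x * dv x) = - (LINT x|dx_Omega. da x * dw x * v x)" .
  note int = square_integrable_mult[OF Linf_mult[OF _ sq(3)] D(1)] square_integrable_mult[OF Linf_mult[OF _ sq(2)] D(1)]
    square_integrable_mult[OF sq(1) D(1)]
  have "(LINT x|dx_Omega. residual da b c f w dw x * v x) =
     (LINT x|dx_Omega. f x * v x + da x * dw x * v x - b x * dw x * v x - c x * w x * v x)"
    by (simp add: residual_def algebra_simps)
  also have "\<dots> = (LINT x|dx_Omega. f x * v x) + (LINT x|dx_Omega. da x * dw x * v x)
     - (LINT x|dx_Omega. b x * dw x * v x) - (LINT x|dx_Omega. c x * w x * v x)"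
    by (simp add: int coeffs_Linf c)
  finally show ?thesis
    using B_form_split[OF sq(2,3) D(1,2)] A by (simp add: inner_L2_def)
qed

text \<open>
  The a posteriori estimate. By Galerkin orthogonality the interpolant of the error may be subtracted
  from the test function in the energy identity, and the remainder is a sum of functions living on
  single elements.
\<close>

theorem error_estimate:
  assumes f: "square_integrable dx_Omega f" and u: "weak_solution a b c f u du"
    and X: "mesh N X" and uh: "fem_solution a b c f N X uh"
  defines "rh \<equiv> residual da b c f uh (deriv uh)"
  shows "a0 * L2norm dx_Omega (\<lambda>x. du x - deriv uh x)
     \<le> sqrt (\<Sum>i=1..N. elem_size X i ^ 3 * (elem_avg X rh i)\<^sup>2)"
proof -
  define duh where "duh = deriv uh"
  define e de where "e = (\<lambda>x. u x - uh x)" and "de = (\<lambda>x. du x - duh x)"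
  have uhV: "uh \<in> Vh N X" using uh by (simp add: fem_solution_def)
  obtain p where p: "\<And>i x. i \<in> {1..N} \<Longrightarrow> x \<in> elem X i \<Longrightarrow> duh x = p i"
    using Vh_deriv[OF X uhV] unfolding duh_def by metis
  have Huh: "H10 uh duh" unfolding duh_def by (rule Vh_H10[OF X uhV])
  have Hu: "H10 u du" using u by (simp add: weak_solution_def)
  have He: "H10 e de" unfolding e_def de_def by (rule H10_diff[OF Hu Huh])
  note Duh = H10_D[OF Huh] and Du = H10_D[OF Hu] and De = H10_D[OF He]
  have sqrh: "square_integrable dx_Omega rh"
    unfolding rh_def duh_def[symmetric] by (rule residual_square_integrable[OF f Duh(1,2)])
  define g0 g1 where "g0 = (\<lambda>x. a x * duh x)" and "g1 = (\<lambda>x. f x - b x * duh x - c x * uh x)"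
  have sqg: "square_integrable dx_Omega g0" "square_integrable dx_Omega g1"
    unfolding g0_def g1_def by (intro square_integrable_diff Linf_mult coeffs_Linf c f Duh)+
  \<comment> \<open>The weak residual of the finite element solution, as a functional of \<open>(v, v')\<close>, and of \<open>v'\<close> alone.\<close>
  define L where "L v dv = (LINT x|dx_Omega. g1 x * v x) - (LINT x|dx_Omega. g0 x * dv x)" for v dv
  define \<Lambda> where "\<Lambda> d = L (prim d) d" for d
  have L: "L v dv = inner_L2 f v - B_form a b c uh duh v dv"
    if v: "square_integrable dx_Omega v" "square_integrable dx_Omega dv" for v dv
  proof -
    note int = square_integrable_mult[OF Linf_mult[OF _ Duh(2)] v(1)] square_integrable_mult[OF Linf_mult[OF _ Duh(1)] v(1)]
      square_integrable_mult[OF f v(1)]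
    have "(LINT x|dx_Omega. g1 x * v x) =
       (LINT x|dx_Omega. f x * v x - b x * duh x * v x - c x * uh x * v x)"
      by (simp add: g1_def algebra_simps)
    also have "\<dots> = (LINT x|dx_Omega. f x * v x) - (LINT x|dx_Omega. b x * duh x * v x)
        - (LINT x|dx_Omega. c x * uh x * v x)"
      by (simp add: int coeffs_Linf c)
    finally show ?thesis
      using B_form_split[OF Duh(1,2) v] by (simp add: L_def inner_L2_def g0_def)
  qed
  have L_cong: "L v dv = L w dw"
    if "square_integrable dx_Omega v" "square_integrable dx_Omega dv" "square_integrable dx_Omega w"
      "square_integrable dx_Omega dw" "AE x in dx_Omega. v x = w x" "AE x in dx_Omega. dv x = dw x" for v dv w dw
    unfolding L_def
    by (intro arg_cong2[of _ _ _ _ minus] integral_cong_AE borel_measurable_times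
        square_integrable_measurable that sqg)
       (use that(5,6) in \<open>auto elim: eventually_mono\<close>)
  have \<Lambda>_cong: "\<Lambda> d = \<Lambda> d'"
    if "square_integrable dx_Omega d" "square_integrable dx_Omega d'" "AE x in dx_Omega. d x = d' x" for d d'
    unfolding \<Lambda>_def prim_cong_AE[OF square_integrable_measurable[OF that(1)] square_integrable_measurable[OF that(2)] that(3)]
    by (intro L_cong square_integrable_prim that) auto
  have \<Lambda>_add: "\<Lambda> (\<lambda>x. d x + d' x) = \<Lambda> d + \<Lambda> d'"
    if d: "square_integrable dx_Omega d" "square_integrable dx_Omega d'" for d d'
    using square_integrable_mult[OF sqg(1) d(1)] square_integrable_mult[OF sqg(1) d(2)]
      square_integrable_mult[OF sqg(2) square_integrable_prim[OF d(1)]]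
      square_integrable_mult[OF sqg(2) square_integrable_prim[OF d(2)]]
    by (simp add: \<Lambda>_def L_def prim_add d Omega.square_integrable_integrable distrib_left)
  have \<Lambda>_sum: "\<Lambda> (\<lambda>x. \<Sum>i\<in>I. d i x) = (\<Sum>i\<in>I. \<Lambda> (d i))"
    if "finite I" "\<And>i. i \<in> I \<Longrightarrow> square_integrable dx_Omega (d i)" for I :: "nat set" and d
    using that
  proof (induction I)
    case empty
    show ?case by (simp add: \<Lambda>_def L_def prim_def)
  next
    case (insert i I)
    then show ?case by (simp add: \<Lambda>_add square_integrable_sum)
  qed
  have "B_form a b c e de e de = L e de"
  proof -
    have "B_form a b c u du e de = inner_L2 f e"
      using u He by (simp add: weak_solution_def)
    moreover have "B_form a b c e de e de = B_form a b c u du e de - B_form a b c uh duh e de"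
    proof -
      note int = square_integrable_mult[OF Linf_mult[OF _ Duh(2)] De(1)]
        square_integrable_mult[OF Linf_mult[OF _ Duh(2)] De(2)]
        square_integrable_mult[OF Linf_mult[OF _ Duh(1)] De(1)]
        square_integrable_mult[OF Linf_mult[OF _ Du(2)] De(1)]
        square_integrable_mult[OF Linf_mult[OF _ Du(2)] De(2)]
        square_integrable_mult[OF Linf_mult[OF _ Du(1)] De(1)]
      have "B_form a b c e de e de = (LINT x|dx_Omega.
         (a x * du x * de x + b x * du x * e x + c x * u x * e x) -
         (a x * duh x * de x + b x * duh x * e x + c x * uh x * e x))"
        unfolding B_form_def
        by (intro Bochner_Integration.integral_cong refl) (simp add: e_def de_def algebra_simps)
      also have "\<dots> = B_form a b c u du e de - B_form a b c uh duh e de"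
        unfolding B_form_def
        by (intro Bochner_Integration.integral_diff Bochner_Integration.integrable_add int coeffs_Linf c)
      finally show ?thesis .
    qed
    ultimately show ?thesis using L[OF De(1,2)] by simp
  qed
  also have "L e de = \<Lambda> de"
    unfolding \<Lambda>_def by (intro L_cong De square_integrable_prim) auto
  also have "\<Lambda> de \<le> (\<Sum>i=1..N. elem_norm X i rh * (elem_size X i * elem_norm X i de))"
  proof -
    \<comment> \<open>On each element \<open>e'\<close> is split into its mean value, which is the slope of the interpolant,
      and a part of mean zero.\<close>
    define m where "m i = (LINT x|dx_Omega. indicator (elem X i) x * de x) / elem_size X i" for i
    define d where "d i = (\<lambda>x. indicator (elem X i) x * (de x - m i))" for i
    let ?I = "piecewise_const N X m"
    note lp = local_part[OF X _ De(2), folded m_def d_def]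
    have sqd: "square_integrable dx_Omega (d i)" if "i \<in> {1..N}" for i
      using H10_D(2)[OF lp(1)[OF that]] .
    note sqI = piecewise_const_square_integrable[of N X m]
    have "AE x in dx_Omega. de x = ?I x + (\<Sum>i=1..N. d i x)"
    proof (rule AE_mesh[OF X])
      fix x i assume i: "i \<in> {1..N}" "x \<in> elem X i"
      show "de x = ?I x + (\<Sum>i=1..N. d i x)"
        using sum_indicator_elem[OF X i, of "\<lambda>i. de x - m i"]
        by (simp add: d_def piecewise_const_elem[OF X i])
    qed
    then have "\<Lambda> de = \<Lambda> (\<lambda>x. ?I x + (\<Sum>i=1..N. d i x))"
      by (intro \<Lambda>_cong De square_integrable_add sqI square_integrable_sum sqd)
    also have "\<dots> = \<Lambda> ?I + (\<Sum>i=1..N. \<Lambda> (d i))"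
    proof -
      have "\<Lambda> (\<lambda>x. \<Sum>i=1..N. d i x) = (\<Sum>i=1..N. \<Lambda> (d i))"
        by (rule \<Lambda>_sum) (auto intro: sqd)
      moreover have "square_integrable dx_Omega (\<lambda>x. \<Sum>i=1..N. d i x)"
        by (intro square_integrable_sum sqd)
      ultimately show ?thesis by (simp only: \<Lambda>_add[OF sqI])
    qed
    also have "\<Lambda> ?I = 0"
    proof -
      have "(LINT x|dx_Omega. ?I x) = (\<Sum>i=1..N. m i * elem_size X i)"
      proof -
        have "(LINT x|dx_Omega. ?I x) = (\<Sum>i=1..N. LINT x|dx_Omega. m i * indicator (elem X i) x)"
          unfolding piecewise_const_def
          by (intro Bochner_Integration.integral_sum integrable_mult_right Omega.square_integrable_integrable
              Omega.square_integrable_bounded[of _ 1] measurable_indicator_Omega) (auto simp: indicator_def)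
        also have "\<dots> = (\<Sum>i=1..N. m i * elem_size X i)"
          by (intro sum.cong refl)
             (simp only: Bochner_Integration.integral_mult_right_zero integral_indicator_elem[OF X])
        finally show ?thesis .
      qed
      also have "\<dots> = (\<Sum>i=1..N. LINT x|dx_Omega. indicator (elem X i) x * de x)"
        using elem_size_pos[OF X] by (intro sum.cong refl) (force simp: m_def)
      also have "\<dots> = 0"
        using integral_mesh[OF X Omega.square_integrable_integrable[OF De(2)]] De(3) by simp
      finally have 0: "(LINT x|dx_Omega. ?I x) = 0" .
      note pV = prim_piecewise_const_Vh[OF X 0]
      have "\<Lambda> ?I = L (prim ?I) (deriv (prim ?I))"
        unfolding \<Lambda>_def using H10_D(2)[OF Vh_H10[OF X pV(1)]] pV(2)
        by (intro L_cong square_integrable_prim sqI) (auto elim: eventually_mono)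
      also have "\<dots> = 0"
        using uh pV(1) H10_D(1,2)[OF Vh_H10[OF X pV(1)]]
        by (simp add: L fem_solution_def duh_def)
      finally show ?thesis .
    qed
    also have "0 + (\<Sum>i=1..N. \<Lambda> (d i)) \<le> (\<Sum>i=1..N. elem_norm X i rh * (elem_size X i * elem_norm X i de))"
      unfolding add_0
    proof (rule sum_mono)
      fix i assume i: "i \<in> {1..N}"
      have z: "prim (d i) x = 0 \<and> d i x = 0" if "x \<in> Omega" "x \<notin> elem X i" for x
        using lp(2)[OF i] that by (simp add: d_def)
      have "\<Lambda> (d i) = (LINT x|dx_Omega. rh x * prim (d i) x)"
        unfolding \<Lambda>_def rh_def duh_def[symmetric]
        using local_residual[OF X i f Duh(1,2) p[OF i] lp(1)[OF i] z] L[OF square_integrable_prim sqd] sqd[OF i] i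
        by simp
      also have "\<dots> = (LINT x|dx_Omega. (indicator (elem X i) x * rh x) * prim (d i) x)"
        by (intro Bochner_Integration.integral_cong refl) (use z in \<open>auto simp: indicator_def\<close>)
      also have "\<dots> \<le> elem_norm X i rh * L2norm dx_Omega (prim (d i))"
        by (intro order.trans[OF abs_ge_self Cauchy_Schwarz_integral] square_integrable_indicator
            sqrh elem_borel square_integrable_prim sqd i)
      also have "\<dots> \<le> elem_norm X i rh * (elem_size X i * elem_norm X i de)"
        by (intro mult_left_mono lp(3) i) simp
      finally show "\<Lambda> (d i) \<le> elem_norm X i rh * (elem_size X i * elem_norm X i de)" .
    qed
    finally show ?thesis .
  qed
  also have "\<dots> \<le> sqrt (\<Sum>i=1..N. elem_size X i ^ 3 * (elem_avg X rh i)\<^sup>2) * L2norm dx_Omega de"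
  proof -
    have "(\<Sum>i=1..N. (elem_norm X i rh * elem_size X i) * elem_norm X i de)\<^sup>2 \<le>
       (\<Sum>i=1..N. (elem_norm X i rh * elem_size X i)\<^sup>2) * (\<Sum>i=1..N. (elem_norm X i de)\<^sup>2)"
      by (rule Cauchy_Schwarz_ineq_sum)
    also have "(\<Sum>i=1..N. (elem_norm X i de)\<^sup>2) = (L2norm dx_Omega de)\<^sup>2"
      by (rule sum_elem_norm_sq[OF X De(2)])
    also have "(\<Sum>i=1..N. (elem_norm X i rh * elem_size X i)\<^sup>2) =
        (\<Sum>i=1..N. elem_size X i ^ 3 * (elem_avg X rh i)\<^sup>2)"
    proof (intro sum.cong refl)
      fix i assume "i \<in> {1..N}"
      note sq = elem_avg_sq(2)[OF X this, of rh]
      have "(elem_norm X i rh * elem_size X i)\<^sup>2 = (elem_norm X i rh)\<^sup>2 * (elem_size X i)\<^sup>2"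
        by (rule power_mult_distrib)
      also have "\<dots> = elem_size X i ^ 3 * (elem_avg X rh i)\<^sup>2"
        unfolding sq[symmetric] by (simp add: power2_eq_square power3_eq_cube)
      finally show "(elem_norm X i rh * elem_size X i)\<^sup>2 = elem_size X i ^ 3 * (elem_avg X rh i)\<^sup>2" .
    qed
    finally have "\<bar>\<Sum>i=1..N. (elem_norm X i rh * elem_size X i) * elem_norm X i de\<bar> \<le>
        sqrt ((\<Sum>i=1..N. elem_size X i ^ 3 * (elem_avg X rh i)\<^sup>2) * (L2norm dx_Omega de)\<^sup>2)"
      by (intro real_le_rsqrt) simp
    then show ?thesis by (simp add: real_sqrt_mult mult.assoc)
  qed
  finally have "a0 * (L2norm dx_Omega de)\<^sup>2 \<le>
      sqrt (\<Sum>i=1..N. elem_size X i ^ 3 * (elem_avg X rh i)\<^sup>2) * L2norm dx_Omega de"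
    using coercive[OF He] by simp
  then have "(a0 * L2norm dx_Omega de) * L2norm dx_Omega de \<le>
      sqrt (\<Sum>i=1..N. elem_size X i ^ 3 * (elem_avg X rh i)\<^sup>2) * L2norm dx_Omega de"
    by (simp add: power2_eq_square mult.assoc)
  moreover have "0 \<le> sqrt (\<Sum>i=1..N. elem_size X i ^ 3 * (elem_avg X rh i)\<^sup>2)"
    using elem_size_pos[OF X] by (intro real_sqrt_ge_zero sum_nonneg mult_nonneg_nonneg) (auto simp: less_imp_le)
  ultimately have "a0 * L2norm dx_Omega de \<le> sqrt (\<Sum>i=1..N. elem_size X i ^ 3 * (elem_avg X rh i)\<^sup>2)"
  proof (cases "L2norm dx_Omega de = 0")
    case False
    then have "L2norm dx_Omega de > 0"
      using L2norm_nonneg[of dx_Omega de] by linarith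
    with \<open>_ * L2norm dx_Omega de \<le> _\<close> show ?thesis
      by (rule mult_right_le_imp_le)
  qed simp
  then show ?thesis by (simp add: de_def duh_def)
qed

end

section \<open>Quasi-equidistributing meshes and averages of the residual\<close>

text \<open>
  \<open>avg_sum\<close> is the cube root of \<open>\<alpha>\<^sub>h\<close>, and \<open>frac_int\<close> is the quantity \<open>\<integral>|g|\<^bsup>2/3\<^esup>\<close> that it approximates. Both are
  subadditive, in contrast to \<open>\<alpha>\<^sub>h\<close> and the quasi-norm.
\<close>

definition avg_sum :: "nat \<Rightarrow> (nat \<Rightarrow> real) \<Rightarrow> (real \<Rightarrow> real) \<Rightarrow> real" where
  "avg_sum N X g = (\<Sum>i=1..N. elem_size X i * elem_avg X g i powr (2 / 3))"

definition frac_int :: "(real \<Rightarrow> real) \<Rightarrow> real" where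
  "frac_int g = (LINT x|dx_Omega. \<bar>g x\<bar> powr (2 / 3))"

lemma powr_two_thirds: "\<bar>x :: real\<bar> powr (2 / 3) = (x\<^sup>2) powr (1 / 3)"
proof -
  have "(x\<^sup>2) powr (1 / 3) = (\<bar>x\<bar> powr 2) powr (1 / 3)" by simp
  also have "\<dots> = \<bar>x\<bar> powr (2 / 3)" by (simp only: powr_powr) simp
  finally show ?thesis ..
qed

lemma cube_powr_third: "x \<ge> 0 \<Longrightarrow> (x powr (1 / 3)) ^ 3 = (x::real)"
  by (cases "x = 0") (simp_all add: powr_power)

lemma elem_avg_nonneg: "mesh N X \<Longrightarrow> i \<in> {1..N} \<Longrightarrow> elem_avg X g i \<ge> 0"
  using elem_avg_sq(1)[of N X i g] elem_size_pos[of N X i] by simp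

lemma elem_avg_powr:
  "mesh N X \<Longrightarrow> i \<in> {1..N} \<Longrightarrow> elem_avg X g i powr (2 / 3) = ((elem_avg X g i)\<^sup>2) powr (1 / 3)"
  using powr_two_thirds[of "elem_avg X g i"] elem_avg_nonneg[of N X i g] by simp

lemma avg_sum_nonneg: "mesh N X \<Longrightarrow> avg_sum N X g \<ge> 0"
  unfolding avg_sum_def by (intro sum_nonneg mult_nonneg_nonneg) (auto dest!: elem_size_pos less_imp_le)

lemma alpha_h_avg_sum: "alpha_h N X g = avg_sum N X g ^ 3"
  by (simp add: alpha_h_def avg_sum_def)

lemma sqrt_alpha_h:
  assumes "mesh N X"
  shows "sqrt (alpha_h N X g) = avg_sum N X g powr (3 / 2)"
proof -
  have "sqrt (alpha_h N X g) = (avg_sum N X g powr 3) powr (1 / 2)"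
    using avg_sum_nonneg[OF assms, of g] by (simp add: alpha_h_avg_sum powr_half_sqrt)
  also have "\<dots> = avg_sum N X g powr (3 / 2)" by (simp only: powr_powr) simp
  finally show ?thesis .
qed

text \<open>
  Since \<open>1 \<le> \<rho>\<^sub>i \<le> 1 + (\<langle>g\<rangle>\<^sub>i\<^sup>2/\<alpha>\<^sub>h)\<^bsup>1/3\<^esup>\<close>, one has \<open>1 \<le> \<sigma>\<^sub>h \<le> 2\<close>. For the third bound only two of the three factors of
  \<open>(\<rho>\<^sub>ih\<^sub>i)\<^sup>3\<close> are estimated by \<open>\<kappa>\<sigma>\<^sub>h/N\<close>, the third one sums up to \<open>\<sigma>\<^sub>h\<close>. This gives \<open>\<kappa>\<^sup>2\<close> instead of \<open>\<kappa>\<^sup>3\<close>,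
  which is what makes the perturbation of \<open>\<alpha>\<^sub>h\<close> depend on \<open>\<kappa>/N\<close> only. In the degenerate case \<open>\<alpha>\<^sub>h = 0\<close> all
  averages vanish and \<open>\<rho>\<^sub>i = 1\<close>, because \<open>1 / 0 = 0\<close>.
\<close>

lemma quasi_equidistributing_bounds:
  assumes q: "quasi_equidistributing \<kappa> N X g"
  shows "\<kappa> \<ge> 1"
    and "\<And>i. i \<in> {1..N} \<Longrightarrow> elem_size X i \<le> 2 * \<kappa> / N"
    and "(\<Sum>i=1..N. elem_size X i ^ 3 * (elem_avg X g i)\<^sup>2) \<le> 8 * alpha_h N X g * (\<kappa> / N)\<^sup>2"
proof -
  have X: "mesh N X" using q by (simp add: quasi_equidistributing_def)
  define h y \<alpha> \<sigma> \<rho> where "h = elem_size X" and "y = elem_avg X g" and "\<alpha> = alpha_h N X g"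
    and "\<sigma> = sigma_h N X g" and "\<rho> = rho N X g"
  have N: "real N > 0" using mesh_pos[OF X] by simp
  have h: "h i > 0" if "i \<in> {1..N}" for i using elem_size_pos[OF X that] by (simp add: h_def)
  have sumh: "(\<Sum>i=1..N. h i) = 1" unfolding h_def by (rule sum_elem_size[OF X])
  have S0: "avg_sum N X g \<ge> 0" by (rule avg_sum_nonneg[OF X])
  have \<alpha>0: "\<alpha> \<ge> 0" using S0 by (simp add: \<alpha>_def alpha_h_avg_sum)
  have \<alpha>S: "\<alpha> powr (1 / 3) = avg_sum N X g"
    using S0 by (simp add: \<alpha>_def alpha_h_avg_sum powr_powr flip: powr_numeral)
  have \<rho>: "\<rho> i = (1 + 1 / \<alpha> * (y i)\<^sup>2) powr (1 / 3)" for i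
    by (simp add: \<rho>_def rho_def \<alpha>_def y_def)
  have arg: "1 / \<alpha> * (y i)\<^sup>2 \<ge> 0" for i using \<alpha>0 by simp
  have \<rho>1: "\<rho> i \<ge> 1" for i unfolding \<rho> using arg[of i] by (intro ge_one_powr_ge_zero) auto
  have \<sigma>: "\<sigma> = (\<Sum>i=1..N. \<rho> i * h i)" by (simp add: \<sigma>_def sigma_h_def \<rho>_def h_def)
  have "(\<Sum>i=1..N. h i) \<le> \<sigma>"
    unfolding \<sigma> using h \<rho>1 by (intro sum_mono) (auto intro: mult_right_mono[of 1, simplified] less_imp_le)
  then have \<sigma>1: "\<sigma> \<ge> 1" using sumh by simp
  have "\<rho> i \<le> 1 + y i powr (2 / 3) / avg_sum N X g" if i: "i \<in> {1..N}" for i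
  proof -
    have "\<rho> i \<le> 1 powr (1 / 3) + (1 / \<alpha> * (y i)\<^sup>2) powr (1 / 3)"
      unfolding \<rho> by (intro powr_add_le arg) auto
    also have "(1 / \<alpha> * (y i)\<^sup>2) powr (1 / 3) = y i powr (2 / 3) / avg_sum N X g"
      using \<alpha>0 elem_avg_powr[OF X i, of g] by (simp add: powr_divide \<alpha>S y_def)
    finally show ?thesis by simp
  qed
  then have "\<sigma> \<le> (\<Sum>i=1..N. (1 + y i powr (2 / 3) / avg_sum N X g) * h i)"
    unfolding \<sigma> using h by (intro sum_mono mult_right_mono) (auto intro: less_imp_le)
  also have "\<dots> = (\<Sum>i=1..N. h i) + (\<Sum>i=1..N. h i * y i powr (2 / 3)) / avg_sum N X g"
    by (simp add: distrib_left sum.distrib sum_divide_distrib mult.commute)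
  also have "\<dots> \<le> 2" unfolding sumh by (simp add: avg_sum_def h_def y_def)
  finally have \<sigma>2: "\<sigma> \<le> 2" .
  have \<rho>h: "\<rho> i * h i \<le> \<kappa> * \<sigma> / N" if "i \<in> {1..N}" for i
    using q that N \<sigma>1 by (auto simp: quasi_equidistributing_def \<rho>_def h_def \<sigma>_def field_simps)
  have "\<sigma> \<le> (\<Sum>i=1..N. \<kappa> * \<sigma> / N)"
    unfolding \<sigma> by (rule sum_mono) (rule \<rho>h[unfolded \<sigma>])
  also have "\<dots> = \<kappa> * \<sigma>" using N by simp
  finally show \<kappa>: "\<kappa> \<ge> 1" using \<sigma>1 by simp
  have \<kappa>\<sigma>: "\<kappa> * \<sigma> / N \<le> 2 * \<kappa> / N"
    using \<sigma>2 \<kappa> N by (intro divide_right_mono) auto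
  show "elem_size X i \<le> 2 * \<kappa> / N" if i: "i \<in> {1..N}" for i
  proof -
    have "1 * h i \<le> \<rho> i * h i" using \<rho>1 h[OF i] by (intro mult_right_mono) auto
    then show ?thesis using \<rho>h[OF i] \<kappa>\<sigma> by (simp add: h_def)
  qed
  have y\<rho>: "(y i)\<^sup>2 \<le> \<alpha> * \<rho> i ^ 3" if i: "i \<in> {1..N}" for i
  proof (cases "\<alpha> = 0")
    case True
    then have "avg_sum N X g = 0" by (simp add: \<alpha>_def alpha_h_avg_sum)
    then have "h i * y i powr (2 / 3) = 0"
      unfolding avg_sum_def h_def y_def
      by (subst (asm) sum_nonneg_eq_0_iff) (use i elem_size_pos[OF X] in \<open>auto intro!: mult_nonneg_nonneg intro: less_imp_le\<close>)
    then show ?thesis using h[OF i] True by simp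
  next
    case False
    then have "\<alpha> * \<rho> i ^ 3 = \<alpha> + (y i)\<^sup>2"
      using cube_powr_third[of "1 + 1 / \<alpha> * (y i)\<^sup>2"] arg[of i] by (simp add: \<rho> distrib_left)
    then show ?thesis using \<alpha>0 by simp
  qed
  have "(\<Sum>i=1..N. h i ^ 3 * (y i)\<^sup>2) \<le> (\<Sum>i=1..N. \<alpha> * (\<kappa> * \<sigma> / N)\<^sup>2 * (\<rho> i * h i))"
  proof (rule sum_mono)
    fix i assume i: "i \<in> {1..N}"
    have 0: "\<rho> i * h i \<ge> 0" using \<rho>1[of i] h[OF i] by simp
    have "h i ^ 3 * (y i)\<^sup>2 \<le> h i ^ 3 * (\<alpha> * \<rho> i ^ 3)"
      using y\<rho>[OF i] h[OF i] by (intro mult_left_mono) auto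
    also have "\<dots> = \<alpha> * ((\<rho> i * h i)\<^sup>2 * (\<rho> i * h i))"
      by (simp add: power2_eq_square power3_eq_cube)
    also have "\<dots> \<le> \<alpha> * ((\<kappa> * \<sigma> / N)\<^sup>2 * (\<rho> i * h i))"
      using 0 \<alpha>0 \<rho>h[OF i] by (intro mult_left_mono mult_right_mono power_mono) auto
    finally show "h i ^ 3 * (y i)\<^sup>2 \<le> \<alpha> * (\<kappa> * \<sigma> / N)\<^sup>2 * (\<rho> i * h i)" by (simp add: mult.assoc)
  qed
  also have "\<dots> = \<alpha> * (\<kappa> * \<sigma> / N)\<^sup>2 * \<sigma>"
    by (simp add: \<sigma> flip: sum_distrib_left)
  also have "\<dots> \<le> \<alpha> * (2 * \<kappa> / N)\<^sup>2 * 2"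
    using \<alpha>0 \<sigma>1 \<sigma>2 \<kappa> \<kappa>\<sigma> N by (intro mult_mono power_mono mult_left_mono) auto
  also have "\<dots> = 8 * \<alpha> * (\<kappa> / N)\<^sup>2"
    by (simp add: power2_eq_square)
  finally show "(\<Sum>i=1..N. elem_size X i ^ 3 * (elem_avg X g i)\<^sup>2) \<le> 8 * alpha_h N X g * (\<kappa> / N)\<^sup>2"
    by (simp add: h_def y_def \<alpha>_def)
qed

lemma frac_integrable:
  assumes "square_integrable dx_Omega g"
  shows "integrable dx_Omega (\<lambda>x. \<bar>g x\<bar> powr (2 / 3))"
  unfolding powr_two_thirds
  using assms by (intro Omega.integrable_powr) (auto simp: square_integrable_def)

lemma frac_int_le_L2norm:
  assumes "square_integrable dx_Omega g"
  shows "frac_int g \<le> L2norm dx_Omega g powr (2 / 3)"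
proof -
  have "frac_int g \<le> measure dx_Omega (space dx_Omega) powr (1 - 1 / 3) * (LINT x|dx_Omega. (g x)\<^sup>2) powr (1 / 3)"
    unfolding frac_int_def powr_two_thirds
    using assms measure_Omega by (intro Omega.integral_powr_le) (auto simp: square_integrable_def)
  also have "\<dots> = \<bar>L2norm dx_Omega g\<bar> powr (2 / 3)"
    unfolding powr_two_thirds measure_Omega L2norm_sq by simp
  finally show ?thesis by simp
qed

lemma frac_int_le_add:
  assumes "square_integrable dx_Omega f" "square_integrable dx_Omega g"
  shows "frac_int f \<le> frac_int g + L2norm dx_Omega (\<lambda>x. f x - g x) powr (2 / 3)"
proof -
  note d = square_integrable_diff[OF assms]
  have "frac_int f \<le> (LINT x|dx_Omega. \<bar>g x\<bar> powr (2 / 3) + \<bar>f x - g x\<bar> powr (2 / 3))"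
    unfolding frac_int_def
    by (intro integral_mono frac_integrable assms Bochner_Integration.integrable_add d powr_abs_le_add_diff) auto
  also have "\<dots> = frac_int g + frac_int (\<lambda>x. f x - g x)"
    unfolding frac_int_def by (intro Bochner_Integration.integral_add frac_integrable assms d)
  also have "\<dots> \<le> frac_int g + L2norm dx_Omega (\<lambda>x. f x - g x) powr (2 / 3)"
    using frac_int_le_L2norm[OF d] by simp
  finally show ?thesis .
qed

lemma avg_sum_le_L2norm:
  assumes X: "mesh N X" and g: "square_integrable dx_Omega g"
  shows "avg_sum N X g \<le> L2norm dx_Omega g powr (2 / 3)"
proof -
  have "avg_sum N X g = (\<Sum>i=1..N. elem_size X i * ((elem_avg X g i)\<^sup>2) powr (1 / 3))"
    unfolding avg_sum_def by (intro sum.cong refl) (simp add: elem_avg_powr[OF X])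
  also have "\<dots> \<le> (\<Sum>i=1..N. elem_size X i * (elem_avg X g i)\<^sup>2) powr (1 / 3)"
    using elem_size_pos[OF X] sum_elem_size[OF X] by (intro sum_powr_le) (auto intro: less_imp_le)
  also have "(\<Sum>i=1..N. elem_size X i * (elem_avg X g i)\<^sup>2) = (\<Sum>i=1..N. (elem_norm X i g)\<^sup>2)"
    by (intro sum.cong refl elem_avg_sq(2)[OF X])
  also have "\<dots> = (L2norm dx_Omega g)\<^sup>2" by (rule sum_elem_norm_sq[OF X g])
  finally show ?thesis using powr_two_thirds[of "L2norm dx_Omega g"] by simp
qed

lemma avg_sum_le_add:
  assumes X: "mesh N X" and f: "square_integrable dx_Omega f" and g: "square_integrable dx_Omega g"
  shows "avg_sum N X f \<le> avg_sum N X g + L2norm dx_Omega (\<lambda>x. f x - g x) powr (2 / 3)"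
proof -
  define d where "d x = f x - g x" for x
  have d: "square_integrable dx_Omega d" unfolding d_def by (rule square_integrable_diff[OF f g])
  have "avg_sum N X f \<le> (\<Sum>i=1..N. elem_size X i * (elem_avg X g i powr (2 / 3) + elem_avg X d i powr (2 / 3)))"
    unfolding avg_sum_def
  proof (intro sum_mono mult_left_mono)
    fix i assume i: "i \<in> {1..N}"
    have h: "elem_size X i > 0" by (rule elem_size_pos[OF X i])
    then show "0 \<le> elem_size X i" by simp
    have "elem_norm X i f = L2norm dx_Omega (\<lambda>x. indicator (elem X i) x * g x + indicator (elem X i) x * d x)"
      by (simp add: d_def algebra_simps)
    also have "\<dots> \<le> elem_norm X i g + elem_norm X i d"
      by (intro L2norm_add_le square_integrable_indicator g d elem_borel)
    finally have "elem_avg X f i \<le> elem_avg X g i + elem_avg X d i"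
      unfolding elem_avg_sq(1)[OF X i] using h by (simp add: divide_right_mono flip: add_divide_distrib)
    then have "elem_avg X f i powr (2 / 3) \<le> (elem_avg X g i + elem_avg X d i) powr (2 / 3)"
      using elem_avg_nonneg[OF X i] by (intro powr_mono2) auto
    also have "\<dots> \<le> elem_avg X g i powr (2 / 3) + elem_avg X d i powr (2 / 3)"
      by (intro powr_add_le elem_avg_nonneg[OF X i]) auto
    finally show "elem_avg X f i powr (2 / 3) \<le> elem_avg X g i powr (2 / 3) + elem_avg X d i powr (2 / 3)" .
  qed
  also have "\<dots> = avg_sum N X g + avg_sum N X d"
    by (simp add: avg_sum_def distrib_left sum.distrib)
  also have "\<dots> \<le> avg_sum N X g + L2norm dx_Omega d powr (2 / 3)"
    using avg_sum_le_L2norm[OF X d] by simp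
  finally show ?thesis unfolding d_def .
qed

lemma frac_int_mesh:
  assumes X: "mesh N X" and g: "square_integrable dx_Omega g"
  shows "frac_int g = (\<Sum>i=1..N. LINT x|dx_Omega. indicator (elem X i) x * \<bar>g x\<bar> powr (2 / 3))"
  unfolding frac_int_def by (rule integral_mesh[OF X frac_integrable[OF g]])

lemma frac_int_le_avg_sum:
  assumes X: "mesh N X" and g: "square_integrable dx_Omega g"
  shows "frac_int g \<le> avg_sum N X g"
  unfolding frac_int_mesh[OF assms] avg_sum_def
proof (rule sum_mono)
  fix i assume i: "i \<in> {1..N}"
  let ?K = "lebesgue_on (elem X i)" and ?h = "elem_size X i"
  have h: "?h > 0" by (rule elem_size_pos[OF X i])
  have K: "elem X i \<in> sets lebesgue" "elem X i \<subseteq> Omega"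
    using elem_subset[OF X i] by (auto simp: elem_def)
  have fin: "finite_measure ?K"
    by (rule finite_measure_lebesgue_on) (simp add: elem_def)
  have meas: "measure ?K (space ?K) = ?h"
    using h by (simp add: measure_restrict_space elem_def elem_size_def)
  have int: "integrable ?K (\<lambda>x. (g x)\<^sup>2)"
    by (rule integrable_restrict_Omega[OF _ K]) (use g in \<open>simp add: square_integrable_def\<close>)
  have "(LINT x|dx_Omega. indicator (elem X i) x * \<bar>g x\<bar> powr (2 / 3)) = (LINT x|?K. ((g x)\<^sup>2) powr (1 / 3))"
    by (simp add: LINT_restrict_Omega[OF K] powr_two_thirds)
  also have "\<dots> \<le> ?h powr (1 - 1 / 3) * (LINT x|?K. (g x)\<^sup>2) powr (1 / 3)"
    using finite_measure.integral_powr_le[OF fin int, of "1 / 3", unfolded meas] h by simp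
  also have "(LINT x|?K. (g x)\<^sup>2) = ?h * (elem_avg X g i)\<^sup>2"
    unfolding elem_avg_sq(2)[OF X i] elem_norm_sq by (rule LINT_restrict_Omega[OF K])
  also have "?h powr (1 - 1 / 3) * (?h * (elem_avg X g i)\<^sup>2) powr (1 / 3) =
      (?h powr (1 - 1 / 3) * ?h powr (1 / 3)) * elem_avg X g i powr (2 / 3)"
    using h by (simp add: powr_mult elem_avg_powr[OF X i])
  also have "?h powr (1 - 1 / 3) * ?h powr (1 / 3) = ?h"
    using h by (simp flip: powr_add)
  finally show "(LINT x|dx_Omega. indicator (elem X i) x * \<bar>g x\<bar> powr (2 / 3)) \<le> ?h * elem_avg X g i powr (2 / 3)" .
qed

lemma frac_int_cong_AE:
  assumes "f \<in> borel_measurable dx_Omega" "g \<in> borel_measurable dx_Omega" "AE x in dx_Omega. f x = g x"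
  shows "frac_int f = frac_int g"
  using assms unfolding frac_int_def by (intro integral_cong_AE) auto

lemma avg_sum_cong_AE:
  assumes X: "mesh N X" and "f \<in> borel_measurable dx_Omega" "g \<in> borel_measurable dx_Omega" "AE x in dx_Omega. f x = g x"
  shows "avg_sum N X f = avg_sum N X g"
  unfolding avg_sum_def
proof (intro sum.cong refl)
  fix i assume i: "i \<in> {1..N}"
  have "elem_norm X i f = elem_norm X i g"
    using assms by (intro L2norm_cong_AE borel_measurable_times measurable_indicator_Omega) auto
  then show "elem_size X i * elem_avg X f i powr (2 / 3) = elem_size X i * elem_avg X g i powr (2 / 3)"
    by (simp only: elem_avg_sq(1)[OF X i])
qed

text \<open>
  The oscillation of \<open>g\<close> on an element is at most the integral \<open>V\<^sub>i\<close> of \<open>|g'|\<close> over it, so that the average exceeds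
  each value of \<open>|g|\<close> there by at most \<open>V\<^sub>i\<close>. Jensen's inequality bounds the sum of the \<open>h\<^sub>i V\<^sub>i\<^bsup>2/3\<^esup>\<close>.
\<close>

lemma avg_sum_le_frac_int:
  assumes X: "mesh N X" and H: "\<And>i. i \<in> {1..N} \<Longrightarrow> elem_size X i \<le> H"
    and g: "square_integrable dx_Omega g" and dg: "integrable dx_Omega dg"
    and rep: "AE x in dx_Omega. g x = m + prim dg x"
  shows "avg_sum N X g \<le> frac_int g + (H * (LINT x|dx_Omega. \<bar>dg x\<bar>)) powr (2 / 3)"
proof -
  define G where "G x = m + prim dg x" for x
  define V where "V i = (LINT x|dx_Omega. indicator (elem X i) x * \<bar>dg x\<bar>)" for i
  have V0: "V i \<ge> 0" for i unfolding V_def by (intro integral_nonneg_AE) auto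
  have Gm: "G \<in> borel_measurable dx_Omega" unfolding G_def using prim_measurable[OF dg] by simp
  have AE: "AE x in dx_Omega. g x = G x" using rep by (simp add: G_def)
  have sqG: "square_integrable dx_Omega G" by (rule square_integrable_cong_AE[OF g Gm AE])
  have osc: "\<bar>G x - G y\<bar> \<le> V i" if "x \<in> elem X i" "y \<in> elem X i" for x y i
  proof -
    have "G x - G y = (LINT t|dx_Omega. indicator {..x} t * dg t - indicator {..y} t * dg t)"
      using dg by (simp add: G_def prim_def integrable_indicator_Omega)
    then have "\<bar>G x - G y\<bar> \<le> (LINT t|dx_Omega. \<bar>indicator {..x} t * dg t - indicator {..y} t * dg t\<bar>)"
      by simp
    also have "\<dots> \<le> V i"
      unfolding V_def
      by (intro integral_mono integrable_abs Bochner_Integration.integrable_diff integrable_indicator_Omega dg)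
         (use that in \<open>auto simp: indicator_def elem_def\<close>)
    finally show ?thesis .
  qed
  have "avg_sum N X G \<le> (\<Sum>i=1..N. (LINT x|dx_Omega. indicator (elem X i) x * \<bar>G x\<bar> powr (2 / 3)) + elem_size X i * V i powr (2 / 3))"
    unfolding avg_sum_def
  proof (rule sum_mono)
    fix i assume i: "i \<in> {1..N}"
    let ?h = "elem_size X i" and ?y = "elem_avg X G i" and ?K = "indicator (elem X i) :: real \<Rightarrow> real"
    have h: "?h > 0" by (rule elem_size_pos[OF X i])
    have intK: "integrable dx_Omega ?K" "(LINT x|dx_Omega. ?K x) = ?h"
      using integral_indicator_elem[OF X i] h not_integrable_integral_eq[of dx_Omega ?K] by fastforce+
    have y: "?y powr (2 / 3) \<le> \<bar>G x\<bar> powr (2 / 3) + V i powr (2 / 3)" if x: "x \<in> elem X i" for x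
    proof -
      have "?h * ?y\<^sup>2 = (LINT t|dx_Omega. ?K t * (G t)\<^sup>2)"
        by (simp add: elem_avg_sq(2)[OF X i] elem_norm_sq)
      also have "\<dots> \<le> (LINT t|dx_Omega. (\<bar>G x\<bar> + V i)\<^sup>2 * ?K t)"
      proof (rule integral_mono)
        show "integrable dx_Omega (\<lambda>t. ?K t * (G t)\<^sup>2)"
          using sqG by (intro integrable_indicator_Omega) (auto simp: square_integrable_def)
        fix t
        show "?K t * (G t)\<^sup>2 \<le> (\<bar>G x\<bar> + V i)\<^sup>2 * ?K t"
        proof (cases "t \<in> elem X i")
          case True
          have "\<bar>G t\<bar> \<le> \<bar>G x\<bar> + V i" using osc[OF True x] by linarith
          then have "(G t)\<^sup>2 \<le> (\<bar>G x\<bar> + V i)\<^sup>2" using power_mono[of "\<bar>G t\<bar>" _ 2] by simp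
          then show ?thesis using True by simp
        qed simp
      qed (use intK in simp)
      also have "\<dots> = (\<bar>G x\<bar> + V i)\<^sup>2 * ?h"
        by (simp only: Bochner_Integration.integral_mult_right_zero intK(2))
      finally have "?y\<^sup>2 \<le> (\<bar>G x\<bar> + V i)\<^sup>2" using h by (simp add: mult.commute)
      then have "?y \<le> \<bar>G x\<bar> + V i" by (rule power2_le_imp_le) (use V0[of i] in simp)
      then have "?y powr (2 / 3) \<le> (\<bar>G x\<bar> + V i) powr (2 / 3)"
        using elem_avg_nonneg[OF X i] by (intro powr_mono2) auto
      also have "\<dots> \<le> \<bar>G x\<bar> powr (2 / 3) + V i powr (2 / 3)"
        using V0 by (intro powr_add_le) auto
      finally show ?thesis .
    qed
    note intG = integrable_indicator_Omega[OF frac_integrable[OF sqG] elem_borel[of X i]]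
    have "?h * ?y powr (2 / 3) = ?y powr (2 / 3) * ?h" by (rule mult.commute)
    also have "\<dots> = (LINT x|dx_Omega. ?y powr (2 / 3) * ?K x)"
      by (simp only: Bochner_Integration.integral_mult_right_zero intK(2))
    also have "\<dots> \<le> (LINT x|dx_Omega. ?K x * \<bar>G x\<bar> powr (2 / 3) + V i powr (2 / 3) * ?K x)"
    proof (rule integral_mono)
      fix x
      show "?y powr (2 / 3) * ?K x \<le> ?K x * \<bar>G x\<bar> powr (2 / 3) + V i powr (2 / 3) * ?K x"
        using y[of x] by (cases "x \<in> elem X i") auto
      show "integrable dx_Omega (\<lambda>x. ?y powr (2 / 3) * ?K x)"
        by (intro integrable_mult_right intK)
      show "integrable dx_Omega (\<lambda>x. ?K x * \<bar>G x\<bar> powr (2 / 3) + V i powr (2 / 3) * ?K x)"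
        by (intro Bochner_Integration.integrable_add intG integrable_mult_right intK)
    qed
    also have "\<dots> = (LINT x|dx_Omega. ?K x * \<bar>G x\<bar> powr (2 / 3)) + (LINT x|dx_Omega. V i powr (2 / 3) * ?K x)"
      by (intro Bochner_Integration.integral_add intG integrable_mult_right intK)
    also have "(LINT x|dx_Omega. V i powr (2 / 3) * ?K x) = V i powr (2 / 3) * ?h"
      by (simp only: Bochner_Integration.integral_mult_right_zero intK(2))
    also have "\<dots> = ?h * V i powr (2 / 3)" by (rule mult.commute)
    finally show "?h * ?y powr (2 / 3) \<le> (LINT x|dx_Omega. ?K x * \<bar>G x\<bar> powr (2 / 3)) + ?h * V i powr (2 / 3)" .
  qed
  also have "\<dots> = frac_int G + (\<Sum>i=1..N. elem_size X i * V i powr (2 / 3))"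
    by (simp only: sum.distrib frac_int_mesh[OF X sqG])
  also have "(\<Sum>i=1..N. elem_size X i * V i powr (2 / 3)) \<le> (\<Sum>i=1..N. elem_size X i * V i) powr (2 / 3)"
    using elem_size_pos[OF X] sum_elem_size[OF X] V0 by (intro sum_powr_le) (auto intro: less_imp_le)
  also have "\<dots> \<le> (H * (LINT x|dx_Omega. \<bar>dg x\<bar>)) powr (2 / 3)"
  proof (intro powr_mono2)
    have "(\<Sum>i=1..N. elem_size X i * V i) \<le> (\<Sum>i=1..N. H * V i)"
      using H V0 by (intro sum_mono mult_right_mono) auto
    also have "\<dots> = H * (LINT x|dx_Omega. \<bar>dg x\<bar>)"
      using integral_mesh[OF X integrable_abs[OF dg]] by (simp add: V_def sum_distrib_left)
    finally show "(\<Sum>i=1..N. elem_size X i * V i) \<le> H * (LINT x|dx_Omega. \<bar>dg x\<bar>)" .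
    show "0 \<le> (\<Sum>i=1..N. elem_size X i * V i)"
      using elem_size_pos[OF X] V0 by (intro sum_nonneg mult_nonneg_nonneg) (auto intro: less_imp_le)
  qed simp
  finally show ?thesis
    using avg_sum_cong_AE[OF X square_integrable_measurable[OF g] Gm AE]
      frac_int_cong_AE[OF square_integrable_measurable[OF g] Gm AE] by simp
qed

text \<open>For a test function the previous lemma gives the limit; the general case follows by density.\<close>

lemma avg_sum_tendsto:
  fixes N :: "nat \<Rightarrow> nat" and H :: "nat \<Rightarrow> real"
  assumes X: "\<And>k. mesh (N k) (X k)" and size: "\<And>k i. i \<in> {1..N k} \<Longrightarrow> elem_size (X k) i \<le> H k"
    and H: "H \<longlonglongrightarrow> 0" and g: "square_integrable dx_Omega g"
  shows "(\<lambda>k. avg_sum (N k) (X k) g) \<longlonglongrightarrow> frac_int g"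
proof (rule LIMSEQ_I)
  fix \<epsilon> :: real assume "\<epsilon> > 0"
  define \<delta> where "\<delta> = (\<epsilon> / 3) powr (3 / 2)"
  have \<delta>: "\<delta> > 0" "\<delta> powr (2 / 3) = \<epsilon> / 3" using \<open>\<epsilon> > 0\<close> by (simp_all add: \<delta>_def powr_powr)
  obtain \<phi> where \<phi>: "\<phi> \<in> test_funs" "L2norm dx_Omega (\<lambda>x. g x - \<phi> x) < \<delta>"
    using test_funs_dense_L2[OF g \<delta>(1)] by blast
  note sm = test_funs_smooth[OF \<phi>(1)]
  note sq = smooth_square_integrable[OF sm]
  have close: "L2norm dx_Omega (\<lambda>x. g x - \<phi> x) powr (2 / 3) \<le> \<epsilon> / 3"
    unfolding \<delta>(2)[symmetric] using \<phi>(2) by (intro powr_mono2) auto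
  have "L2norm dx_Omega (\<lambda>x. \<phi> x - g x) = L2norm dx_Omega (\<lambda>x. g x - \<phi> x)"
    by (simp add: L2norm_def power2_commute)
  then have Rle: "frac_int \<phi> \<le> frac_int g + \<epsilon> / 3"
    using frac_int_le_add[OF sq g] close by simp
  define V where "V = (LINT x|dx_Omega. \<bar>deriv \<phi> x\<bar>)"
  have "(\<lambda>k. (max 0 (H k) * V) powr (2 / 3)) \<longlonglongrightarrow> (max 0 0 * V) powr (2 / 3)"
    by (intro tendsto_powr' tendsto_intros H) (auto simp: V_def)
  then have "\<forall>\<^sub>F k in sequentially. (max 0 (H k) * V) powr (2 / 3) < \<epsilon> / 3"
    using \<open>\<epsilon> > 0\<close> by (intro order_tendstoD(2)) auto
  then obtain k0 where k0: "\<And>k. k \<ge> k0 \<Longrightarrow> (max 0 (H k) * V) powr (2 / 3) < \<epsilon> / 3"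
    by (auto simp: eventually_sequentially)
  have "norm (avg_sum (N k) (X k) g - frac_int g) < \<epsilon>" if "k \<ge> k0" for k
  proof -
    have "avg_sum (N k) (X k) \<phi> \<le> frac_int \<phi> + (max 0 (H k) * V) powr (2 / 3)"
      unfolding V_def
    proof (rule avg_sum_le_frac_int[OF X _ sq smooth_integrable[OF smooth_deriv[OF sm]], of k _ 0])
      show "AE x in dx_Omega. \<phi> x = 0 + prim (deriv \<phi>) x"
        by (rule AE_I2) (simp add: test_fun_prim[OF \<phi>(1)])
      show "elem_size (X k) i \<le> max 0 (H k)" if "i \<in> {1..N k}" for i
        using size[OF that] by simp
    qed
    then have "avg_sum (N k) (X k) g < frac_int g + \<epsilon>"
      using avg_sum_le_add[OF X g sq, of k] close Rle k0[OF that] by linarith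
    then show ?thesis using frac_int_le_avg_sum[OF X g, of k] by simp
  qed
  then show "\<exists>no. \<forall>n\<ge>no. norm (avg_sum (N n) (X n) g - frac_int g) < \<epsilon>" by blast
qed

section \<open>Error bound and asymptotics of \<open>\<alpha>\<^sub>h\<close>\<close>

context elliptic
begin

lemma error_bound:
  assumes f: "square_integrable dx_Omega f" and u: "weak_solution a b c f u du"
    and uh: "fem_solution a b c f N X uh"
    and q: "quasi_equidistributing \<kappa> N X (residual da b c f uh (deriv uh))"
  shows "L2norm dx_Omega (\<lambda>x. du x - deriv uh x)
    \<le> (sqrt 8 / a0) * (\<kappa> * sqrt (alpha_h N X (residual da b c f uh (deriv uh))) / N)"
proof -
  let ?rh = "residual da b c f uh (deriv uh)"
  have X: "mesh N X" using q by (simp add: quasi_equidistributing_def)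
  have "a0 * L2norm dx_Omega (\<lambda>x. du x - deriv uh x) \<le> sqrt (8 * alpha_h N X ?rh * (\<kappa> / N)\<^sup>2)"
    using error_estimate[OF f u X uh] quasi_equidistributing_bounds(3)[OF q]
    by (meson order.trans real_sqrt_le_mono)
  also have "\<dots> = sqrt 8 * (\<kappa> * sqrt (alpha_h N X ?rh) / N)"
    using quasi_equidistributing_bounds(1)[OF q] by (simp add: real_sqrt_mult)
  finally have "L2norm dx_Omega (\<lambda>x. du x - deriv uh x) \<le> (sqrt 8 * (\<kappa> * sqrt (alpha_h N X ?rh) / N)) / a0"
    unfolding pos_le_divide_eq[OF a0(1)] by (subst mult.commute)
  then show ?thesis by (simp add: mult.commute[of a0])
qed

lemma residual_error:
  "\<exists>K\<ge>0. \<forall>f u du N X uh. square_integrable dx_Omega f \<longrightarrow> weak_solution a b c f u du \<longrightarrow> mesh N X \<longrightarrow>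
       fem_solution a b c f N X uh \<longrightarrow>
       L2norm dx_Omega (\<lambda>x. residual da b c f u du x - residual da b c f uh (deriv uh) x)
         \<le> K * L2norm dx_Omega (\<lambda>x. du x - deriv uh x)"
proof -
  obtain Ka where Ka: "Ka \<ge> 0" "\<And>f. square_integrable dx_Omega f \<Longrightarrow> L2norm dx_Omega (\<lambda>x. da x * f x) \<le> Ka * L2norm dx_Omega f"
    using Linf_L2norm_bound[OF coeffs_Linf(2)] by blast
  obtain Kb where Kb: "Kb \<ge> 0" "\<And>f. square_integrable dx_Omega f \<Longrightarrow> L2norm dx_Omega (\<lambda>x. b x * f x) \<le> Kb * L2norm dx_Omega f"
    using Linf_L2norm_bound[OF coeffs_Linf(3)] by blast
  obtain Kc where Kc: "Kc \<ge> 0" "\<And>f. square_integrable dx_Omega f \<Longrightarrow> L2norm dx_Omega (\<lambda>x. c x * f x) \<le> Kc * L2norm dx_Omega f"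
    using Linf_L2norm_bound[OF c] by blast
  show ?thesis
  proof (intro exI[of _ "Ka + Kb + Kc"] conjI allI impI)
    show "Ka + Kb + Kc \<ge> 0" using Ka Kb Kc by simp
    fix f u du N X uh
    assume f: "square_integrable dx_Omega f" and u: "weak_solution a b c f u du" and X: "mesh N X"
      and uh: "fem_solution a b c f N X uh"
    define e de where "e = (\<lambda>x. u x - uh x)" and "de = (\<lambda>x. du x - deriv uh x)"
    have He: "H10 e de"
      unfolding e_def de_def using u uh Vh_H10[OF X]
      by (intro H10_diff) (auto simp: weak_solution_def fem_solution_def)
    note De = H10_D[OF He]
    have "L2norm dx_Omega (\<lambda>x. residual da b c f u du x - residual da b c f uh (deriv uh) x)
      = L2norm dx_Omega (\<lambda>x. (da x * de x - b x * de x) - c x * e x)"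
      by (simp add: residual_def e_def de_def algebra_simps)
    also have "\<dots> \<le> (L2norm dx_Omega (\<lambda>x. da x * de x) + L2norm dx_Omega (\<lambda>x. b x * de x)) + L2norm dx_Omega (\<lambda>x. c x * e x)"
      by (intro order.trans[OF L2norm_diff_le] add_mono L2norm_diff_le order.refl
          square_integrable_diff Linf_mult coeffs_Linf c De)
    also have "\<dots> \<le> (Ka * L2norm dx_Omega de + Kb * L2norm dx_Omega de) + Kc * L2norm dx_Omega de"
      by (intro add_mono Ka Kb order.trans[OF Kc(2)] mult_left_mono Kc(1) H10_poincare[OF He] De)
    finally show "L2norm dx_Omega (\<lambda>x. residual da b c f u du x - residual da b c f uh (deriv uh) x)
         \<le> (Ka + Kb + Kc) * L2norm dx_Omega (\<lambda>x. du x - deriv uh x)"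
      by (simp add: de_def algebra_simps)
  qed
qed

end

text \<open>To be used with \<open>s\<close> the cube root of \<open>\<alpha>\<^sub>h\<close>, so that \<open>s powr (3/2) = \<surd>\<alpha>\<^sub>h\<close>.\<close>

lemma perturbation_powr:
  fixes s n k :: real
  assumes "s \<ge> 0" "n \<ge> 0" "k \<ge> 0" "n \<le> k * s powr (3 / 2)"
  shows "n powr (2 / 3) \<le> k powr (2 / 3) * s"
proof -
  have "n powr (2 / 3) \<le> (k * s powr (3 / 2)) powr (2 / 3)"
    using assms by (intro powr_mono2) auto
  also have "\<dots> = k powr (2 / 3) * s"
    using assms by (simp add: powr_mult powr_powr)
  finally show ?thesis .
qed

theorem theorem2p2:
  fixes a da b db c :: "real \<Rightarrow> real"
  assumes "W1inf a da" and "W1inf b db" and "c \<in> Linf"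
    and "\<exists>a0>0. AE x in dx_Omega. a x \<ge> a0"
    and "AE x in dx_Omega. c x - 1 / 2 * db x \<ge> 0"
  shows "\<exists>C>0. \<exists>cs>0. \<forall>f u du. \<forall>\<kappa>>0.
    f \<in> Lp 2 \<longrightarrow> \<not> (AE x in dx_Omega. f x = 0) \<longrightarrow> weak_solution a b c f u du \<longrightarrow>
    (let r = residual da b c f u du;
         rh = (\<lambda>uh. residual da b c f uh (deriv uh));
         admissible = (\<lambda>N X uh. fem_solution a b c f N X uh \<and>
                                quasi_equidistributing \<kappa> N X (rh uh))
     in
       (\<forall>N X uh. admissible N X uh \<longrightarrow>
          Lp_norm 2 (\<lambda>x. du x - deriv uh x) \<le> C * sqrt (alpha_h N X (rh uh) * \<kappa> ^ 3) / real N)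
     \<and> (\<forall>(n :: nat \<Rightarrow> nat) X uh.
          (\<forall>k. admissible (n k) (X k) (uh k)) \<longrightarrow> filterlim n at_top sequentially \<longrightarrow>
          (\<lambda>k. sqrt (alpha_h (n k) (X k) (rh (uh k)))) \<longlonglongrightarrow> Lp_norm (2 / 3) r)
     \<and> (\<forall>dr. has_weak_deriv r dr \<and> dr \<in> Lp 1 \<longrightarrow>
          (\<forall>N X uh. admissible N X uh \<and> real N > \<kappa> * cs \<longrightarrow>
             (1 + (\<kappa> * cs / real N) powr (2 / 3)) powr (- 3 / 2) * Lp_norm (2 / 3) r
               \<le> sqrt (alpha_h N X (rh uh))
           \<and> sqrt (alpha_h N X (rh uh))
               \<le> (1 - (\<kappa> * cs / real N) powr (2 / 3)) powr (- 3 / 2) *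
                  (Lp_norm (2 / 3) r powr (2 / 3)
                     + (\<kappa> * cs * Lp_norm 1 dr / real N) powr (2 / 3)) powr (3 / 2))))"
proof -
  obtain a0 where "a0 > 0" "AE x in dx_Omega. a x \<ge> a0" using assms(4) by blast
  then interpret elliptic a da b db c a0 using assms by unfold_locales auto
  define C where "C = sqrt 8 / a0"
  have C: "C > 0" using a0 by (simp add: C_def)
  obtain K where K: "K \<ge> 0"
    "\<And>f u du N X uh. square_integrable dx_Omega f \<Longrightarrow> weak_solution a b c f u du \<Longrightarrow> mesh N X \<Longrightarrow>
       fem_solution a b c f N X uh \<Longrightarrow>
       L2norm dx_Omega (\<lambda>x. residual da b c f u du x - residual da b c f uh (deriv uh) x)
         \<le> K * L2norm dx_Omega (\<lambda>x. du x - deriv uh x)"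
    using residual_error by blast
  \<comment> \<open>\<open>K C\<close> controls the perturbation of the residual, 2 comes from the bound \<open>2\<kappa>/N\<close> for the element sizes.\<close>
  define cs where "cs = max 2 (K * C)"
  have cs: "cs > 0" "cs \<ge> 2" "cs \<ge> K * C" by (auto simp: cs_def)
  show ?thesis
    unfolding Let_def
  proof (rule exI[of _ C], rule conjI[OF C], rule exI[of _ cs], rule conjI[OF cs(1)],
      intro conjI allI impI; (elim conjE)?)
    fix f u du and \<kappa> :: real
    assume "\<kappa> > 0" and f: "f \<in> Lp 2" and u: "weak_solution a b c f u du"
    have sqf: "square_integrable dx_Omega f" using f by (simp add: Lp_2_iff)
    define r where "r = residual da b c f u du"
    define rh where "rh uh = residual da b c f uh (deriv uh)" for uh
    define adm where "adm N X uh \<longleftrightarrow> fem_solution a b c f N X uh \<and>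
        quasi_equidistributing \<kappa> N X (residual da b c f uh (deriv uh))" for N X uh
    have Hu: "H10 u du" using u by (simp add: weak_solution_def)
    have sqr: "square_integrable dx_Omega r"
      unfolding r_def by (rule residual_square_integrable[OF sqf H10_D(1,2)[OF Hu]])
    note folds = r_def[symmetric] rh_def[symmetric] adm_def[symmetric]
    have mesh: "mesh N X" "\<kappa> \<ge> 1" "real N > 0" if "adm N X uh" for N X uh
      using that mesh_pos[of N X] quasi_equidistributing_bounds(1)[of \<kappa> N X]
      by (auto simp: adm_def quasi_equidistributing_def)
    have err: "L2norm dx_Omega (\<lambda>x. du x - deriv uh x) \<le> C * (\<kappa> * sqrt (alpha_h N X (rh uh)) / N)"
      if "adm N X uh" for N X uh
      using error_bound[OF sqf u, of N X uh \<kappa>] that by (simp add: adm_def C_def rh_def)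
    have sqrh: "square_integrable dx_Omega (rh uh)" if "adm N X uh" for N X uh
      unfolding rh_def using that mesh(1)[OF that] Vh_H10[of N X uh]
      by (intro residual_square_integrable sqf H10_D[of uh "deriv uh"]) (auto simp: adm_def fem_solution_def)
    have pert: "L2norm dx_Omega (\<lambda>x. r x - rh uh x) powr (2 / 3)
        \<le> (\<kappa> * cs / N) powr (2 / 3) * avg_sum N X (rh uh)" if A: "adm N X uh" for N X uh
    proof (rule perturbation_powr)
      have "L2norm dx_Omega (\<lambda>x. r x - rh uh x) \<le> K * L2norm dx_Omega (\<lambda>x. du x - deriv uh x)"
        unfolding r_def rh_def using A mesh(1)[OF A] by (intro K(2) sqf u) (auto simp: adm_def)
      also have "\<dots> \<le> K * (C * (\<kappa> * sqrt (alpha_h N X (rh uh)) / N))"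
        by (intro mult_left_mono err A K(1))
      also have "\<dots> = (K * C) * (\<kappa> * sqrt (alpha_h N X (rh uh)) / N)" by simp
      also have "\<dots> \<le> cs * (\<kappa> * sqrt (alpha_h N X (rh uh)) / N)"
        using mesh[OF A] by (intro mult_right_mono cs) (simp add: sqrt_alpha_h)
      finally show "L2norm dx_Omega (\<lambda>x. r x - rh uh x) \<le> (\<kappa> * cs / N) * avg_sum N X (rh uh) powr (3 / 2)"
        using mesh(1)[OF A] by (simp add: sqrt_alpha_h mult_ac)
      show "avg_sum N X (rh uh) \<ge> 0" by (rule avg_sum_nonneg[OF mesh(1)[OF A]])
      show "\<kappa> * cs / N \<ge> 0" using \<open>\<kappa> > 0\<close> cs by simp
    qed simp
    have lower: "avg_sum N X r \<le> (1 + (\<kappa> * cs / N) powr (2 / 3)) * avg_sum N X (rh uh)"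
      if A: "adm N X uh" for N X uh
      using avg_sum_le_add[OF mesh(1)[OF A] sqr sqrh[OF A]] pert[OF A] by (simp add: distrib_right)
    have upper: "(1 - (\<kappa> * cs / N) powr (2 / 3)) * avg_sum N X (rh uh) \<le> avg_sum N X r"
      if A: "adm N X uh" for N X uh
    proof -
      have "L2norm dx_Omega (\<lambda>x. rh uh x - r x) = L2norm dx_Omega (\<lambda>x. r x - rh uh x)"
        by (simp add: L2norm_def power2_commute)
      then show ?thesis
        using avg_sum_le_add[OF mesh(1)[OF A] sqrh[OF A] sqr] pert[OF A] by (simp add: left_diff_distrib)
    qed
    have R0: "frac_int r \<ge> 0" unfolding frac_int_def by simp
    have Lpr: "Lp_norm (2 / 3) r = frac_int r powr (3 / 2)"
      by (simp add: Lp_norm_def frac_int_def)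
    have Lpr': "Lp_norm (2 / 3) r powr (2 / 3) = frac_int r"
      unfolding Lpr using R0 by (simp add: powr_powr)
    {
      fix N X uh
      assume "fem_solution a b c f N X uh" "quasi_equidistributing \<kappa> N X (residual da b c f uh (deriv uh))"
      then have A: "adm N X uh" by (simp add: adm_def)
      note m = mesh[OF A]
      have "Lp_norm 2 (\<lambda>x. du x - deriv uh x) \<le> C * (\<kappa> * sqrt (alpha_h N X (rh uh)) / N)"
        unfolding Lp_norm_2 by (rule err[OF A])
      also have "\<dots> \<le> C * (sqrt (\<kappa> ^ 3) * sqrt (alpha_h N X (rh uh)) / N)"
      proof (intro mult_left_mono divide_right_mono mult_right_mono)
        \<comment> \<open>Here \<open>\<kappa> \<ge> 1\<close> is needed, which holds whenever a quasi-equidistributing mesh exists.\<close>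
        have "\<kappa> ^ 2 \<le> \<kappa> ^ 3" using m by (intro power_increasing) auto
        then show "\<kappa> \<le> sqrt (\<kappa> ^ 3)" by (intro real_le_rsqrt)
      qed (use C m in \<open>auto simp: sqrt_alpha_h\<close>)
      also have "\<dots> = C * sqrt (alpha_h N X (rh uh) * \<kappa> ^ 3) / real N"
        by (simp add: real_sqrt_mult)
      finally show "Lp_norm 2 (\<lambda>x. du x - deriv uh x)
          \<le> C * sqrt (alpha_h N X (residual da b c f uh (deriv uh)) * \<kappa> ^ 3) / real N"
        by (simp add: rh_def)
    }
    {
      fix n :: "nat \<Rightarrow> nat" and X uh
      assume adm: "\<forall>k. fem_solution a b c f (n k) (X k) (uh k) \<and>
            quasi_equidistributing \<kappa> (n k) (X k) (residual da b c f (uh k) (deriv (uh k)))"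
        and n: "filterlim n at_top sequentially"
      have A: "adm (n k) (X k) (uh k)" for k using adm by (simp add: adm_def)
      define \<epsilon> where "\<epsilon> k = (\<kappa> * cs / real (n k)) powr (2 / 3)" for k
      have div: "(\<lambda>k. x / real (n k)) \<longlonglongrightarrow> 0" for x
        by (intro tendsto_divide_0[OF tendsto_const] filterlim_at_top_imp_at_infinity
            filterlim_compose[OF filterlim_real_sequentially n])
      have "\<epsilon> \<longlonglongrightarrow> 0 powr (2 / 3)"
        unfolding \<epsilon>_def using \<open>\<kappa> > 0\<close> cs by (intro tendsto_powr' div tendsto_const) auto
      then have \<epsilon>: "\<epsilon> \<longlonglongrightarrow> 0" by simp
      have lim: "(\<lambda>k. avg_sum (n k) (X k) r) \<longlonglongrightarrow> frac_int r"
        using A by (intro avg_sum_tendsto[OF _ _ div[of "2 * \<kappa>"] sqr] mesh(1) quasi_equidistributing_bounds(2))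
          (auto simp: adm_def)
      have "(\<lambda>k. avg_sum (n k) (X k) (rh (uh k))) \<longlonglongrightarrow> frac_int r"
      proof (rule tendsto_sandwich)
        show "(\<lambda>k. avg_sum (n k) (X k) r / (1 + \<epsilon> k)) \<longlonglongrightarrow> frac_int r"
          using tendsto_divide[OF lim tendsto_add[OF tendsto_const \<epsilon>], of 1] by simp
        show "(\<lambda>k. avg_sum (n k) (X k) r / (1 - \<epsilon> k)) \<longlonglongrightarrow> frac_int r"
          using tendsto_divide[OF lim tendsto_diff[OF tendsto_const \<epsilon>], of 1] by simp
        have "1 + \<epsilon> k > 0" for k by (simp add: \<epsilon>_def add_pos_nonneg)
        then show "\<forall>\<^sub>F k in sequentially. avg_sum (n k) (X k) r / (1 + \<epsilon> k) \<le> avg_sum (n k) (X k) (rh (uh k))"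
          using lower[OF A] by (intro always_eventually allI) (simp add: pos_divide_le_eq \<epsilon>_def mult.commute)
        have "\<forall>\<^sub>F k in sequentially. \<epsilon> k < 1" using \<epsilon> by (intro order_tendstoD(2)) auto
        then show "\<forall>\<^sub>F k in sequentially. avg_sum (n k) (X k) (rh (uh k)) \<le> avg_sum (n k) (X k) r / (1 - \<epsilon> k)"
        proof eventually_elim
          case (elim k)
          then show ?case using upper[OF A, of k] by (simp add: pos_le_divide_eq \<epsilon>_def mult.commute)
        qed
      qed
      then have "(\<lambda>k. avg_sum (n k) (X k) (rh (uh k)) powr (3 / 2)) \<longlonglongrightarrow> frac_int r powr (3 / 2)"
        using avg_sum_nonneg[OF mesh(1)[OF A]] by (intro tendsto_powr' tendsto_const) auto
      then show "(\<lambda>k. sqrt (alpha_h (n k) (X k) (residual da b c f (uh k) (deriv (uh k)))))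
          \<longlonglongrightarrow> Lp_norm (2 / 3) (residual da b c f u du)"
        using mesh(1)[OF A] by (simp add: sqrt_alpha_h folds Lpr)
    }
    {
      fix dr N X uh
      assume dr: "has_weak_deriv (residual da b c f u du) dr" "dr \<in> Lp 1"
        and fem: "fem_solution a b c f N X uh" "quasi_equidistributing \<kappa> N X (residual da b c f uh (deriv uh))"
        and big: "\<kappa> * cs < real N"
      have A: "adm N X uh" using fem by (simp add: adm_def)
      note m = mesh[OF A]
      define \<epsilon> where "\<epsilon> = (\<kappa> * cs / real N) powr (2 / 3)"
      have "\<epsilon> < 1 powr (2 / 3)"
        unfolding \<epsilon>_def using big m cs by (intro powr_less_mono2) auto
      then have \<epsilon>: "0 \<le> \<epsilon>" "\<epsilon> < 1" by (auto simp: \<epsilon>_def)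
      define S where "S = avg_sum N X (rh uh)"
      have S0: "S \<ge> 0" unfolding S_def by (rule avg_sum_nonneg[OF m(1)])
      have "frac_int r \<le> (1 + \<epsilon>) * S"
        using frac_int_le_avg_sum[OF m(1) sqr] lower[OF A] by (simp add: \<epsilon>_def S_def)
      then have "frac_int r powr (3 / 2) \<le> ((1 + \<epsilon>) * S) powr (3 / 2)"
        using R0 by (intro powr_mono2) auto
      also have "\<dots> = (1 + \<epsilon>) powr (3 / 2) * S powr (3 / 2)"
        using \<epsilon> S0 by (simp add: powr_mult)
      finally have "(1 + \<epsilon>) powr (- 3 / 2) * frac_int r powr (3 / 2) \<le>
          (1 + \<epsilon>) powr (- 3 / 2) * ((1 + \<epsilon>) powr (3 / 2) * S powr (3 / 2))"
        by (intro mult_left_mono) auto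
      also have "\<dots> = S powr (3 / 2)"
        using \<epsilon> by (simp add: mult.assoc[symmetric] powr_add[symmetric])
      finally show "(1 + (\<kappa> * cs / real N) powr (2 / 3)) powr (- 3 / 2) * Lp_norm (2 / 3) (residual da b c f u du)
          \<le> sqrt (alpha_h N X (residual da b c f uh (deriv uh)))"
        using m(1) by (simp add: \<epsilon>_def S_def sqrt_alpha_h folds Lpr)
      have idr: "integrable dx_Omega dr" using dr(2) by (simp add: Lp_1_iff)
      obtain q where q: "AE x in dx_Omega. r x = q + prim dr x"
        using weak_deriv_L1_prim[OF sqr idr] dr(1) by (auto simp: r_def)
      define V where "V = Lp_norm 1 dr"
      have V: "V = (LINT x|dx_Omega. \<bar>dr x\<bar>)" by (simp add: V_def Lp_norm_1)
      have V0: "V \<ge> 0" unfolding V by simp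
      have "avg_sum N X r \<le> frac_int r + (2 * \<kappa> / N * V) powr (2 / 3)"
        unfolding V using fem(2)
        by (intro avg_sum_le_frac_int[OF m(1) _ sqr idr q] quasi_equidistributing_bounds(2))
      also have "(2 * \<kappa> / N * V) powr (2 / 3) \<le> (\<kappa> * cs * V / N) powr (2 / 3)"
      proof (intro powr_mono2)
        have "(2 * \<kappa>) * V \<le> (\<kappa> * cs) * V" using cs m V0 by (intro mult_right_mono) auto
        then show "2 * \<kappa> / N * V \<le> \<kappa> * cs * V / N" using m by (simp add: divide_right_mono)
      qed (use m V0 in auto)
      finally have "(1 - \<epsilon>) * S \<le> frac_int r + (\<kappa> * cs * V / N) powr (2 / 3)"
        using upper[OF A] by (simp add: S_def \<epsilon>_def)
      then have "((1 - \<epsilon>) * S) powr (3 / 2) \<le> (frac_int r + (\<kappa> * cs * V / N) powr (2 / 3)) powr (3 / 2)"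
        using \<epsilon> S0 by (intro powr_mono2) auto
      then have "(1 - \<epsilon>) powr (- 3 / 2) * ((1 - \<epsilon>) * S) powr (3 / 2) \<le>
          (1 - \<epsilon>) powr (- 3 / 2) * (frac_int r + (\<kappa> * cs * V / N) powr (2 / 3)) powr (3 / 2)"
        by (intro mult_left_mono) auto
      moreover have "(1 - \<epsilon>) powr (- 3 / 2) * ((1 - \<epsilon>) * S) powr (3 / 2) = S powr (3 / 2)"
        using \<epsilon> S0 by (simp add: powr_mult mult.assoc[symmetric] powr_add[symmetric])
      ultimately show "sqrt (alpha_h N X (residual da b c f uh (deriv uh)))
               \<le> (1 - (\<kappa> * cs / real N) powr (2 / 3)) powr (- 3 / 2) *
                  (Lp_norm (2 / 3) (residual da b c f u du) powr (2 / 3)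
                     + (\<kappa> * cs * Lp_norm 1 dr / real N) powr (2 / 3)) powr (3 / 2)"
        using m(1) by (simp add: \<epsilon>_def S_def sqrt_alpha_h folds Lpr' V_def)
    }
  qed
qed

end
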